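(* Let $\mathcal{A}_q(Q)$ be the quantum cluster algebra of type $A_2^{(1)}$ with principal coefficients, and let $$\mathcal{B}=\{\text{quantum cluster monomials}\}\ \sqcup\ \{u_n w^k,\ u_n z^k \mid n\ge 1,\ k\ge 0\}\subset \mathcal{A}_q(Q).$$ Then $\mathcal{B}$ is a bar-invariant positive $\mathbb{ZP}$-basis of $\mathcal{A}_q(Q)$. That is: every element of $\mathcal{B}$ is fixed by the bar-involution; $\mathcal{B}$ is a basis of $\mathcal{A}_q(Q)$ over $\mathbb{ZP}$; and for all $b,b'\in\mathcal{B}$ the coefficients in the expansion of the product $bb'$ as a $\mathbb{ZP}$-linear combination of elements of $\mathcal{B}$ lie in $\mathbb{Z}_{\ge 0}\mathbb{P}$.
   Context: Quantum torus. Let $q$ be a formal parameter and let $\Lambda$ be the skew-symmetric bilinear form on $\mathbb{Z}^6$ (standard basis $\mathbf e_1,\dots,\mathbf e_6$) with $\Lambda(\mathbf e_i,\mathbf e_j)=\lambda_{ij}$, where $$(\lambda_{ij})=\begin{pmatrix}0&0&0&-1&0&0\\0&0&0&0&-1&0\\0&0&0&0&0&-1\\1&0&0&0&-1&-1\\0&1&0&1&0&-1\\0&0&1&1&1&0\end{pmatrix},\qquad \widetilde B=\begin{pmatrix}0&1&1\\-1&0&1\\-1&-1&0\\1&0&0\\0&1&0\\0&0&1\end{pmatrix}.$$ The based quantum torus $\mathcal T$ is the $\mathbb{Z}[q^{\pm 1/2}]$-algebra with $\mathbb{Z}[q^{\pm 1/2}]$-basis $\{X^{\mathbf c}:\mathbf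 c\in\mathbb{Z}^6\}$ and multiplication $X^{\mathbf c}X^{\mathbf d}=q^{\Lambda(\mathbf c,\mathbf d)/2}X^{\mathbf c+\mathbf d}$; $\mathcal F$ is its skew-field of fractions. Put $X_i=X^{\mathbf e_i}$ for $i=1,2,3$ and $y_1=X^{\mathbf e_4}$, $y_2=X^{\mathbf e_5}$, $y_3=X^{\mathbf e_6}$ (the coefficients, forming $\mathbb{P}$). Bar-involution: the $\mathbb{Z}$-linear map on $\mathcal T$ with $\overline{q^{l/2}X^{\mathbf c}}=q^{-l/2}X^{\mathbf c}$ for $l\in\mathbb{Z}$, $\mathbf c\in\mathbb{Z}^6$. Seeds and mutation. A quantum seed is a triple $(\Lambda',\widetilde B',X')$ with $X'=(X_1',\dots,X_6')$ in $\mathcal F$, where $(X')^{\mathbf c}:=q^{-\frac12\sum_{i<j}c_ic_j\lambda'_{ij}}(X_1')^{c_1}\cdots (X_6')^{c_6}$ are the normalized monomials. The mutation in direction $k\in\{1,2,3\}$ replaces $\Lambda'$ by $E^T\Lambda' E$, where $E=(e_{ij})$ has $e_{ij}=\delta_{ij}$ for $j\ne k$, $e_{kk}=-1$, $e_{ik}=[-b'_{ik}]_+$ for $i\ne k$ ($[a]_+=\max(a,0)$); replaces $b'_{ij}$ by $-b'_{ij}$ if $i=k$ or $j=k$, and by $b'_{ij}+\frac12(|b'_{ik}|b'_{kj}+b'_{ik}|b'_{kj}|)$ otherwise; and replaces $X'_k$ by $(X')^{-\mathbf e_k+\sum_i[b'_{ik}]_+\mathbf e_i}+(X')^{-\mathbf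 e_k+\sum_i[-b'_{ik}]_+\mathbf e_i}$, leaving the other $X'_j$ unchanged. The initial seed is $\Sigma_1=(\Lambda,\widetilde B,(X_1,X_2,X_3,y_1,y_2,y_3))$. The first three elements of $X'$ in a seed obtained from $\Sigma_1$ by finitely many mutations form a cluster; its elements are the quantum cluster variables. Quantum cluster monomials are the monomials (with nonnegative exponents) in the quantum cluster variables of a common cluster. Variables. For $m\in\mathbb{Z}$ the seed $\Sigma_m$ has cluster $(X_m,X_{m+1},X_{m+2})$: mutating $\Sigma_m$ in direction 1 replaces $X_m$ by $X_{m+3}$ and, after reordering the first three indices to $(X_{m+1},X_{m+2},X_{m+3})$, gives $\Sigma_{m+1}$; mutating $\Sigma_m$ in direction 3 replaces $X_{m+2}$ by $X_{m-1}$ and, after reordering to $(X_{m-1},X_m,X_{m+1})$, gives $\Sigma_{m-1}$. Further $$w=X^{(1,-1,0,0,1,0)}+X^{(0,-1,1,0,0,0)},\quad z=X^{(0,1,-1,1,0,1)}+X^{(-1,0,-1,1,0,0)}+X^{(-1,1,0,0,0,0)}.$$ The clusters are $\{X_m,X_{m+1},X_{m+2}\}$, $\{X_{2m-1},w,X_{2m+1}\}$, $\{X_{2m},z,X_{2m+2}\}$ ($m\in\mathbb{Z}$), and variables in a common cluster commute. Algebra. $\mathbb{ZP}$ (resp. $\mathbb{Z}_{\ge0}\mathbb{P}$) denotes the Laurent polynomials in $y_1,y_2,y_3$ with coefficients in $\mathbb{Z}[q^{\pm1/2}]$ (resp. $\mathbb{Z}_{\ge0}[q^{\pm1/2}]$),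 inside $\mathcal T$. $\mathcal A_q(Q)$ is the $\mathbb{ZP}$-subalgebra of $\mathcal F$ generated by all quantum cluster variables (it lies in $\mathcal T$). Linear combinations over $\mathbb{ZP}$ are taken with scalars on the left. Elements $u_n$: $u_0=1$, $u_1=wz-q^{-1/2}X^{(0,0,0,1,0,1)}-q^{1/2}X^{(0,0,0,0,1,0)}$, $u_2=u_1^2-2X^{(0,0,0,1,1,1)}$, $u_{n+1}=u_1u_n-X^{(0,0,0,1,1,1)}u_{n-1}$ for $n\ge2$. *)

theory Defs
  imports Complex_Main "HOL-Library.Poly_Mapping" "HOL-Library.Product_Plus"
begin

section \<open>The form and the based quantum torus\<close>

text \<open>Matrices and vectors in the mutation data are functions on the indices \<open>1, 2, \<dots>\<close>;
  values outside the index range are never used.\<close>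

type_synonym z6 = "int \<times> int \<times> int \<times> int \<times> int \<times> int"

fun coord :: "z6 \<Rightarrow> nat \<Rightarrow> int" where
  "coord (c1, c2, c3, c4, c5, c6) i = [c1, c2, c3, c4, c5, c6] ! (i - 1)"

definition evec :: "nat \<Rightarrow> z6" where
  "evec i = (of_bool (i = 1), of_bool (i = 2), of_bool (i = 3),
             of_bool (i = 4), of_bool (i = 5), of_bool (i = 6))"

definition lam0 :: "nat \<Rightarrow> nat \<Rightarrow> int" where
  "lam0 i j =
    [[0, 0, 0, -1,  0,  0],
     [0, 0, 0,  0, -1,  0],
     [0, 0, 0,  0,  0, -1],
     [1, 0, 0,  0, -1, -1],
     [0, 1, 0,  1,  0, -1],
     [0, 0, 1,  1,  1,  0]] ! (i - 1) ! (j - 1)"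

definition bmat0 :: "nat \<Rightarrow> nat \<Rightarrow> int" where
  "bmat0 i j =
    [[ 0,  1, 1],
     [-1,  0, 1],
     [-1, -1, 0],
     [ 1,  0, 0],
     [ 0,  1, 0],
     [ 0,  0, 1]] ! (i - 1) ! (j - 1)"

definition Lambda :: "z6 \<Rightarrow> z6 \<Rightarrow> int" where
  "Lambda c d = (\<Sum>i = 1..6. \<Sum>j = 1..6. coord c i * lam0 i j * coord d j)"

text \<open>\<open>QMon l c\<close> stands for \<open>q\<^bsup>l/2\<^esup> X\<^bsup>c\<^esup>\<close>. These elements form a group under the multiplication of the
  quantum torus; it is written additively because \<open>poly_mapping\<close> takes its convolution product
  from \<open>+\<close> on the keys (which need not commute). The integral group ring \<open>qmon \<Rightarrow>\<^sub>0 int\<close>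
  has \<open>\<int>\<close>-basis \<open>q\<^bsup>l/2\<^esup> X\<^bsup>c\<^esup>\<close>, that is, \<open>\<int>[q\<^bsup>1/2\<^esup>, q\<^bsup>-1/2\<^esup>]\<close>-basis \<open>X\<^bsup>c\<^esup>\<close>, and is the based quantum torus.\<close>

datatype qmon = QMon (qexp: int) (xexp: z6)

instantiation qmon :: monoid_add
begin

definition zero_qmon :: qmon where
  "zero_qmon = QMon 0 0"

definition plus_qmon :: "qmon \<Rightarrow> qmon \<Rightarrow> qmon" where
  "plus_qmon m n = QMon (qexp m + qexp n + Lambda (xexp m) (xexp n)) (xexp m + xexp n)"

lemma Lambda_expand:
  "Lambda (a1, a2, a3, a4, a5, a6) (b1, b2, b3, b4, b5, b6) =
     - a1 * b4 - a2 * b5 - a3 * b6 + a4 * (b1 - b5 - b6) + a5 * (b2 + b4 - b6) + a6 * (b3 + b4 + b5)"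
proof -
  have "{1..6} = {1, 2, 3, 4, 5, 6::nat}"
    by auto
  then show ?thesis
    by (simp add: Lambda_def lam0_def algebra_simps)
qed

instance
proof
  fix a b c :: qmon
  obtain l1 a1 a2 a3 a4 a5 a6 where "a = QMon l1 (a1, a2, a3, a4, a5, a6)"
    by (metis qmon.exhaust prod.exhaust)
  moreover obtain l2 b1 b2 b3 b4 b5 b6 where "b = QMon l2 (b1, b2, b3, b4, b5, b6)"
    by (metis qmon.exhaust prod.exhaust)
  moreover obtain l3 c1 c2 c3 c4 c5 c6 where "c = QMon l3 (c1, c2, c3, c4, c5, c6)"
    by (metis qmon.exhaust prod.exhaust)
  ultimately show "a + b + c = a + (b + c)" "0 + a = a" "a + 0 = a"
    by (simp_all add: plus_qmon_def zero_qmon_def Lambda_expand zero_prod_def algebra_simps)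
qed

end

type_synonym qtorus = "qmon \<Rightarrow>\<^sub>0 int"

definition qh :: "int \<Rightarrow> qtorus" where  \<comment> \<open>\<open>q\<^bsup>l/2\<^esup>\<close>\<close>
  "qh l = Poly_Mapping.single (QMon l 0) 1"

definition Xm :: "z6 \<Rightarrow> qtorus" where  \<comment> \<open>\<open>X\<^bsup>c\<^esup>\<close>\<close>
  "Xm c = Poly_Mapping.single (QMon 0 c) 1"

lemma Lambda_zero [simp]: "Lambda 0 c = 0" "Lambda c 0 = 0"
  by (cases c; simp add: Lambda_expand zero_prod_def)+

lemma qh_mult_Xm: "qh l * Xm c = Poly_Mapping.single (QMon l c) 1"
  by (simp add: qh_def Xm_def mult_single plus_qmon_def)

lemma Xm_mult_qh: "Xm c * qh l = qh l * Xm c"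
  by (simp add: qh_def Xm_def mult_single plus_qmon_def)

lemma qh_0: "qh 0 = 1" and qh_add: "qh (k + l) = qh k * qh l"
  by (simp_all add: qh_def mult_single plus_qmon_def flip: zero_qmon_def)

lemma Xm_mult: "Xm c * Xm d = qh (Lambda c d) * Xm (c + d)"
  by (simp add: qh_def Xm_def mult_single plus_qmon_def)

definition bar :: "qtorus \<Rightarrow> qtorus" where
  "bar p = (\<Sum>m\<in>Poly_Mapping.keys p.
              Poly_Mapping.single (QMon (- qexp m) (xexp m)) (Poly_Mapping.lookup p m))"

text \<open>Since \<open>y\<^sub>1\<^sup>a y\<^sub>2\<^sup>b y\<^sub>3\<^sup>c\<close> equals \<open>X\<^bsup>(0,0,0,a,b,c)\<^esup>\<close> up to a power of \<open>q\<^bsup>1/2\<^esup>\<close>, the Laurent polynomials in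
  \<open>y\<^sub>1, y\<^sub>2, y\<^sub>3\<close> are the elements supported on the following monomials.\<close>

definition coeff_mons :: "qmon set" where
  "coeff_mons = {QMon l (0, 0, 0, a, b, c) | l a b c. True}"

definition ZP :: "qtorus set" where
  "ZP = {p. Poly_Mapping.keys p \<subseteq> coeff_mons}"

definition ZP_nonneg :: "qtorus set" where
  "ZP_nonneg = {p \<in> ZP. \<forall>m. 0 \<le> Poly_Mapping.lookup p m}"

text \<open>The skew-field of fractions of the Ore domain \<open>qtorus\<close>, which is unique up to unique isomorphism,
  as a division ring with an embedding of \<open>qtorus\<close>.\<close>

definition skew_field_of_fractions :: "(qtorus \<Rightarrow> 'f::division_ring) \<Rightarrow> bool" where
  "skew_field_of_fractions \<iota> \<longleftrightarrow>
     \<iota> 1 = 1 \<and> (\<forall>a b. \<iota> (a + b) = \<iota> a + \<iota> b) \<and> (\<forall>a b. \<iota> (a * b) = \<iota> a * \<iota> b) \<and>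
     inj \<iota> \<and> (\<forall>f. \<exists>a b. b \<noteq> 0 \<and> f = \<iota> a * inverse (\<iota> b))"

section \<open>Quantum seeds and mutation\<close>

record 'f qseed =
  slam :: "nat \<Rightarrow> nat \<Rightarrow> int"
  sbmat :: "nat \<Rightarrow> nat \<Rightarrow> int"
  svar :: "nat \<Rightarrow> 'f"

definition pos_part :: "int \<Rightarrow> int" where
  "pos_part a = max a 0"

context
  fixes \<iota> :: "qtorus \<Rightarrow> 'f::division_ring"
begin

definition norm_mon :: "'f qseed \<Rightarrow> (nat \<Rightarrow> int) \<Rightarrow> 'f" where
  "norm_mon S c =
     \<iota> (qh (- (\<Sum>i = 1..6. \<Sum>j = i+1..6. c i * c j * slam S i j)))
       * prod_list (map (\<lambda>i. svar S i powi c i) [1, 2, 3, 4, 5, 6])"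

definition mut_E :: "'f qseed \<Rightarrow> nat \<Rightarrow> nat \<Rightarrow> nat \<Rightarrow> int" where
  "mut_E S k i j =
     (if j \<noteq> k then of_bool (i = j)
      else if i = k then - 1
      else pos_part (- sbmat S i k))"

definition mutate :: "nat \<Rightarrow> 'f qseed \<Rightarrow> 'f qseed" where
  "mutate k S =
     \<lparr>slam = (\<lambda>i j. \<Sum>r = 1..6. \<Sum>s = 1..6. mut_E S k r i * slam S r s * mut_E S k s j),
      sbmat = (\<lambda>i j. if i = k \<or> j = k then - sbmat S i j
         else sbmat S i j
              + (\<bar>sbmat S i k\<bar> * sbmat S k j + sbmat S i k * \<bar>sbmat S k j\<bar>) div 2),
      svar = (svar S)(k :=
         norm_mon S (\<lambda>i. (if i = k then - 1 else 0) + pos_part (sbmat S i k))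
         + norm_mon S (\<lambda>i. (if i = k then - 1 else 0) + pos_part (- sbmat S i k)))\<rparr>"

definition initial_seed :: "'f qseed" where
  "initial_seed = \<lparr>slam = lam0, sbmat = bmat0, svar = (\<lambda>i. \<iota> (Xm (evec i)))\<rparr>"

inductive_set seeds :: "'f qseed set" where
  initial: "initial_seed \<in> seeds"
| mutation: "S \<in> seeds \<Longrightarrow> k \<in> {1, 2, 3} \<Longrightarrow> mutate k S \<in> seeds"

definition cluster_variables :: "'f set" where
  "cluster_variables = {svar S i | S i. S \<in> seeds \<and> i \<in> {1, 2, 3}}"

text \<open>The variables of a cluster commute, so the order of the factors is immaterial.\<close>

definition cluster_monomials :: "'f set" where
  "cluster_monomials =
     {svar S 1 ^ a * svar S 2 ^ b * svar S 3 ^ c | S a b c. S \<in> seeds}"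

inductive_set cluster_algebra :: "'f set" where
  scalar: "p \<in> ZP \<Longrightarrow> \<iota> p \<in> cluster_algebra"
| variable: "x \<in> cluster_variables \<Longrightarrow> x \<in> cluster_algebra"
| add: "x \<in> cluster_algebra \<Longrightarrow> y \<in> cluster_algebra \<Longrightarrow> x + y \<in> cluster_algebra"
| mult: "x \<in> cluster_algebra \<Longrightarrow> y \<in> cluster_algebra \<Longrightarrow> x * y \<in> cluster_algebra"

section \<open>Linear combinations with left coefficients\<close>

definition lincomb :: "('f \<Rightarrow>\<^sub>0 qtorus) \<Rightarrow> 'f" where
  "lincomb c = (\<Sum>b\<in>Poly_Mapping.keys c. \<iota> (Poly_Mapping.lookup c b) * b)"

definition coeffs_on :: "'f set \<Rightarrow> ('f \<Rightarrow>\<^sub>0 qtorus) set" where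
  "coeffs_on B = {c. Poly_Mapping.keys c \<subseteq> B \<and> (\<forall>b. Poly_Mapping.lookup c b \<in> ZP)}"

definition ZP_basis :: "'f set \<Rightarrow> 'f set \<Rightarrow> bool" where
  "ZP_basis B A \<longleftrightarrow>
     B \<subseteq> A \<and>
     (\<forall>x\<in>A. \<exists>c\<in>coeffs_on B. lincomb c = x) \<and>
     (\<forall>c\<in>coeffs_on B. lincomb c = 0 \<longrightarrow> c = 0)"

text \<open>For a basis of an algebra the expansion of each product exists and is unique.\<close>

definition positive_products :: "'f set \<Rightarrow> bool" where
  "positive_products B \<longleftrightarrow>
     (\<forall>b\<in>B. \<forall>b'\<in>B. \<forall>c\<in>coeffs_on B.
        lincomb c = b * b' \<longrightarrow> (\<forall>d. Poly_Mapping.lookup c d \<in> ZP_nonneg))"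

definition bar_fixed :: "'f \<Rightarrow> bool" where
  "bar_fixed x \<longleftrightarrow> (\<exists>t. x = \<iota> t \<and> bar t = t)"

end

section \<open>The elements \<open>w\<close>, \<open>z\<close>, \<open>u\<^sub>n\<close> and the set \<open>\<B>\<close>\<close>

definition w_elem :: qtorus where
  "w_elem = Xm (1, -1, 0, 0, 1, 0) + Xm (0, -1, 1, 0, 0, 0)"

definition z_elem :: qtorus where
  "z_elem = Xm (0, 1, -1, 1, 0, 1) + Xm (-1, 0, -1, 1, 0, 0) + Xm (-1, 1, 0, 0, 0, 0)"

definition u1_elem :: qtorus where
  "u1_elem = w_elem * z_elem - qh (- 1) * Xm (0, 0, 0, 1, 0, 1) - qh 1 * Xm (0, 0, 0, 0, 1, 0)"

fun u_elem :: "nat \<Rightarrow> qtorus" where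
  "u_elem 0 = 1"
| "u_elem (Suc 0) = u1_elem"
| "u_elem (Suc (Suc 0)) = u1_elem ^ 2 - 2 * Xm (0, 0, 0, 1, 1, 1)"
| "u_elem (Suc (Suc (Suc n))) = u1_elem * u_elem (Suc (Suc n)) - Xm (0, 0, 0, 1, 1, 1) * u_elem (Suc n)"

definition uwz_elements :: "(qtorus \<Rightarrow> 'f::division_ring) \<Rightarrow> 'f set" where
  "uwz_elements \<iota> = {\<iota> (u_elem n * w_elem ^ k) | n k. n \<ge> 1} \<union> {\<iota> (u_elem n * z_elem ^ k) | n k. n \<ge> 1}"

definition B_set :: "(qtorus \<Rightarrow> 'f::division_ring) \<Rightarrow> 'f set" where
  "B_set \<iota> = cluster_monomials \<iota> \<union> uwz_elements \<iota>"

end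

theory Submission
  imports Defs "HOL-Library.Multiset"
begin

text \<open>
  Up to coefficient monomials the cluster variables other than \<open>w\<close> and \<open>z\<close> form a bi-infinite sequence
  \<open>x\<^sub>m\<close> that solves the linear recursions \<open>w x\<^sub>m = x\<^sub>m\<^sub>+\<^sub>1 + a x\<^sub>m\<^sub>-\<^sub>1\<close> (\<open>m\<close> even) and
  \<open>z x\<^sub>m = x\<^sub>m\<^sub>+\<^sub>1 + a' x\<^sub>m\<^sub>-\<^sub>1\<close> (\<open>m\<close> odd); all quadratic relations follow from these. Call two of
  the letters \<open>x\<^sub>m, w, z, u\<^sub>n\<close> compatible if they occur together in an element of \<open>\<B>\<close>. Compatible letters
  commute, and a product of two incompatible ones is a nonnegative combination of words that are
  shorter, or of the same length with a smaller sum of squared indices. Hence rewriting expands every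
  word nonnegatively in \<open>\<B>\<close>, which gives spanning and positivity. For independence, every element of \<open>\<B>\<close>
  has lowest part \<open>X\<^bsup>g\<^esup>\<close> with respect to the degree in the \<open>y\<^sub>i\<close>, and \<open>g\<close> determines the element. The
  clusters are the triples \<open>{X\<^sub>m, X\<^sub>m\<^sub>+\<^sub>1, X\<^sub>m\<^sub>+\<^sub>2}\<close> and \<open>{X\<^sub>m, v, X\<^sub>m\<^sub>+\<^sub>2}\<close> with \<open>v \<in> {w, z}\<close>, whose exchange
  matrices have sign-coherent coefficient columns dual to the \<open>g\<close>-vectors.
\<close>

section \<open>Coefficient monomials and homogeneous elements\<close>

text \<open>The coefficients are not central, so powers of q must be tracked everywhere. One grading
  (\<open>homog\<close>) does this: moving a coefficient monomial past a homogeneous element costs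
  only a power of q. It is the g-vector grading, so for a basis letter the same triple serves as
  degree, as leading exponent and, for cluster variables, as the mixed block of Lambda in a seed.
  Two normalizations are used. The \<open>x m\<close> satisfy recursions uniform in m, which yields
  the quadratic relations. The true cluster variables \<open>aX m\<close> differ from them by a
  coefficient monomial for m <= 0 and start in y-degree 0, as seeds and leading terms require. The
  change of normalization between the indices 0 and 1 is what makes the signs of the c-vectors
  depend on m. Positivity rests on Chebyshev identities: u_n is of the first kind in u_1, products
  of distant x_m produce the second kind, and the second kind is a nonnegative combination of the
  first. Uniqueness of expansions comes from leading exponents, not from confluence of the
  rewriting.\<close>

type_synonym z3 = "int \<times> int \<times> int"

definition mon :: "int \<Rightarrow> z3 \<Rightarrow> qtorus" where
  "mon l \<gamma> = (case \<gamma> of (a, b, c) \<Rightarrow> Poly_Mapping.single (QMon l (0, 0, 0, a, b, c)) 1)"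

fun dot :: "z3 \<Rightarrow> z3 \<Rightarrow> int" where
  "dot (a, b, c) (d, e, f) = a * d + b * e + c * f"

text \<open>This is \<open>Lambda\<close> restricted to the coefficient exponents, that is, to the
  last three coordinates.\<close>

fun yform :: "z3 \<Rightarrow> z3 \<Rightarrow> int" where
  "yform (a, b, c) (a', b', c') = a * (- b' - c') + b * (a' - c') + c * (a' + b')"

lemma mon_mult: "mon l \<gamma> * mon l' \<gamma>' = mon (l + l' + yform \<gamma> \<gamma>') (\<gamma> + \<gamma>')"
  by (cases \<gamma>; cases \<gamma>') (simp add: mon_def mult_single plus_qmon_def Lambda_expand algebra_simps)

lemma mon_mult_assoc: "mon l \<gamma> * (mon l' \<gamma>' * t) = mon (l + l' + yform \<gamma> \<gamma>') (\<gamma> + \<gamma>') * t"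
  by (simp flip: mult.assoc add: mon_mult)

lemma mon_0_0 [simp]: "mon 0 (0, 0, 0) = 1"
  by (simp add: mon_def zero_qmon_def zero_prod_def single_one[symmetric] del: single_one)

lemma mon_0_zero [simp]: "mon 0 0 = 1"
  using mon_0_0 by (simp only: zero_prod_def)

lemma yform_self [simp]: "yform \<gamma> \<gamma> = 0"
  by (cases \<gamma>) (simp add: algebra_simps)

lemma yform_uminus [simp]: "yform (- \<gamma>) \<delta> = - yform \<gamma> \<delta>" "yform \<gamma> (- \<delta>) = - yform \<gamma> \<delta>"
  by (cases \<gamma>; cases \<delta>; simp add: algebra_simps)+

lemma yform_zero [simp]: "yform 0 \<delta> = 0" "yform \<delta> 0 = 0"
  by (cases \<delta>; simp add: zero_prod_def)+

lemma yform_commute: "yform \<gamma> \<delta> = - yform \<delta> \<gamma>"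
  by (cases \<gamma>; cases \<delta>) (simp add: algebra_simps)

lemma mon_inverse: "mon (- l) (- \<gamma>) * mon l \<gamma> = 1" "mon l \<gamma> * mon (- l) (- \<gamma>) = 1"
  by (simp_all add: mon_mult)

lemma mon_cancel: "mon l \<gamma> * s = mon l \<gamma> * t \<longleftrightarrow> s = t"
  by (metis mon_inverse(1) mult.assoc mult_1)

lemma dot_add: "dot (\<gamma> + \<gamma>') \<delta> = dot \<gamma> \<delta> + dot \<gamma>' \<delta>" "dot \<delta> (\<gamma> + \<gamma>') = dot \<delta> \<gamma> + dot \<delta> \<gamma>'"
  by (cases \<gamma>; cases \<gamma>'; cases \<delta>; simp add: algebra_simps)+

lemma dot_zero [simp]: "dot 0 \<delta> = 0" "dot \<delta> 0 = 0"
  by (cases \<delta>; simp add: zero_prod_def)+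

lemma dot_uminus [simp]: "dot (- \<gamma>) \<delta> = - dot \<gamma> \<delta>" "dot \<gamma> (- \<delta>) = - dot \<gamma> \<delta>"
  by (cases \<gamma>; cases \<delta>; simp add: algebra_simps)+

text \<open>Conjugation by the coefficient monomials grades the torus by \<open>\<int>\<^sup>3\<close>.\<close>

definition homog :: "qtorus \<Rightarrow> z3 \<Rightarrow> bool" where
  "homog t d \<longleftrightarrow> (\<forall>l \<gamma>. mon l \<gamma> * t = t * mon (l + 2 * dot \<gamma> d) \<gamma>)"

lemma homogD: "homog t d \<Longrightarrow> mon l \<gamma> * t = t * mon (l + 2 * dot \<gamma> d) \<gamma>"
  by (simp only: homog_def)

lemma homog_right: "homog t d \<Longrightarrow> t * mon l \<gamma> = mon (l - 2 * dot \<gamma> d) \<gamma> * t"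
  using homogD[of t d "l - 2 * dot \<gamma> d" \<gamma>] by simp

lemma homog_right_assoc: "homog t d \<Longrightarrow> t * (mon l \<gamma> * s) = mon (l - 2 * dot \<gamma> d) \<gamma> * (t * s)"
  by (simp add: homog_right flip: mult.assoc)

lemma homog_1: "homog 1 0"
  by (simp add: homog_def)

lemma homog_add: "homog s d \<Longrightarrow> homog t d \<Longrightarrow> homog (s + t) d"
  by (simp add: homog_def distrib_left distrib_right)

lemma homog_diff: "homog s d \<Longrightarrow> homog t d \<Longrightarrow> homog (s - t) d"
  by (simp add: homog_def left_diff_distrib right_diff_distrib)

lemma homog_mult:
  assumes "homog s d" "homog t e"
  shows "homog (s * t) (d + e)"
  unfolding homog_def
proof (intro allI)
  fix l \<gamma>
  have "mon l \<gamma> * (s * t) = s * (mon (l + 2 * dot \<gamma> d) \<gamma> * t)"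
    using homogD[OF assms(1)] by (simp flip: mult.assoc)
  also have "\<dots> = s * t * mon (l + 2 * dot \<gamma> (d + e)) \<gamma>"
    using homogD[OF assms(2)] by (simp add: mult.assoc dot_add algebra_simps)
  finally show "mon l \<gamma> * (s * t) = s * t * mon (l + 2 * dot \<gamma> (d + e)) \<gamma>" .
qed

text \<open>The degree is the pairing of the exponent with the last three coordinates under
  \<open>Lambda\<close>. It sends X_i to the i-th unit vector and y_j to minus the j-th column of
  the exchange matrix, hence is the g-vector grading.\<close>

lemma homog_single:
  "homog (Poly_Mapping.single (QMon l (a, b, c, d, e, f)) v) (a - e - f, b + d - f, c + d + e)"
  unfolding homog_def
  by (auto simp: mon_def mult_single plus_qmon_def Lambda_expand algebra_simps)

lemma homog_Xm: "homog (Xm (a, b, c, d, e, f)) (a - e - f, b + d - f, c + d + e)"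
  unfolding Xm_def by (rule homog_single)

lemma homog_mon: "homog (mon l (a, b, c)) (- b - c, a - c, a + b)"
  unfolding mon_def using homog_single[of l 0 0 0 a b c 1] by simp

section \<open>The bar-involution\<close>

definition barq :: "qmon \<Rightarrow> qmon" where
  "barq m = QMon (- qexp m) (xexp m)"

lemma barq_barq [simp]: "barq (barq m) = m"
  by (simp add: barq_def)

lemma lookup_bar: "Poly_Mapping.lookup (bar p) m = Poly_Mapping.lookup p (barq m)"
proof -
  have eq: "QMon (- qexp x) (xexp x) = m \<longleftrightarrow> x = barq m" for x
    by (auto simp: barq_def)
  have "Poly_Mapping.lookup (bar p) m =
      (\<Sum>x\<in>Poly_Mapping.keys p. Poly_Mapping.lookup p x when x = barq m)"
    unfolding bar_def by (simp add: lookup_sum lookup_single eq)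
  also have "\<dots> = (\<Sum>x\<in>Poly_Mapping.keys p. if x = barq m then Poly_Mapping.lookup p x else 0)"
    by (intro sum.cong) (auto simp: when_def)
  also have "\<dots> = Poly_Mapping.lookup p (barq m)"
    by (subst sum.delta) (auto simp: in_keys_iff)
  finally show ?thesis .
qed

lemma bar_add: "bar (p + q) = bar p + bar q"
  by (rule poly_mapping_eqI) (simp add: lookup_bar lookup_add)

lemma bar_diff: "bar (p - q) = bar p - bar q"
  by (rule poly_mapping_eqI) (simp add: lookup_bar lookup_minus)

lemma bar_0 [simp]: "bar 0 = 0"
  by (simp add: bar_def)

lemma bar_single: "bar (Poly_Mapping.single m v) = Poly_Mapping.single (barq m) v"
  by (cases "v = 0") (simp_all add: bar_def barq_def)

lemma bar_single_mult: "bar (Poly_Mapping.single m 1 * Poly_Mapping.single n 1)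
   = bar (Poly_Mapping.single n 1) * bar (Poly_Mapping.single m (1::int))"
proof -
  obtain l1 a1 a2 a3 a4 a5 a6 where "m = QMon l1 (a1, a2, a3, a4, a5, a6)"
    by (metis qmon.exhaust prod.exhaust)
  moreover obtain l2 b1 b2 b3 b4 b5 b6 where "n = QMon l2 (b1, b2, b3, b4, b5, b6)"
    by (metis qmon.exhaust prod.exhaust)
  ultimately show ?thesis
    by (simp add: mult_single bar_single barq_def plus_qmon_def Lambda_expand algebra_simps)
qed

text \<open>On monomials this is skew-symmetry of \<open>Lambda\<close>; additivity in both factors
  does the rest. Every product relation between bar-invariant elements thereby yields the one with
  the factors in reversed order.\<close>

lemma bar_mult: "bar (p * q) = bar q * bar p"
proof (rule frag_induction[of p UNIV])
  fix m
  show "bar (frag_of m * q) = bar q * bar (frag_of m)"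
    by (rule frag_induction[of q UNIV])
       (auto simp: bar_single_mult bar_diff right_diff_distrib left_diff_distrib)
qed (auto simp: bar_diff right_diff_distrib left_diff_distrib)

lemma bar_1 [simp]: "bar 1 = 1"
  by (simp add: bar_single barq_def zero_qmon_def flip: single_one)

lemma bar_Xm [simp]: "bar (Xm c) = Xm c"
  by (simp add: Xm_def bar_single barq_def)

lemma bar_mon: "bar (mon l \<gamma>) = mon (- l) \<gamma>"
  by (simp add: mon_def bar_single barq_def split: prod.split)

section \<open>The elements \<open>w\<close>, \<open>z\<close> and \<open>u\<^sub>1\<close>\<close>

lemmas torus_simps = w_elem_def z_elem_def Xm_def mon_def mult_single plus_qmon_def Lambda_expand
  distrib_left distrib_right left_diff_distrib right_diff_distrib

lemma u1_eq: "u1_elem = w_elem * z_elem - mon (- 1) (1, 0, 1) - mon 1 (0, 1, 0)"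
  by (simp add: u1_elem_def qh_mult_Xm mon_def)

text \<open>Compared with w z, only the powers of q at the two coefficient monomials are inverted;
  this makes u_1 bar-invariant.\<close>

lemma z_w_eq: "z_elem * w_elem = u1_elem + mon 1 (1, 0, 1) + mon (- 1) (0, 1, 0)"
  unfolding u1_eq by (simp add: torus_simps)

lemma w_z_eq: "w_elem * z_elem = u1_elem + mon (- 1) (1, 0, 1) + mon 1 (0, 1, 0)"
  by (simp add: u1_eq)

lemma homog_w: "homog w_elem (0, - 1, 1)"
  unfolding w_elem_def
  using homog_Xm[of 1 "-1" 0 0 1 0] homog_Xm[of 0 "-1" 1 0 0 0] by (intro homog_add) simp_all

lemma homog_z: "homog z_elem (- 1, 1, 0)"
  unfolding z_elem_def
  using homog_Xm[of 0 1 "-1" 1 0 1] homog_Xm[of "-1" 0 "-1" 1 0 0] homog_Xm[of "-1" 1 0 0 0 0]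
  by (intro homog_add) simp_all

lemma homog_u1: "homog u1_elem (- 1, 0, 1)"
  unfolding u1_eq
  using homog_mult[OF homog_w homog_z] homog_mon[of "- 1" 1 0 1] homog_mon[of 1 0 1 0]
  by (intro homog_diff) simp_all

text \<open>Expand w z w in its two bracketings: the coefficient terms agree once they are moved
  past w, which leaves u_1 w = w u_1.\<close>

lemma u_w_commute: "u1_elem * w_elem = w_elem * u1_elem"
proof -
  have "w_elem * (z_elem * w_elem) = (w_elem * z_elem) * w_elem"
    by (simp add: mult.assoc)
  then show ?thesis
    unfolding z_w_eq w_z_eq
    by (simp add: distrib_left distrib_right homog_right[OF homog_w])
qed

lemma u_z_commute: "u1_elem * z_elem = z_elem * u1_elem"
proof -
  have "z_elem * (w_elem * z_elem) = (z_elem * w_elem) * z_elem"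
    by (simp add: mult.assoc)
  then show ?thesis
    unfolding z_w_eq w_z_eq
    by (simp add: distrib_left distrib_right homog_right[OF homog_z])
qed

lemma bar_w [simp]: "bar w_elem = w_elem"
  by (simp add: w_elem_def bar_add)

lemma bar_z [simp]: "bar z_elem = z_elem"
  by (simp add: z_elem_def bar_add)

lemma bar_u1 [simp]: "bar u1_elem = u1_elem"
  unfolding u1_eq bar_diff bar_mult by (simp add: z_w_eq bar_mon u1_eq[symmetric])

section \<open>The normalized bridging variables\<close>

definition V :: "int \<Rightarrow> qtorus" where
  "V m = (if even m then w_elem else z_elem)"

definition aexp :: "int \<Rightarrow> z3" where
  "aexp m = (if even m then (0, 1, 0) else (1, 0, 1))"

text \<open>The sequences solve \<open>V\<^sub>m x\<^sub>m = x\<^sub>m\<^sub>+\<^sub>1 + a\<^sub>m x\<^sub>m\<^sub>-\<^sub>1\<close> for all \<open>m\<close>. For \<open>m \<ge> 1\<close> the solution is the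
  cluster variable \<open>X\<^sub>m\<close>; for \<open>m \<le> 0\<close> it is \<open>X\<^sub>m\<close> up to a coefficient monomial.
  \<open>xup n\<close> is \<open>x\<^sub>n\<^sub>+\<^sub>1\<close> and \<open>xdown n\<close> is \<open>x\<^sub>2\<^sub>-\<^sub>n\<close>.\<close>

fun xup :: "nat \<Rightarrow> qtorus" where
  "xup 0 = Xm (1, 0, 0, 0, 0, 0)"
| "xup (Suc 0) = Xm (0, 1, 0, 0, 0, 0)"
| "xup (Suc (Suc n)) = V (int n + 2) * xup (Suc n) - mon 1 (aexp (int n + 2)) * xup n"

fun xdown :: "nat \<Rightarrow> qtorus" where
  "xdown 0 = Xm (0, 1, 0, 0, 0, 0)"
| "xdown (Suc 0) = Xm (1, 0, 0, 0, 0, 0)"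
| "xdown (Suc (Suc n)) = mon (- 1) (- aexp (1 - int n)) * (V (1 - int n) * xdown (Suc n) - xdown n)"

definition x :: "int \<Rightarrow> qtorus" where
  "x m = (if 1 \<le> m then xup (nat (m - 1)) else xdown (nat (2 - m)))"

lemma x_xup: "1 \<le> m \<Longrightarrow> x m = xup (nat (m - 1))"
  by (simp add: x_def)

lemma x_xdown: "m \<le> 2 \<Longrightarrow> x m = xdown (nat (2 - m))"
proof -
  assume "m \<le> 2"
  then consider "m = 2" | "m = 1" | "m < 1" by linarith
  then show ?thesis
    by cases (simp_all add: x_def)
qed

lemma V_x: "V m * x m = x (m + 1) + mon 1 (aexp m) * x (m - 1)"
proof (cases "2 \<le> m")
  case True
  define n where "n = nat (m - 2)"
  have *: "m = int n + 2" and "nat (m - 1) = Suc n" "nat m = Suc (Suc n)" "nat (m - 1 - 1) = n"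
    using True by (auto simp: n_def)
  moreover have "nat (m + 1 - 1) = Suc (Suc n)"
    using True by (auto simp: n_def)
  ultimately have "x m = xup (Suc n)" "x (m + 1) = xup (Suc (Suc n))" "x (m - 1) = xup n"
    using True by (auto simp only: x_xup intro!: x_xup[THEN trans])
  then show ?thesis
    by (simp add: *(1))
next
  case False
  define n where "n = nat (1 - m)"
  have *: "m = 1 - int n" and "nat (2 - m) = Suc n" "nat (2 - (m - 1)) = Suc (Suc n)"
    "nat (2 - (m + 1)) = n"
    using False by (auto simp: n_def)
  then have "x m = xdown (Suc n)" "x (m - 1) = xdown (Suc (Suc n))" "x (m + 1) = xdown n"
    using False by (simp_all add: x_xdown)
  then show ?thesis
    by (simp add: *(1) mon_mult_assoc zero_prod_def[symmetric])
qed

section \<open>The recursion with coefficients u_1 and Y, and its consequences\<close>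

abbreviation Y :: qtorus where
  "Y \<equiv> mon 0 (1, 1, 1)"

lemma V_cong_parity [simp]: "V (m + 2) = V m" "V (m - 2) = V m" "V (m - 1) = V (m + 1)"
    "aexp (m + 2) = aexp m" "aexp (m - 2) = aexp m" "aexp (m - 1) = aexp (m + 1)"
  by (simp_all add: V_def aexp_def)

lemma V_V: "V (m + 1) * V m = u1_elem + mon 1 (aexp (m + 1)) + mon (- 1) (aexp m)"
  by (auto simp: V_def aexp_def z_w_eq w_z_eq)

lemma homog_V: "homog (V m) (if even m then (0, - 1, 1) else (- 1, 1, 0))"
  by (simp add: V_def homog_w homog_z)

lemma u_V_commute: "u1_elem * V m = V m * u1_elem"
  by (simp add: V_def u_w_commute u_z_commute)

lemma bar_V [simp]: "bar (V m) = V m"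
  by (simp add: V_def)

lemma u_mon: "u1_elem * mon l (a, b, c) = mon (l + 2 * a - 2 * c) (a, b, c) * u1_elem"
  by (simp add: homog_right[OF homog_u1] algebra_simps)

lemma V_mon: "V m * mon l (a, b, c) =
    mon (l + (if even m then 2 * b - 2 * c else 2 * a - 2 * b)) (a, b, c) * V m"
  by (simp add: homog_right[OF homog_V] algebra_simps)

lemma V_aexp: "V (m + 1) * mon l (aexp m) = mon (l - 2) (aexp m) * V (m + 1)"
    "V m * mon l (aexp m) = mon (l + 2) (aexp m) * V m"
  by (auto simp: aexp_def V_mon)

text \<open>Apply V_{m+1} V_m to x_m and expand by \<open>V_V\<close> and by \<open>V_x\<close>; the
  terms in x_m cancel. Here u_1 and Y play the roles of trace and determinant of two steps of the
  recursion, and they no longer depend on m.\<close>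

lemma u_x: "u1_elem * x m = x (m + 2) + Y * x (m - 2)"
proof -
  have "u1_elem * x m + mon 1 (aexp (m + 1)) * x m + mon (- 1) (aexp m) * x m
      = V (m + 1) * (V m * x m)"
    by (simp add: V_V distrib_right flip: mult.assoc)
  also have "\<dots> = V (m + 1) * x (m + 1) + mon (- 1) (aexp m) * (V (m - 1) * x (m - 1))"
    by (simp add: V_x distrib_left V_aexp flip: mult.assoc)
  also have "\<dots> = x (m + 2) + mon 1 (aexp (m + 1)) * x m
      + mon (- 1) (aexp m) * (x m + mon 1 (aexp (m + 1)) * x (m - 2))"
    unfolding V_x by (simp add: algebra_simps)
  also have "mon (- 1) (aexp m) * (x m + mon 1 (aexp (m + 1)) * x (m - 2))
      = mon (- 1) (aexp m) * x m + Y * x (m - 2)"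
    by (simp add: distrib_left mon_mult_assoc aexp_def)
  finally show ?thesis
    by (simp add: algebra_simps)
qed

text \<open>Both sides of a relation that is linear in the \<open>x\<^sub>m\<close> satisfy the recursion of \<open>u_x\<close>, so such a
  relation holds for all \<open>m\<close> once it holds for four consecutive values.\<close>

lemma recurrence_zero:
  fixes D :: "int \<Rightarrow> qtorus"
  assumes rec: "\<And>m. u1_elem * D m = D (m + 2) + Y * D (m - 2)"
    and base: "D 0 = 0" "D 1 = 0" "D 2 = 0" "D 3 = 0"
  shows "D m = 0"
proof -
  have "D m = 0 \<and> D (m + 1) = 0 \<and> D (m + 2) = 0 \<and> D (m + 3) = 0"
  proof (induction m rule: int_induct[where k = 0])
    case (step1 i)
    with rec[of "i + 2"] show ?case
      by (simp add: add.assoc)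
  next
    case (step2 i)
    with rec[of "i + 1"] have "Y * D (i - 1) = Y * 0"
      by (simp add: algebra_simps)
    then have "D (i - 1) = 0"
      by (simp only: mon_cancel)
    with step2 show ?case
      by (simp add: algebra_simps)
  qed (use base in auto)
  then show ?thesis ..
qed

text \<open>The Laurent expansions of x_{-1}, ..., x_4 are what the base cases 0, 1, 2, 3 of
  \<open>recurrence_zero\<close> involve.\<close>

lemma x_1: "x 1 = Xm (1, 0, 0, 0, 0, 0)" and x_2: "x 2 = Xm (0, 1, 0, 0, 0, 0)"
  by (simp_all add: x_def)

lemma x_3: "x 3 = Xm (0, 0, 1, 0, 0, 0)"
  using V_x[of 2] by (simp add: x_1 x_2 V_def aexp_def torus_simps)

lemma x_4: "x 4 = Xm (- 1, 0, 0, 1, 0, 0) + Xm (- 1, 1, 1, 0, 0, 0)"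
  using V_x[of 3] by (simp add: x_2 x_3 V_def aexp_def torus_simps)

lemma x_down: "x (m - 1) = mon (- 1) (- aexp m) * (V m * x m - x (m + 1))"
  by (simp add: V_x mon_mult_assoc mon_mult)

lemma x_0: "x 0 = mon (- 1) (0, 0, - 1) * (Xm (0, 0, - 1, 0, 0, 0) + Xm (1, 1, - 1, 0, 0, 1))"
  using x_down[of 1] by (simp add: x_1 x_2 V_def aexp_def torus_simps)

lemma x_m1: "x (- 1) = mon (- 1) (0, - 1, - 1)
    * (Xm (0, - 1, 0, 0, 0, 0) + Xm (1, - 1, - 1, 0, 1, 0) + Xm (2, 0, - 1, 0, 1, 1))"
  using x_down[of 0] by (simp add: x_1 x_0 V_def aexp_def torus_simps)

lemma Y_V: "V m * Y = Y * V m"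
  by (simp add: V_mon)

lemma Y_u: "u1_elem * Y = Y * u1_elem"
  by (simp add: u_mon)

text \<open>The mirror image of \<open>V_x\<close>. It cannot be read off by applying
  \<open>bar\<close>, because bar-invariance of x_m is deduced from it; instead the defect solves
  the recursion of \<open>u_x\<close>.\<close>

lemma x_V: "x m * V m = x (m + 1) + mon (- 1) (aexp m) * x (m - 1)"
proof -
  define D where "D m = x m * V m - x (m + 1) - mon (- 1) (aexp m) * x (m - 1)" for m
  have "D m = 0"
  proof (rule recurrence_zero)
    fix m
    have u_a: "u1_elem * mon (- 1) (aexp m) = mon (- 1) (aexp m) * u1_elem"
      by (simp add: aexp_def u_mon)
    have Y_a: "Y * mon (- 1) (aexp m) = mon (- 1) (aexp m) * Y"
      by (simp add: aexp_def mon_mult)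
    have "u1_elem * D m = (u1_elem * x m) * V m - u1_elem * x (m + 1)
        - mon (- 1) (aexp m) * (u1_elem * x (m - 1))"
      by (simp add: D_def right_diff_distrib mult.assoc[symmetric] u_a)
    also have "\<dots> = D (m + 2) + (Y * x (m - 2) * V m - Y * x (m - 1)
        - (Y * mon (- 1) (aexp m)) * x (m - 3))"
      unfolding u_x Y_a D_def by (simp add: distrib_left distrib_right algebra_simps)
    also have "\<dots> = D (m + 2) + Y * D (m - 2)"
      by (simp add: D_def right_diff_distrib mult.assoc)
    finally show "u1_elem * D m = D (m + 2) + Y * D (m - 2)" .
  qed (simp_all add: D_def x_0 x_1 x_2 x_3 x_4 x_m1 V_def aexp_def torus_simps)
  then show ?thesis
    by (simp add: D_def algebra_simps)
qed

text \<open>The commutator solves the recursion of \<open>u_x\<close>, since V_{m+1} depends only on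
  the parity of m and commutes with both u_1 and Y.\<close>

lemma x_V_commute: "x m * V (m + 1) = V (m + 1) * x m"
proof -
  define D where "D m = x m * V (m + 1) - V (m + 1) * x m" for m
  have "D m = 0"
  proof (rule recurrence_zero)
    fix m
    have "u1_elem * D m = (u1_elem * x m) * V (m + 1) - V (m + 1) * (u1_elem * x m)"
      by (simp add: D_def right_diff_distrib u_V_commute flip: mult.assoc)
    also have "\<dots> = D (m + 2) + (Y * x (m - 2) * V (m + 1) - V (m + 1) * Y * x (m - 2))"
      unfolding u_x D_def using V_cong_parity(1)[of "m + 1"]
      by (simp add: distrib_left distrib_right algebra_simps)
    also have "\<dots> = D (m + 2) + Y * D (m - 2)"
      unfolding Y_V D_def by (simp add: right_diff_distrib mult.assoc)
    finally show "u1_elem * D m = D (m + 2) + Y * D (m - 2)" .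
  qed (simp_all add: D_def x_0 x_1 x_2 x_3 x_4 x_m1 V_def aexp_def torus_simps)
  then show ?thesis
    by (simp add: D_def)
qed

text \<open>On each parity class this is linear in m. It is the g-vector of X_m only for m >= 1; for
  m <= 0 the normalizing coefficient monomial shifts it (see \<open>gX\<close>).\<close>

definition xdeg :: "int \<Rightarrow> z3" where
  "xdeg m = (if even m then (1 - m div 2, 1, m div 2 - 1) else (- (m div 2) + 1, 0, m div 2))"

lemma xdeg_Suc: "(if even m then (0, - 1, 1) else (- 1, 1, 0)) + xdeg m = xdeg (m + 1)"
  by (auto simp: xdeg_def elim!: evenE oddE)

lemma xdeg_add2: "(- 1, 0, 1) + xdeg m = xdeg (m + 2)"
  by (auto simp: xdeg_def)

lemma homog_aexp: "homog (mon l (aexp m)) (- 1, 0, 1)" "homog (mon l (- aexp m)) (1, 0, - 1)"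
  using homog_mon[of l 0 1 0] homog_mon[of l 1 0 1] homog_mon[of l 0 "-1" 0] homog_mon[of l "-1" 0 "-1"]
  by (simp_all add: aexp_def)

lemma homog_x: "homog (x m) (xdeg m)"
proof -
  have V_x': "homog (V m * x m) (xdeg (m + 1))" if "homog (x m) (xdeg m)" for m
    using homog_mult[OF homog_V[of m] that] by (simp only: xdeg_Suc)
  have "homog (x m) (xdeg m) \<and> homog (x (m + 1)) (xdeg (m + 1))"
  proof (induction m rule: int_induct[where k = 1])
    case base
    then show ?case
      using homog_Xm[of 1 0 0 0 0 0] homog_Xm[of 0 1 0 0 0 0] by (simp add: x_1 x_2 xdeg_def)
  next
    case (step1 i)
    have "x (i + 2) = V (i + 1) * x (i + 1) - mon 1 (aexp (i + 1)) * x i"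
      using V_x[of "i + 1"] by (simp add: add.commute)
    moreover have "homog (V (i + 1) * x (i + 1)) (xdeg (i + 2))"
      using V_x'[of "i + 1"] step1 by (simp add: add.assoc)
    moreover have "homog (mon 1 (aexp (i + 1)) * x i) (xdeg (i + 2))"
      using homog_mult[OF homog_aexp(1) conjunct1[OF step1(2)]] by (simp only: xdeg_add2)
    ultimately have "homog (x (i + 2)) (xdeg (i + 2))"
      by (simp only: homog_diff)
    then show ?case
      using step1 by (simp add: add.assoc)
  next
    case (step2 i)
    have "homog (V i * x i - x (i + 1)) (xdeg (i + 1))"
      using V_x'[of i] step2 by (intro homog_diff) auto
    from homog_mult[OF homog_aexp(2) this] have "homog (x (i - 1)) ((1, 0, - 1) + xdeg (i + 1))"
      by (simp only: x_down[of i])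
    moreover have "(1, 0, - 1) + xdeg (i + 1) = xdeg (i - 1)"
    proof -
      have "i - 1 + 2 = i + 1"
        by simp
      then have "xdeg (i + 1) = (- 1, 0, 1) + xdeg (i - 1)"
        by (metis xdeg_add2)
      then show ?thesis
        by (cases "xdeg (i - 1)") simp
    qed
    ultimately show ?case
      using step2 by simp
  qed
  then show ?thesis ..
qed

lemma x_aexp: "x m * mon l (aexp m) = mon (l - 2) (aexp m) * x m"
    "x m * mon l (aexp (m + 1)) = mon l (aexp (m + 1)) * x m"
  by (auto simp: homog_right[OF homog_x] aexp_def xdeg_def elim!: evenE oddE)

section \<open>Quadratic relations\<close>

text \<open>Applying \<open>bar\<close> turns left multiplication by V_m into right multiplication,
  and \<open>V_x\<close> into \<open>x_V\<close>; so the conjugates obey the same recursion with the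
  same initial values.\<close>

lemma bar_x [simp]: "bar (x m) = x m"
proof -
  have "bar (x m) = x m \<and> bar (x (m + 1)) = x (m + 1)"
  proof (induction m rule: int_induct[where k = 1])
    case (step1 i)
    have eq: "x (i + 2) = V (i + 1) * x (i + 1) - mon 1 (aexp (i + 1)) * x i"
      using V_x[of "i + 1"] by (simp add: add.commute)
    have "bar (x (i + 2)) = x (i + 1) * V (i + 1) - x i * mon (- 1) (aexp (i + 1))"
      unfolding eq bar_diff bar_mult using step1 by (simp add: bar_mon)
    also have "\<dots> = x (i + 2)"
      by (simp add: x_V x_aexp add.assoc)
    finally show ?case
      using step1 by (simp add: add.assoc)
  next
    case (step2 i)
    have eq: "mon 1 (aexp i) * x (i - 1) = V i * x i - x (i + 1)"
      by (simp add: V_x)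
    have "bar (x (i - 1)) * mon (- 1) (aexp i) = bar (mon 1 (aexp i) * x (i - 1))"
      by (simp add: bar_mult bar_mon)
    also have "\<dots> = x i * V i - x (i + 1)"
      unfolding eq bar_diff bar_mult using step2 by simp
    also have "\<dots> = x (i - 1) * mon (- 1) (aexp i)"
      using x_aexp(2)[of "i - 1" "- 1"] by (simp add: x_V)
    finally have "bar (x (i - 1)) * (mon (- 1) (aexp i) * mon 1 (- aexp i))
        = x (i - 1) * (mon (- 1) (aexp i) * mon 1 (- aexp i))"
      by (simp add: mult.assoc[symmetric])
    then show ?case
      using step2 by (simp add: mon_mult)
  qed (simp add: x_1 x_2)
  then show ?thesis ..
qed

text \<open>The commutator of neighbours at m is an invertible coefficient monomial times the one at
  m - 1, so its vanishing at m = 1 spreads in both directions.\<close>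

lemma x_commute_1: "x m * x (m + 1) = x (m + 1) * x m"
proof (induction m rule: int_induct[where k = 1])
  have step: "x m * x (m + 1) - x (m + 1) * x m
      = mon (- 1) (aexp m) * (x (m - 1) * x m - x m * x (m - 1))" for m
  proof -
    have eq: "x (m + 1) = V m * x m - mon 1 (aexp m) * x (m - 1)"
      by (simp add: V_x)
    have "x m * x (m + 1) = (x m * V m) * x m - (x m * mon 1 (aexp m)) * x (m - 1)"
      unfolding eq by (simp add: right_diff_distrib mult.assoc)
    then show ?thesis
      unfolding x_V x_aexp by (simp add: algebra_simps)
  qed
  {
    case (step1 i)
    with step[of "i + 1"] show ?case
      by simp
  next
    case (step2 i)
    with step[of "i"] have "mon (- 1) (aexp i) * (x (i - 1) * x i - x i * x (i - 1)) = mon (- 1) (aexp i) * 0"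
      by simp
    then show ?case
      by (simp only: mon_cancel) simp
  }
qed (simp add: x_1 x_2 torus_simps)

lemma x_commute_2: "x m * x (m + 2) = x (m + 2) * x m"
proof -
  have eq: "x (m + 2) = V (m + 1) * x (m + 1) - mon 1 (aexp (m + 1)) * x m"
    using V_x[of "m + 1"] by (simp add: add.commute)
  have "x m * x (m + 2) = (x m * V (m + 1)) * x (m + 1) - (x m * mon 1 (aexp (m + 1))) * x m"
    unfolding eq by (simp add: right_diff_distrib mult.assoc)
  then show ?thesis
    unfolding eq by (simp add: x_V_commute x_aexp left_diff_distrib mult.assoc x_commute_1)
qed

text \<open>The accumulated exponents of the recursion: \<open>dexp m\<close> is
  \<open>aexp m\<close> plus \<open>dexp (m - 1)\<close>, with value (1, 0, 0) at m = 1. It becomes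
  the coefficient in the exchange relation of x_m and x_{m+3}.\<close>

definition dexp :: "int \<Rightarrow> z3" where
  "dexp m = (if even m then (m div 2, m div 2, m div 2 - 1) else (m div 2 + 1, m div 2, m div 2))"

lemma mon_dexp: "mon (- 1) (aexp m) * mon l (dexp (m - 1)) = mon l (dexp m)"
proof (cases "even m")
  case True
  then obtain b where "m = 2 * b" ..
  moreover have "(2 * b - 1) div 2 = b - 1"
    by presburger
  ultimately show ?thesis
    by (simp add: mon_mult dexp_def aexp_def)
next
  case False
  then obtain b where "m = 2 * b + 1" ..
  then show ?thesis
    by (simp add: mon_mult dexp_def aexp_def algebra_simps)
qed

text \<open>The cross difference \<open>E\<close> is a discrete Wronskian of the recursion: one step
  multiplies it by a coefficient monomial.\<close>

lemma x_mult_3: "x m * x (m + 3) = x (m + 1) * x (m + 2) + mon (- 1) (dexp m)"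
proof (induction m rule: int_induct[where k = 1])
  define E where "E m = x m * x (m + 3) - x (m + 1) * x (m + 2)" for m
  have step: "E m = mon (- 1) (aexp m) * E (m - 1)" for m
  proof -
    have eq: "x (m + 3) = V m * x (m + 2) - mon 1 (aexp m) * x (m + 1)"
      using V_x[of "m + 2"] by (simp add: algebra_simps)
    have "x m * x (m + 3) = (x m * V m) * x (m + 2) - (x m * mon 1 (aexp m)) * x (m + 1)"
      unfolding eq by (simp add: right_diff_distrib mult.assoc)
    then show ?thesis
      unfolding x_V x_aexp E_def by (simp add: algebra_simps)
  qed
  {
    case (step1 i)
    with step[of "i + 1"] mon_dexp[of "i + 1" "- 1"] show ?case
      by (simp add: E_def algebra_simps)
  next
    case (step2 i)
    with step[of "i"] have "mon (- 1) (aexp i) * E (i - 1) = mon (- 1) (aexp i) * mon (- 1) (dexp (i - 1))"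
      by (simp add: E_def mon_dexp algebra_simps)
    then show ?case
      by (simp only: mon_cancel) (simp add: E_def algebra_simps)
  }
qed (simp add: x_1 x_2 x_3 x_4 dexp_def torus_simps)

text \<open>Write x_{m+4} through V_{m+1}, which commutes with x_m, and reduce to
  \<open>x_mult_3\<close>.\<close>

lemma x_mult_4: "x m * x (m + 4) = x (m + 2) * x (m + 2) + V (m + 1) * mon (- 1) (dexp m)"
proof -
  have eq: "x (m + 4) = V (m + 1) * x (m + 3) - mon 1 (aexp (m + 1)) * x (m + 2)"
    using V_x[of "m + 3"] V_cong_parity(1,4)[of "m + 1"] by (simp add: add.commute)
  have "x m * x (m + 4)
      = (x m * V (m + 1)) * x (m + 3) - (x m * mon 1 (aexp (m + 1))) * x (m + 2)"
    unfolding eq by (simp add: right_diff_distrib mult.assoc)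
  also have "\<dots> = V (m + 1) * (x m * x (m + 3)) - mon 1 (aexp (m + 1)) * (x m * x (m + 2))"
    by (simp add: x_V_commute x_aexp mult.assoc)
  also have "\<dots> = (V (m + 1) * x (m + 1) - mon 1 (aexp (m + 1)) * x m) * x (m + 2)
      + V (m + 1) * mon (- 1) (dexp m)"
    unfolding x_mult_3 by (simp add: algebra_simps)
  also have "V (m + 1) * x (m + 1) - mon 1 (aexp (m + 1)) * x m = x (m + 2)"
    using V_x[of "m + 1"] by (simp add: add.commute)
  finally show ?thesis .
qed

section \<open>Chebyshev-type recursions\<close>

text \<open>Chebyshev polynomials of the second kind in u_1, homogenized by Y, with the index
  shifted: \<open>cheb (Suc n)\<close> has degree n.\<close>

fun cheb :: "nat \<Rightarrow> qtorus" where
  "cheb 0 = 0"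
| "cheb (Suc 0) = 1"
| "cheb (Suc (Suc n)) = u1_elem * cheb (Suc n) - Y * cheb n"

lemma Y_Y: "u1_elem * (Y * t) = Y * (u1_elem * t)"
  by (simp add: Y_u flip: mult.assoc)

declare u_elem.simps(3,4) [simp del]

lemma u_elem_2: "u_elem (Suc (Suc 0)) = u1_elem * u1_elem - (Y + Y)"
  by (simp add: u_elem.simps(3) power2_eq_square mon_def Xm_def mult_2)

lemma u_elem_Suc: "u_elem (Suc (Suc (Suc n))) = u1_elem * u_elem (Suc (Suc n)) - Y * u_elem (Suc n)"
  by (simp add: u_elem.simps(4) mon_def Xm_def)

text \<open>The classical relation between the two kinds. Iterated, it writes the second kind as a
  nonnegative combination of the u_k; this is the source of positivity for products of distant
  x_m.\<close>

lemma cheb_step: "cheb (Suc (Suc (Suc n))) = u_elem (Suc (Suc n)) + Y * cheb (Suc n)"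
proof (induction n rule: induct_nat_012)
  case 0
  show ?case
    by (simp add: u_elem_2)
next
  case 1
  show ?case
    by (simp add: u_elem_2 u_elem_Suc right_diff_distrib distrib_left Y_u Y_Y)
next
  case (ge2 n)
  have "cheb (Suc (Suc (Suc (Suc (Suc n))))) = u1_elem * cheb (Suc (Suc (Suc (Suc n)))) - Y * cheb (Suc (Suc (Suc n)))"
    by (rule cheb.simps)
  also have "\<dots> = (u1_elem * u_elem (Suc (Suc (Suc n))) - Y * u_elem (Suc (Suc n)))
      + Y * (u1_elem * cheb (Suc (Suc n)) - Y * cheb (Suc n))"
    unfolding ge2 by (simp only: distrib_left right_diff_distrib Y_Y) simp
  also have "\<dots> = u_elem (Suc (Suc (Suc (Suc n)))) + Y * cheb (Suc (Suc (Suc n)))"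
    by (simp only: u_elem_Suc cheb.simps)
  finally show ?case .
qed

lemma commute_mult: "t * a = a * t \<Longrightarrow> t * b = b * t \<Longrightarrow> t * (a * b) = a * b * t"
  for t :: "'a::semigroup_mult"
  by (metis mult.assoc)

lemma u_elem_commute:
  assumes "t * u1_elem = u1_elem * t" "t * Y = Y * t"
  shows "t * u_elem n = u_elem n * t"
proof (induction n rule: u_elem.induct)
  case 3
  have "t * (u1_elem * u1_elem) = u1_elem * u1_elem * t"
    by (intro commute_mult assms)
  with assms(2) show ?case
    by (simp add: u_elem_2 right_diff_distrib left_diff_distrib distrib_left distrib_right)
next
  case (4 n)
  have "t * (u1_elem * u_elem (Suc (Suc n))) = u1_elem * u_elem (Suc (Suc n)) * t"
    by (intro commute_mult assms 4)
  moreover have "t * (Y * u_elem (Suc n)) = Y * u_elem (Suc n) * t"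
    by (intro commute_mult assms 4)
  ultimately show ?case
    by (simp add: right_diff_distrib left_diff_distrib u_elem_Suc)
qed (simp_all add: assms)

lemma u_elem_V_commute: "V m * u_elem n = u_elem n * V m"
  by (rule u_elem_commute) (simp_all only: u_V_commute Y_V)

lemma u_elem_Y: "u_elem n * Y = Y * u_elem n"
  by (rule u_elem_commute[symmetric]) (simp_all only: Y_u)

lemma u_elem_u1: "u_elem n * u1_elem = u1_elem * u_elem n"
  by (rule u_elem_commute[symmetric]) (simp_all only: Y_u)

lemma bar_u_elem [simp]: "bar (u_elem n) = u_elem n"
proof (induction n rule: u_elem.induct)
  case 3
  then show ?case
    by (simp add: u_elem_2 bar_diff bar_mult bar_add bar_mon)
next
  case (4 n)
  then show ?case
    by (simp only: u_elem_Suc bar_diff bar_mult bar_mon bar_u1 u_elem_Y u_elem_u1) (simp add: u_elem_Y)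
qed simp_all

lemma homog_u_elem: "homog (u_elem n) (- int n, 0, int n)"
proof (induction n rule: u_elem.induct)
  case 3
  show ?case
    using homog_diff[OF homog_mult[OF homog_u1 homog_u1] homog_add] homog_mon[of 0 1 1 1]
    by (simp add: u_elem_2)
next
  case (4 n)
  have "homog Y (- 2, 0, 2)"
    using homog_mon[of 0 1 1 1] by simp
  from homog_diff[OF _ homog_mult[OF this 4(2)]] homog_mult[OF homog_u1 4(1)] show ?case
    by (simp add: u_elem_Suc)
qed (use homog_1 homog_u1 in \<open>simp_all add: zero_prod_def\<close>)

text \<open>Chebyshev polynomials of the first kind begin with 2, but u_0 = 1. With the value 2 the
  three-term recursion holds from index 0 on.\<close>

definition tt :: "nat \<Rightarrow> qtorus" where
  "tt n = (if n = 0 then 2 else u_elem n)"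

lemma tt_rec: "u1_elem * tt (Suc n) = tt (Suc (Suc n)) + Y * tt n"
proof (cases n)
  case 0
  have "Y * 2 = Y + Y"
    by (rule mult_2_right)
  then have "u_elem (Suc (Suc 0)) + Y * 2 = u1_elem * u1_elem"
    by (simp only: u_elem_2 diff_add_cancel)
  with 0 show ?thesis
    by (simp add: tt_def)
qed (simp add: tt_def u_elem_Suc)

lemma Y_power_u1: "u1_elem * (Y ^ k * t) = Y ^ k * (u1_elem * t)"
  by (induction k) (simp_all only: power_0 mult_1 power_Suc mult.assoc Y_Y)

lemma Y_power_Suc: "Y * (Y ^ n * t) = Y ^ Suc n * t" "Y ^ n * (Y * t) = Y ^ Suc n * t"
  by (simp_all only: power_Suc mult.assoc) (simp only: power_commutes flip: mult.assoc)

text \<open>The product-to-sum formula for cosines. The induction lowers the smaller index m and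
  compensates in the difference k, which therefore stays arbitrary.\<close>

lemma tt_mult: "tt m * tt (m + k) = tt (2 * m + k) + Y ^ m * tt k"
proof (induction m arbitrary: k rule: induct_nat_012)
  case 0
  show ?case
    by (simp add: tt_def) (simp add: mult_2)
next
  case 1
  show ?case
    using tt_rec[of k] by (simp add: tt_def)
next
  case (ge2 n)
  have rec: "tt (Suc (Suc n)) = u1_elem * tt (Suc n) - Y * tt n"
    by (simp add: tt_rec)
  have eq: "Suc (Suc n) + k = Suc n + Suc k" "Suc (Suc n) + k = n + Suc (Suc k)"
    by simp_all
  have "tt (Suc (Suc n)) * tt (Suc (Suc n) + k)
      = u1_elem * (tt (Suc n) * tt (Suc n + Suc k)) - Y * (tt n * tt (n + Suc (Suc k)))"
    by (subst rec) (simp only: left_diff_distrib mult.assoc flip: eq)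
  also have "\<dots> = u1_elem * tt (Suc (2 * n + k + 2)) - Y * tt (2 * n + k + 2)
      + Y ^ Suc n * (u1_elem * tt (Suc k) - tt (Suc (Suc k)))"
    unfolding ge2 distrib_left Y_power_u1 Y_power_Suc right_diff_distrib by simp
  also have "\<dots> = tt (2 * Suc (Suc n) + k) + Y ^ Suc n * (Y * tt k)"
    using tt_rec[of "2 * n + k + 2"] tt_rec[of k] by simp
  finally show ?case
    by (simp only: Y_power_Suc)
qed

lemma Y_power: "Y ^ n = mon 0 (int n, int n, int n)"
  by (induction n) (simp_all add: mon_mult)

text \<open>Iteration of \<open>u_x\<close>. It is proved for \<open>tt\<close>, whose value 2 at n
  = 0 matches the two equal terms x_m + x_m.\<close>

lemma u_elem_x: "1 \<le> n \<Longrightarrow> u_elem n * x m = x (m + 2 * int n) + Y ^ n * x (m - 2 * int n)"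
proof -
  have "tt n * x m = x (m + 2 * int n) + Y ^ n * x (m - 2 * int n)"
  proof (induction n rule: induct_nat_012)
    case 0
    show ?case
      by (simp add: tt_def mult_2)
  next
    case 1
    show ?case
      by (simp add: tt_def u_x)
  next
    case (ge2 n)
    have rec: "tt (Suc (Suc n)) = u1_elem * tt (Suc n) - Y * tt n"
      by (simp add: tt_rec)
    have "tt (Suc (Suc n)) * x m = u1_elem * (tt (Suc n) * x m) - Y * (tt n * x m)"
      by (subst rec) (simp only: left_diff_distrib mult.assoc)
    also have "\<dots> = (u1_elem * x (m + 2 * int (Suc n)) - Y * x (m + 2 * int n))
        + (Y ^ Suc n * (u1_elem * x (m - 2 * int (Suc n))) - Y ^ Suc n * x (m - 2 * int n))"
      unfolding ge2 distrib_left Y_power_u1 Y_power_Suc by simp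
    also have "\<dots> = x (m + 2 * int (Suc (Suc n))) + Y ^ Suc n * (Y * x (m - 2 * int (Suc (Suc n))))"
      unfolding u_x distrib_left by (simp del: power_Suc add: algebra_simps)
    finally show ?case
      unfolding Y_power_Suc .
  qed
  then show "1 \<le> n \<Longrightarrow> ?thesis"
    by (simp add: tt_def)
qed

section \<open>Products of distant bridging variables\<close>

lemma dexp_add2: "dexp (m + 2) = dexp m + (1, 1, 1)"
  by (simp add: dexp_def)

lemma u_dexp: "u1_elem * mon l (dexp m) = mon (l + 2) (dexp m) * u1_elem"
  by (cases "even m") (simp_all add: dexp_def u_mon)

lemma Y_dexp: "Y * mon l (dexp m) = mon (l + 2) (dexp (m + 2))" "mon l (dexp m) * Y = mon (l - 2) (dexp (m + 2))"
proof -
  have "yform (1, 1, 1) (dexp m) = 2"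
    by (cases "even m") (auto simp: dexp_def elim!: evenE oddE)
  moreover from this have "yform (dexp m) (1, 1, 1) = - 2"
    by (subst yform_commute) simp
  ultimately show "Y * mon l (dexp m) = mon (l + 2) (dexp (m + 2))" "mon l (dexp m) * Y = mon (l - 2) (dexp (m + 2))"
    by (simp_all add: mon_mult dexp_add2 add.commute)
qed

lemma u_dexp': "u1_elem * (mon l (dexp m) * t) = mon (l + 2) (dexp m) * (u1_elem * t)"
  by (simp add: u_dexp flip: mult.assoc)

lemma Y_dexp': "Y * (mon l (dexp m) * t) = mon (l + 2) (dexp (m + 2)) * t"
  by (simp add: Y_dexp flip: mult.assoc)

lemma x_mult_3': "x (m + 3) * x m = x (m + 1) * x (m + 2) + mon 1 (dexp m)"
proof -
  have "x (m + 2) * x (m + 1) = x (m + 1) * x (m + 2)"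
    using x_commute_1[of "m + 1"] by (simp add: add.commute)
  then show ?thesis
    using arg_cong[OF x_mult_3[of m], of bar] by (simp add: bar_mult bar_add bar_mon)
qed

text \<open>\<open>F n m\<close> compares a product of two x's at odd distance with the product
  whose indices are moved inwards by two. Applying u_1 to the left factors by \<open>u_x\<close>
  gives a three-term recursion in n with the coefficients u_1 and Y, and its solutions are built
  from \<open>cheb\<close>.\<close>

lemma x_mult_odd:
  "x m * x (m + 2 * int n + 3) = x (m + 2) * x (m + 2 * int n + 1)
     + (mon (- 1) (dexp m) * cheb (Suc n) + mon (- 1) (dexp (m + 1)) * cheb n)"
proof -
  define F where "F n m = x m * x (m + 2 * n + 1) - x (m + 2) * x (m + 2 * n - 1)" for n m
  have step: "Y * F (n + 1) m = u1_elem * F n (m + 2) - F (n - 1) (m + 4)" for n m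
  proof -
    have "u1_elem * F n (m + 2)
        = (u1_elem * x (m + 2)) * x (m + 2 * n + 3) - (u1_elem * x (m + 4)) * x (m + 2 * n + 1)"
      by (simp add: F_def right_diff_distrib mult.assoc add.commute add.left_commute)
    then show ?thesis
      unfolding u_x F_def by (simp add: algebra_simps)
  qed
  have "F (int n + 1) m = mon (- 1) (dexp m) * cheb (Suc n) + mon (- 1) (dexp (m + 1)) * cheb n" for m
  proof (induction n arbitrary: m rule: induct_nat_012)
    case 0
    show ?case
      using x_mult_3[of m] x_commute_1[of "m + 1"] by (simp add: F_def algebra_simps)
  next
    case 1
    \<comment> \<open>At n = 0 the pair at distance three occurs with the larger index on the left,
      hence the reversed relation and the exponent 1 of q.\<close>
    have F0: "F 0 m = - mon 1 (dexp (m - 1))" for m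
      using x_mult_3'[of "m - 1"] x_commute_1[of m] by (simp add: F_def algebra_simps)
    have F1: "F 1 m = mon (- 1) (dexp m)" for m
      using x_mult_3[of m] x_commute_1[of "m + 1"] by (simp add: F_def algebra_simps)
    have "Y * F 2 m = u1_elem * mon (- 1) (dexp (m + 2)) + mon 1 (dexp (m + 3))"
      using step[of 1 m] by (simp add: F0 F1 add.commute)
    also have "\<dots> = Y * (mon (- 1) (dexp m) * u1_elem + mon (- 1) (dexp (m + 1)))"
      by (simp add: distrib_left Y_dexp u_dexp Y_dexp' add.assoc)
    finally show ?case
      by (simp add: mon_cancel)
  next
    case (ge2 n)
    have "Y * F (int (Suc (Suc n)) + 1) m = u1_elem * F (int (Suc n) + 1) (m + 2) - F (int n + 1) (m + 4)"
      using step[of "int n + 2" m] by (simp add: algebra_simps)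
    also have "\<dots> = mon 1 (dexp (m + 2)) * (u1_elem * cheb (Suc (Suc n))) - mon (- 1) (dexp (m + 4)) * cheb (Suc n)
       + (mon 1 (dexp (m + 3)) * (u1_elem * cheb (Suc n)) - mon (- 1) (dexp (m + 5)) * cheb n)"
      unfolding ge2 by (simp add: distrib_left u_dexp' add.assoc del: cheb.simps)
    also have "\<dots> = mon 1 (dexp (m + 2)) * cheb (Suc (Suc (Suc n)))
       + mon 1 (dexp (m + 3)) * cheb (Suc (Suc n))"
    proof -
      have "mon (- 1) (dexp (m + 4)) * t = mon 1 (dexp (m + 2)) * (Y * t)"
        "mon (- 1) (dexp (m + 5)) * t = mon 1 (dexp (m + 3)) * (Y * t)" for t
        using Y_dexp(2)[of 1 "m + 2"] Y_dexp(2)[of 1 "m + 3"] by (simp_all add: add.commute flip: mult.assoc)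
      then show ?thesis
        by (simp add: right_diff_distrib)
    qed
    also have "\<dots> = Y * (mon (- 1) (dexp m) * cheb (Suc (Suc (Suc n)))
       + mon (- 1) (dexp (m + 1)) * cheb (Suc (Suc n)))"
      by (simp add: distrib_left Y_dexp' add.assoc del: cheb.simps)
    finally show ?case
      by (simp only: mon_cancel)
  qed
  then show ?thesis
    by (simp add: F_def algebra_simps)
qed

text \<open>V_{m+1} commutes with x_m and x_{m+2}, so lowering the larger index by it reduces an
  even distance to an odd one. Of the two \<open>cheb\<close> terms delivered by
  \<open>x_mult_odd\<close>, one cancels against the induction hypothesis.\<close>

lemma x_mult_even:
  "x m * x (m + 2 * int n + 2) = x (m + 2) * x (m + 2 * int n)
     + V (m + 1) * (mon (- 1) (dexp m) * cheb n)"
proof (induction n)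
  case 0
  then show ?case
    by (simp add: x_commute_2)
next
  case (Suc n)
  let ?A = "mon 1 (aexp (m + 1))"
  have V_eq: "V (m + 2 * int n + 1) = V (m + 1)" "aexp (m + 2 * int n + 1) = aexp (m + 1)"
       "V (m + 2 * int n + 3) = V (m + 1)" "aexp (m + 2 * int n + 3) = aexp (m + 1)"
    by (simp_all add: V_def aexp_def)
  have eq: "x (m + 2 * int n + 4) = V (m + 1) * x (m + 2 * int n + 3) - ?A * x (m + 2 * int n + 2)"
    using V_x[of "m + 2 * int n + 3"] V_eq by (simp add: algebra_simps)
  have eq': "x (m + 2 * int n + 2) = V (m + 1) * x (m + 2 * int n + 1) - ?A * x (m + 2 * int n)"
    using V_x[of "m + 2 * int n + 1"] V_eq by (simp add: algebra_simps)
  have "V (m + 3) = V (m + 1)" "aexp (m + 3) = aexp (m + 1)"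
    by (simp_all add: V_def aexp_def)
  then have comm: "x (m + 2) * V (m + 1) = V (m + 1) * x (m + 2)" "x (m + 2) * ?A = ?A * x (m + 2)"
    using x_V_commute[of "m + 2"] x_aexp(2)[of "m + 2" 1] by (simp_all add: add.commute)
  then have comm': "x (m + 2) * (V (m + 1) * t) = V (m + 1) * (x (m + 2) * t)"
       "x (m + 2) * (?A * t) = ?A * (x (m + 2) * t)" for t
    by (simp_all flip: mult.assoc)
  have "x m * x (m + 2 * int n + 4)
      = (x m * V (m + 1)) * x (m + 2 * int n + 3) - (x m * ?A) * x (m + 2 * int n + 2)"
    unfolding eq by (simp add: right_diff_distrib mult.assoc)
  also have "\<dots> = V (m + 1) * (x m * x (m + 2 * int n + 3)) - ?A * (x m * x (m + 2 * int n + 2))"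
    by (simp add: x_V_commute x_aexp mult.assoc)
  also have "\<dots> = x (m + 2) * (V (m + 1) * x (m + 2 * int n + 1) - ?A * x (m + 2 * int n))
      + V (m + 1) * (mon (- 1) (dexp m) * cheb (Suc n))
      + (V (m + 1) * (mon (- 1) (dexp (m + 1)) * cheb n) - ?A * (V (m + 1) * (mon (- 1) (dexp m) * cheb n)))"
    unfolding x_mult_odd Suc
    by (simp add: distrib_left right_diff_distrib comm' del: cheb.simps)
  also have "?A * (V (m + 1) * (mon (- 1) (dexp m) * cheb n)) = V (m + 1) * (mon (- 1) (dexp (m + 1)) * cheb n)"
  proof -
    have "?A * (V (m + 1) * (mon (- 1) (dexp m) * cheb n)) = ?A * V (m + 1) * mon (- 1) (dexp m) * cheb n"
      by (simp only: mult.assoc)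
    also have "?A * V (m + 1) = V (m + 1) * mon (- 1) (aexp (m + 1))"
      by (simp add: V_aexp)
    also have "V (m + 1) * mon (- 1) (aexp (m + 1)) * mon (- 1) (dexp m) * cheb n
        = V (m + 1) * (mon (- 1) (aexp (m + 1)) * mon (- 1) (dexp m)) * cheb n"
      by (simp only: mult.assoc)
    also have "mon (- 1) (aexp (m + 1)) * mon (- 1) (dexp m) = mon (- 1) (dexp (m + 1))"
      using mon_dexp[of "m + 1" "- 1"] by simp
    finally show ?thesis
      by (simp only: mult.assoc)
  qed
  finally show ?case
    unfolding eq'[symmetric] by (simp add: algebra_simps del: cheb.simps)
qed

section \<open>Words\<close>

datatype letter = LX int | LW | LZ | LU nat

fun lval :: "letter \<Rightarrow> qtorus" where
  "lval (LX m) = x m"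
| "lval LW = w_elem"
| "lval LZ = z_elem"
| "lval (LU n) = u_elem n"

definition wval :: "letter list \<Rightarrow> qtorus" where
  "wval W = prod_list (map lval W)"

lemma wval_simps [simp]: "wval [] = 1" "wval (s # W) = lval s * wval W" "wval (U @ W) = wval U * wval W"
  by (simp_all add: wval_def)

lemma bar_lval [simp]: "bar (lval s) = lval s"
  by (cases s) simp_all

lemma bar_wval: "bar (wval W) = wval (rev W)"
  by (induction W) (simp_all add: bar_mult)

fun ldeg :: "letter \<Rightarrow> z3" where
  "ldeg (LX m) = xdeg m"
| "ldeg LW = (0, - 1, 1)"
| "ldeg LZ = (- 1, 1, 0)"
| "ldeg (LU n) = (- int n, 0, int n)"

lemma homog_lval: "homog (lval s) (ldeg s)"
  by (cases s) (simp_all add: homog_x homog_w homog_z homog_u_elem)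

lemma homog_wval: "homog (wval W) (sum_list (map ldeg W))"
  by (induction W) (simp_all add: homog_1 homog_mult homog_lval)

fun compat :: "letter \<Rightarrow> letter \<Rightarrow> bool" where
  "compat (LX m) (LX n) \<longleftrightarrow> \<bar>m - n\<bar> \<le> 2"
| "compat (LX m) LW \<longleftrightarrow> odd m"
| "compat LW (LX m) \<longleftrightarrow> odd m"
| "compat (LX m) LZ \<longleftrightarrow> even m"
| "compat LZ (LX m) \<longleftrightarrow> even m"
| "compat LW LW \<longleftrightarrow> True"
| "compat LZ LZ \<longleftrightarrow> True"
| "compat LW (LU n) \<longleftrightarrow> True"
| "compat (LU n) LW \<longleftrightarrow> True"
| "compat LZ (LU n) \<longleftrightarrow> True"
| "compat (LU n) LZ \<longleftrightarrow> True"
| "compat _ _ \<longleftrightarrow> False"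

lemma compat_sym: "compat s t = compat t s"
  by (cases s; cases t) (auto simp: abs_minus_commute)

lemma x_V_commute':
  "odd m \<Longrightarrow> x m * w_elem = w_elem * x m" "even m \<Longrightarrow> x m * z_elem = z_elem * x m"
  using x_V_commute[of m] by (simp_all add: V_def)

lemma u_elem_w_z_commute: "w_elem * u_elem n = u_elem n * w_elem" "z_elem * u_elem n = u_elem n * z_elem"
  using u_elem_V_commute[of 0] u_elem_V_commute[of 1] by (simp_all add: V_def)

lemma compat_commute: "compat s t \<Longrightarrow> lval s * lval t = lval t * lval s"
proof -
  have x_x: "x m * x n = x n * x m" if "\<bar>m - n\<bar> \<le> 2" for m n
  proof -
    have "n = m \<or> n = m + 1 \<or> n = m + 2 \<or> m = n + 1 \<or> m = n + 2"
      using that by linarith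
    then show ?thesis
      by (elim disjE) (simp_all add: x_commute_1 x_commute_2)
  qed
  assume "compat s t"
  then show ?thesis
    by (cases s; cases t) (simp_all add: x_x x_V_commute' u_elem_w_z_commute)
qed

text \<open>Compatibility is imposed on pairs of positions. As two \<open>LU\<close> letters are
  never compatible, not even equal ones, a basic word contains at most one u_n.\<close>

definition basic :: "letter list \<Rightarrow> bool" where
  "basic W \<longleftrightarrow> sorted_wrt compat W"

lemma move_right: "(\<And>s. s \<in> set U \<Longrightarrow> compat a s) \<Longrightarrow> lval a * wval U = wval U * lval a"
  by (induction U) (simp_all add: compat_commute commute_mult)

text \<open>Take a letter whose tail is basic and the first later letter incompatible with it:
  everything in between commutes with it, so the two can be made adjacent. The multiset is recorded
  because it determines the size of the word under \<open>wless\<close>.\<close>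

lemma not_basic_factor:
  assumes "\<not> basic W"
  obtains U s t R where "\<not> compat s t" "wval W = wval (U @ s # t # R)" "mset W = mset (U @ s # t # R)"
  using assms
proof (induction W arbitrary: thesis)
  case Nil
  then show ?case
    by (simp add: basic_def)
next
  case (Cons a W)
  show ?case
  proof (cases "basic W")
    case False
    from Cons.IH[OF _ this] obtain U s t R where
      "\<not> compat s t" "wval W = wval (U @ s # t # R)" "mset W = mset (U @ s # t # R)"
      by blast
    then show ?thesis
      by (intro Cons.prems(1)[of s t "a # U" R]) simp_all
  next
    case True
    with Cons.prems(2) have "\<exists>t\<in>set W. \<not> compat a t"
      by (simp add: basic_def)
    then obtain U t R where W: "W = U @ t # R" and t: "\<not> compat a t" "\<forall>s\<in>set U. compat a s"
      using split_list_first_prop[of W "\<lambda>t. \<not> compat a t"] by blast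
    then show ?thesis
      using move_right[of U a] by (intro Cons.prems(1)[of a t U R]) (simp_all flip: mult.assoc)
  qed
qed

section \<open>Nonnegative combinations of words\<close>

text \<open>Each summand has a single coefficient monomial with factor 1; multiplicities arise by
  repetition, so membership itself encodes nonnegativity.\<close>

inductive_set pcone :: "letter list set \<Rightarrow> qtorus set" for P where
  zero: "0 \<in> pcone P"
| step: "t \<in> pcone P \<Longrightarrow> W \<in> P \<Longrightarrow> mon l \<gamma> * wval W + t \<in> pcone P"

lemma pcone_add: "s \<in> pcone P \<Longrightarrow> t \<in> pcone P \<Longrightarrow> s + t \<in> pcone P"
  by (induction rule: pcone.induct) (auto simp: add.assoc intro: pcone.step)

lemma pcone_wval: "W \<in> P \<Longrightarrow> mon l \<gamma> * wval W \<in> pcone P" "W \<in> P \<Longrightarrow> wval W \<in> pcone P"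
  using pcone.step[OF pcone.zero, of W P l \<gamma>] pcone.step[OF pcone.zero, of W P 0 0] by simp_all

lemma pcone_mon: "t \<in> pcone P \<Longrightarrow> mon l \<gamma> * t \<in> pcone P"
  by (induction rule: pcone.induct)
     (auto simp: distrib_left mon_mult_assoc intro: pcone.intros)

text \<open>Words are homogeneous, so coefficients inside a context move to the front at the cost of
  a power of q and without a sign.\<close>

lemma pcone_context:
  assumes "t \<in> pcone P" "\<And>W. W \<in> P \<Longrightarrow> wval U * wval W * wval R \<in> pcone Q"
  shows "wval U * t * wval R \<in> pcone Q"
  using assms(1)
proof (induction rule: pcone.induct)
  case (step t W l \<gamma>)
  have "wval U * (mon l \<gamma> * wval W + t) * wval R
     = mon (l - 2 * dot \<gamma> (sum_list (map ldeg U))) \<gamma> * (wval U * wval W * wval R) + wval U * t * wval R"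
    by (simp add: distrib_left distrib_right homog_right_assoc[OF homog_wval] mult.assoc)
  with step assms(2) show ?case
    by (simp add: pcone_add pcone_mon)
qed (simp add: pcone.zero)

text \<open>Conjugation reverses words and keeps coefficients nonnegative; it transfers a reduction
  of s t to one of t s.\<close>

lemma pcone_bar:
  assumes "t \<in> pcone P" "\<And>W. W \<in> P \<Longrightarrow> rev W \<in> P"
  shows "bar t \<in> pcone P"
  using assms(1)
proof (induction rule: pcone.induct)
  case (step t W l \<gamma>)
  have "bar (mon l \<gamma> * wval W + t)
     = mon (- l - 2 * dot \<gamma> (sum_list (map ldeg (rev W)))) \<gamma> * wval (rev W) + bar t"
    by (simp add: bar_add bar_mult bar_mon bar_wval homog_right[OF homog_wval])
  with step assms(2) show ?case
    by (simp add: pcone.step)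
qed (simp add: pcone.zero)

fun lsq :: "letter \<Rightarrow> nat" where
  "lsq (LX m) = nat (m * m)"
| "lsq _ = 0"

text \<open>Squares enter because x_m x_n is rewritten to x_{m+2} x_{n-2}: the sum of the indices
  stays fixed, but they move closer together when n - m >= 3.\<close>

definition wless :: "letter list \<Rightarrow> letter list \<Rightarrow> bool" where
  "wless W W' \<longleftrightarrow> length W < length W'
     \<or> length W = length W' \<and> sum_list (map lsq W) < sum_list (map lsq W')"

lemma wless_rev: "wless (rev W) W' = wless W W'" "wless W (rev W') = wless W W'"
  by (simp_all add: wless_def sum_list_rev flip: rev_map)

lemma wless_cong: "mset W = mset W' \<Longrightarrow> wless A W = wless A W'"
  by (simp add: wless_def mset_map sum_mset_sum_list[symmetric] flip: size_mset)

lemma wless_context: "wless W W' \<Longrightarrow> wless (U @ W @ R) (U @ W' @ R)"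
  by (auto simp: wless_def)

text \<open>By iterating \<open>cheb_step\<close>, with the constant 1 represented by the letter
  \<open>LU 0\<close>. The prefix \<open>U\<close> is there because x's at even distance give V
  times \<open>cheb\<close>.\<close>

lemma cheb_pcone: "wval U * cheb n \<in> pcone {U @ [LU k] | k. True}"
proof (induction n rule: cheb.induct)
  case 1
  then show ?case
    by (simp add: pcone.zero)
next
  case 2
  have "U @ [LU 0] \<in> {U @ [LU k] | k. True}"
    by blast
  from pcone_wval(2)[OF this] show ?case
    by simp
next
  case (3 n)
  have 1: "wval U * u_elem k \<in> pcone {U @ [LU k] | k. True}" for k
    using pcone_wval(2)[of "U @ [LU k]" "{U @ [LU k] | k. True}"] by auto
  show ?case
  proof (cases n)
    case 0
    then show ?thesis
      using 1[of 1] by simp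
  next
    case (Suc k)
    have "wval U * cheb (Suc (Suc n)) = wval U * u_elem (Suc (Suc k))
        + mon (0 - 2 * dot (1, 1, 1) (sum_list (map ldeg U))) (1, 1, 1) * (wval U * cheb (Suc k))"
      unfolding Suc cheb_step distrib_left homog_right_assoc[OF homog_wval] ..
    then show ?thesis
      using 3(2) Suc pcone_add[OF 1 pcone_mon] by simp
  qed
qed

lemma pcone_mono: "t \<in> pcone P \<Longrightarrow> P \<subseteq> Q \<Longrightarrow> t \<in> pcone Q"
  by (induction rule: pcone.induct) (auto intro: pcone.intros)

definition reducible :: "letter \<Rightarrow> letter \<Rightarrow> bool" where
  "reducible s t \<longleftrightarrow> lval s * lval t \<in> pcone {W. wless W [s, t]}"

lemma reducible_sym:
  assumes "reducible s t"
  shows "reducible t s"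
proof -
  have "{W. wless W [s, t]} = {W. wless W [t, s]}"
    by (auto simp: wless_cong[of "[s, t]" "[t, s]"] add_mset_commute)
  moreover have "bar (lval s * lval t) \<in> pcone {W. wless W [s, t]}"
    using assms unfolding reducible_def by (rule pcone_bar) (simp add: wless_rev)
  ultimately show ?thesis
    by (simp add: reducible_def bar_mult)
qed

lemma pcone_letter: "wless [r] [s, t] \<Longrightarrow> mon l \<gamma> * lval r \<in> pcone {W. wless W [s, t]}"
    "wless [r] [s, t] \<Longrightarrow> lval r \<in> pcone {W. wless W [s, t]}"
    "mon l \<gamma> \<in> pcone {W. wless W [s, t]}"
  using pcone_wval(1)[of "[r]" "{W. wless W [s, t]}" l \<gamma>] pcone_wval(2)[of "[r]" "{W. wless W [s, t]}"]
    pcone_wval(1)[of "[]" "{W. wless W [s, t]}" l \<gamma>]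
  by (simp_all add: wless_def)

lemma wless_single [simp]: "wless [r] [s, t]"
  by (simp add: wless_def)

text \<open>\<open>LU 0\<close> has value 1 yet is incompatible with every \<open>LX\<close>, so it
  is removed as a shortening; for n >= 1 the product is \<open>u_elem_x\<close>.\<close>

lemma reducible_U_X: "reducible (LU n) (LX m)"
proof (cases "n = 0")
  case True
  then show ?thesis
    using pcone_letter(2)[of "LX m" "LU n" "LX m"] by (simp add: reducible_def)
next
  case False
  then show ?thesis
    using pcone_add[OF pcone_letter(2)[of "LX (m + 2 * int n)"] pcone_letter(1)[of "LX (m - 2 * int n)"],
        of "LU n" "LX m" 0 "(int n, int n, int n)"]
    by (simp add: reducible_def u_elem_x Y_power)
qed

lemma reducible_U_U: "reducible (LU m) (LU n)"
proof -
  have main: "reducible (LU m) (LU (m + k))" for m k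
  proof -
    consider "m = 0" | "m \<noteq> 0" "k = 0" | "m \<noteq> 0" "k \<noteq> 0"
      by blast
    then show ?thesis
    proof cases
      case 1
      then show ?thesis
        using pcone_letter(2)[of "LU k" "LU m" "LU (m + k)"] by (simp add: reducible_def)
    next
      \<comment> \<open>Equal indices: the second term of the product formula involves
        \<open>tt 0 = 2\<close>, so the power of Y occurs twice.\<close>
      case 2
      then have "u_elem m * u_elem m = u_elem (2 * m) + (Y ^ m + Y ^ m)"
        using tt_mult[of m 0] by (simp add: tt_def mult_2_right)
      then show ?thesis
        using 2 pcone_add[OF pcone_letter(2)[of "LU (2 * m)"] pcone_add[OF pcone_letter(3) pcone_letter(3)],
            of "LU m" "LU m" 0 "(int m, int m, int m)" 0 "(int m, int m, int m)"]
        by (simp add: reducible_def Y_power)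
    next
      case 3
      then have "u_elem m * u_elem (m + k) = u_elem (2 * m + k) + Y ^ m * u_elem k"
        using tt_mult[of m k] by (simp add: tt_def)
      then show ?thesis
        using pcone_add[OF pcone_letter(2)[of "LU (2 * m + k)"] pcone_letter(1)[of "LU k"],
            of "LU m" "LU (m + k)" 0 "(int m, int m, int m)"]
        by (simp add: reducible_def Y_power)
    qed
  qed
  show ?thesis
  proof (cases "m \<le> n")
    case True
    then show ?thesis
      using main[of m "n - m"] by simp
  next
    case False
    then show ?thesis
      using main[of n "m - n"] by (intro reducible_sym[of "LU n"]) simp
  qed
qed

lemma reducible_W_Z: "reducible LW LZ"
  using pcone_add[OF pcone_add[OF pcone_letter(2)[of "LU 1"] pcone_letter(3)] pcone_letter(3),
      of LW LZ "- 1" "(1, 0, 1)" 1 "(0, 1, 0)"]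
  by (simp add: reducible_def w_z_eq)

lemma reducible_V_X:
  "even m \<Longrightarrow> reducible LW (LX m)" "odd m \<Longrightarrow> reducible LZ (LX m)"
proof -
  have "V m * x m \<in> pcone {W. wless W [s, LX m]}" for s
    unfolding V_x using pcone_letter(2)[of "LX (m + 1)"] pcone_letter(1)[of "LX (m - 1)"]
    by (intro pcone_add) simp_all
  then show "even m \<Longrightarrow> reducible LW (LX m)" "odd m \<Longrightarrow> reducible LZ (LX m)"
    by (simp_all add: reducible_def V_def)
qed

lemma reducible_X_X:
  assumes "m + 3 \<le> n"
  shows "reducible (LX m) (LX n)"
proof -
  define P where "P = {W. wless W [LX m, LX n]}"
  have less: "nat ((m + 2) * (m + 2)) + nat ((n - 2) * (n - 2)) < nat (m * m) + nat (n * n)"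
  proof -
    have "(m + 2) * (m + 2) + (n - 2) * (n - 2) < m * m + n * n"
      using assms by (simp add: algebra_simps)
    moreover have "0 \<le> (m + 2) * (m + 2) + (n - 2) * (n - 2)"
      by simp
    ultimately have "nat ((m + 2) * (m + 2) + (n - 2) * (n - 2)) < nat (m * m + n * n)"
      by (subst nat_less_eq_zless)
    then show ?thesis
      by (simp add: nat_add_distrib)
  qed
  then have "[LX (m + 2), LX (n - 2)] \<in> P"
    by (simp add: P_def wless_def)
  from pcone_wval(2)[OF this] have XX: "x (m + 2) * x (n - 2) \<in> pcone P"
    by simp
  have U: "mon l \<gamma> * cheb k \<in> pcone P" for l \<gamma> k
  proof (rule pcone_mon, rule pcone_mono)
    show "cheb k \<in> pcone {[] @ [LU j] | j. True}"
      using cheb_pcone[of "[]" k] by simp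
  qed (auto simp: P_def)
  \<comment> \<open>A word of w or z followed by some u_k is as long as the word being rewritten. It
    counts as smaller because its sum of squares is 0 and the present one is positive.\<close>
  have pos: "0 < nat (m * m) + nat (n * n)"
    using less by linarith
  have VU: "lval v * cheb k \<in> pcone P" if "v = LW \<or> v = LZ" for v k
  proof (rule pcone_mono)
    show "lval v * cheb k \<in> pcone {[v] @ [LU k] | k. True}"
      using cheb_pcone[of "[v]" k] by simp
    show "{[v] @ [LU k] |k. True} \<subseteq> P"
      using that pos by (auto simp: P_def wless_def)
  qed
  have "x m * x n \<in> pcone P"
  proof (cases "even (n - m)")
    case True
    then obtain j where "n - m = 2 * j" ..
    then obtain k where n: "n = m + 2 * int k + 2"
      using assms by (intro that[of "nat (j - 1)"]) linarith
    have "V (m + 1) * mon (- 1) (dexp m) * cheb k \<in> pcone P"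
      using VU[of LW k] VU[of LZ k]
      by (cases "even m")
         (simp_all add: V_def homog_right[OF homog_w] homog_right[OF homog_z] mult.assoc pcone_mon)
    moreover have "x (m + 2) * x (m + 2 * int k) \<in> pcone P"
      using XX by (simp add: n)
    ultimately show ?thesis
      unfolding n x_mult_even by (simp only: pcone_add mult.assoc)
  next
    case False
    then obtain j where "n - m = 2 * j + 1" ..
    then obtain k where n: "n = m + 2 * int k + 3"
      using assms by (intro that[of "nat (j - 1)"]) linarith
    have "x (m + 2) * x (m + 2 * int k + 1) \<in> pcone P"
      using XX by (simp add: n add.commute)
    then show ?thesis
      unfolding n x_mult_odd by (intro pcone_add U)
  qed
  then show ?thesis
    by (simp add: reducible_def P_def)
qed

lemma incompat_reducible: "\<not> compat s t \<Longrightarrow> reducible s t"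
proof -
  have sym: "reducible t s \<Longrightarrow> reducible s t" for s t
    by (rule reducible_sym)
  have xx: "reducible (LX m) (LX n)" if "\<not> \<bar>m - n\<bar> \<le> 2" for m n
  proof (cases "m \<le> n")
    case False
    show ?thesis
      by (rule sym, rule reducible_X_X) (use that False in linarith)
  qed (use that in \<open>auto intro: reducible_X_X\<close>)
  assume "\<not> compat s t"
  then show ?thesis
    by (cases s; cases t)
       (auto intro: xx reducible_U_X reducible_U_U reducible_W_Z reducible_V_X
          sym[OF reducible_U_X] sym[OF reducible_W_Z] sym[OF reducible_V_X(1)] sym[OF reducible_V_X(2)])
qed

text \<open>Each rewriting step shortens a word or keeps its length and decreases the sum of the squares of
  the indices of its bridging variables.\<close>

lemma wval_pcone: "wval W \<in> pcone {W. basic W}"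
proof -
  have "wf {(W, W'). wless W W'}"
    by (rule wf_subset[of "measures [length, \<lambda>W. sum_list (map lsq W)]"]) (auto simp: wless_def)
  then show ?thesis
  proof (induction W)
    case (less W)
    show ?case
    proof (cases "basic W")
      case True
      then show ?thesis
        by (intro pcone_wval(2)) simp
    next
      case False
      then obtain U s t R where *: "\<not> compat s t" "wval W = wval (U @ s # t # R)"
          "mset W = mset (U @ s # t # R)"
        by (rule not_basic_factor)
      have "wval U * (lval s * lval t) * wval R \<in> pcone {W. basic W}"
      proof (rule pcone_context)
        show "lval s * lval t \<in> pcone {W. wless W [s, t]}"
          using incompat_reducible[OF *(1)] by (simp add: reducible_def)
        fix W' assume "W' \<in> {W. wless W [s, t]}"
        then have "wless (U @ W' @ R) W"
          using wless_context[of W' "[s, t]" U R] by (simp add: wless_cong[OF *(3)])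
        then show "wval U * wval W' * wval R \<in> pcone {W. basic W}"
          using less[of "U @ W' @ R"] by (simp add: mult.assoc)
      qed
      then show ?thesis
        by (simp add: *(2) mult.assoc)
    qed
  qed
qed

section \<open>The bridging cluster variables\<close>

text \<open>For m <= 0 this is \<open>- dexp m\<close>. Multiplication by it shifts the lowest term
  of x_m to y-degree 0.\<close>

definition gam :: "int \<Rightarrow> z3" where
  "gam m = (if 1 \<le> m then 0
     else if even m then (- (m div 2), - (m div 2), 1 - m div 2)
     else (- (m div 2) - 1, - (m div 2), - (m div 2)))"

text \<open>The power of \<open>q\<close> is the one that makes \<open>X\<^sub>m\<close> bar-invariant.\<close>

definition aX :: "int \<Rightarrow> qtorus" where
  "aX m = mon (- dot (gam m) (xdeg m)) (gam m) * x m"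

text \<open>The g-vector of X_m, that is, \<open>xdeg m\<close> plus the degree of the coefficient
  monomial with exponent \<open>gam m\<close>.\<close>

definition gX :: "int \<Rightarrow> z3" where
  "gX m = (if 1 \<le> m then xdeg m
     else if even m then (m div 2, 0, - (m div 2) - 1)
     else (m div 2 + 1, - 1, - (m div 2) - 1))"

lemma aX_pos: "1 \<le> m \<Longrightarrow> aX m = x m"
  by (simp add: aX_def gam_def)

lemma homog_aX: "homog (aX m) (gX m)"
proof -
  obtain a b c where g: "gam m = (a, b, c)"
    by (metis prod.exhaust)
  have "homog (aX m) ((- b - c, a - c, a + b) + xdeg m)"
    unfolding aX_def g by (intro homog_mult homog_mon homog_x)
  moreover have "(- b - c, a - c, a + b) + xdeg m = gX m"
    using g by (cases "even m") (auto simp: gam_def gX_def xdeg_def zero_prod_def split: if_splits)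
  ultimately show ?thesis
    by simp
qed

lemma bar_aX [simp]: "bar (aX m) = aX m"
  by (simp add: aX_def bar_mult bar_mon homog_right[OF homog_x])

definition xxexp :: "int \<Rightarrow> int \<Rightarrow> int" where
  "xxexp m n = - dot (gam m) (xdeg m) - dot (gam n) (xdeg n) - 2 * dot (gam n) (xdeg m) + yform (gam m) (gam n)"

lemma aX_aX: "aX m * aX n = mon (xxexp m n) (gam m + gam n) * (x m * x n)"
  by (simp add: aX_def xxexp_def mult.assoc homog_right_assoc[OF homog_x] mon_mult_assoc algebra_simps)

definition posz :: "z3 \<Rightarrow> bool" where
  "posz \<gamma> \<longleftrightarrow> 0 \<le> fst \<gamma> \<and> 0 \<le> fst (snd \<gamma>) \<and> 0 \<le> snd (snd \<gamma>)"

lemma posz_simp [simp]: "posz (a, b, c) \<longleftrightarrow> 0 \<le> a \<and> 0 \<le> b \<and> 0 \<le> c"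
  by (simp add: posz_def)

text \<open>\<open>kap\<close>, \<open>lam\<close> and \<open>th\<close> are the coefficient
  exponents that remain in the relations for X_m X_{m+3}, V_m X_m and X_m X_{m+4} after
  normalization. Up to sign they are the c-vectors.\<close>

definition kap :: "int \<Rightarrow> z3" where
  "kap m = dexp m + gam (m + 1) + gam (m + 2)"

definition lam :: "int \<Rightarrow> z3" where
  "lam m = aexp m + gam (m + 1) - gam (m - 1)"

definition th :: "int \<Rightarrow> z3" where
  "th m = dexp m + gam (m + 2) + gam (m + 2)"

lemma half [simp]: "(2 * k + 3) div 2 = k + 1" "(2 * k - 1) div 2 = k - 1" "(2 * k - 2) div 2 = k - 1"
    "(2 * k + 5) div 2 = k + 2" "(2 * k - 3) div 2 = k - 2" "(k * 2 - 1) div 2 = k - 1"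
    "(k * 2 - 2) div 2 = k - 1" "(k * 2 - 3) div 2 = k - 2" for k :: int
  by presburger+

lemmas zdefs = gam_def gX_def xdeg_def dexp_def aexp_def kap_def lam_def th_def xxexp_def zero_prod_def

lemma parity_cases:
  fixes m :: int
  obtains k where "m = 2 * k" | k where "m = 2 * k + 1"
  by (metis evenE oddE)

text \<open>For m >= 1 nothing is rescaled, and for m <= -3 the outer and the inner pair are
  rescaled by the same exponent. For -2 <= m <= 0 the left side is rescaled only through X_m, by
  \<open>- dexp m\<close>; this cancels the coefficient of the constant term and moves it with the
  opposite sign to the other term.\<close>

lemma exchange_3:
  "1 \<le> m \<or> m \<le> - 3 \<Longrightarrow> posz (kap m) \<and> aX m * aX (m + 3) = mon (- 1) (kap m) + aX (m + 1) * aX (m + 2)"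
  "- 2 \<le> m \<Longrightarrow> m \<le> 0 \<Longrightarrow> posz (- kap m) \<and> aX m * aX (m + 3) = 1 + mon 1 (- kap m) * (aX (m + 1) * aX (m + 2))"
proof -
  have eq: "aX m * aX (m + 3) = mon (xxexp m (m + 3)) (gam m + gam (m + 3)) * (x (m + 1) * x (m + 2))
     + mon (xxexp m (m + 3) - 1 + yform (gam m + gam (m + 3)) (dexp m)) (gam m + gam (m + 3) + dexp m)"
    by (simp add: aX_aX x_mult_3 distrib_left mon_mult algebra_simps)
  show "posz (kap m) \<and> aX m * aX (m + 3) = mon (- 1) (kap m) + aX (m + 1) * aX (m + 2)" if m: "1 \<le> m \<or> m \<le> - 3"
  proof (cases "1 \<le> m")
    case True
    then show ?thesis
      by (auto simp: aX_pos x_mult_3 kap_def gam_def zero_prod_def dexp_def)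
  next
    case False
    with m have m: "m \<le> - 3"
      by simp
    have p: "posz (kap m) \<and> xxexp m (m + 3) = xxexp (m + 1) (m + 2) \<and> gam m + gam (m + 3) = gam (m + 1) + gam (m + 2)
       \<and> xxexp m (m + 3) - 1 + yform (gam m + gam (m + 3)) (dexp m) = - 1"
      using m by (cases m rule: parity_cases) (simp_all add: zdefs algebra_simps)
    then have p4: "gam m + gam (m + 3) + dexp m = kap m"
      by (simp add: kap_def add_ac)
    have p3: "xxexp m (m + 3) - 1 + yform (gam m + gam (m + 3)) (dexp m) = - 1"
      and p12: "posz (kap m)" "xxexp m (m + 3) = xxexp (m + 1) (m + 2)" "gam m + gam (m + 3) = gam (m + 1) + gam (m + 2)"
      using p by blast+
    show ?thesis
      unfolding eq p3 p4 unfolding p12 aX_aX[of "m + 1"] by (simp only: add.commute simp_thms p12(1))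
  qed
  show "posz (- kap m) \<and> aX m * aX (m + 3) = 1 + mon 1 (- kap m) * (aX (m + 1) * aX (m + 2))" if m: "- 2 \<le> m" "m \<le> 0"
  proof -
    have "m = 0 \<or> m = - 1 \<or> m = - 2"
      using m by linarith
    then show ?thesis
      unfolding eq aX_aX[of "m + 1"] by (elim disjE) (simp_all add: zdefs mon_mult mon_mult_assoc)
  qed
qed

lemma exchange_V:
  "1 \<le> m \<Longrightarrow> posz (lam m) \<and> V m * aX m = aX (m + 1) + mon 1 (lam m) * aX (m - 1)"
  "m \<le> 0 \<Longrightarrow> posz (- lam m) \<and> V m * aX m = mon (- 1) (- lam m) * aX (m + 1) + aX (m - 1)"
proof -
  have V_aX: "V m * aX m = mon (- dot (gam m) (xdeg m) - 2 * dot (gam m) (if even m then (0, - 1, 1) else (- 1, 1, 0))) (gam m)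
       * (x (m + 1) + mon 1 (aexp m) * x (m - 1))" for m
    by (simp add: aX_def homog_right_assoc[OF homog_V] V_x)
  show "posz (lam m) \<and> V m * aX m = aX (m + 1) + mon 1 (lam m) * aX (m - 1)" if "1 \<le> m"
  \<comment> \<open>At m = 1 the term X_0 is rescaled while X_1 and X_2 are not.\<close>
  proof (cases "m = 1")
    case True
    then show ?thesis
      unfolding V_aX unfolding aX_def by (simp add: zdefs mon_mult_assoc distrib_left)
  next
    case False
    with that show ?thesis
      by (auto simp: aX_pos V_x lam_def gam_def zero_prod_def aexp_def)
  qed
  show "posz (- lam m) \<and> V m * aX m = mon (- 1) (- lam m) * aX (m + 1) + aX (m - 1)" if "m \<le> 0"
  \<comment> \<open>At m = 0 the term X_1 is not rescaled while X_0 and X_{-1} are.\<close>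
  proof (cases "m = 0")
    case True
    then show ?thesis
      unfolding V_aX unfolding aX_def by (simp add: zdefs mon_mult_assoc distrib_left)
  next
    case False
    with that have "m \<le> - 1"
      by simp
    then show ?thesis
      unfolding V_aX unfolding aX_def
      by (cases m rule: parity_cases) (simp_all add: zdefs mon_mult_assoc distrib_left algebra_simps)
  qed
qed

text \<open>As for distance three: the sign changes exactly when m <= 0 < m + 4.\<close>

lemma exchange_4:
  "1 \<le> m \<or> m \<le> - 4 \<Longrightarrow> posz (th m)
      \<and> aX m * aX (m + 4) = mon (- 1) (th m) * V (m + 1) + aX (m + 2) * aX (m + 2)"
  "- 3 \<le> m \<Longrightarrow> m \<le> 0 \<Longrightarrow> posz (- th m)
      \<and> aX m * aX (m + 4) = V (m + 1) + mon 1 (- th m) * (aX (m + 2) * aX (m + 2))"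
proof -
  have V_d: "V (m + 1) * mon (- 1) (dexp m) = mon (- 1) (dexp m) * V (m + 1)"
    by (cases m rule: parity_cases) (simp_all add: dexp_def V_mon)
  have eq: "aX m * aX (m + 4) = mon (xxexp m (m + 4)) (gam m + gam (m + 4)) * (x (m + 2) * x (m + 2))
     + mon (xxexp m (m + 4) - 1 + yform (gam m + gam (m + 4)) (dexp m)) (gam m + gam (m + 4) + dexp m) * V (m + 1)"
    by (simp only: aX_aX x_mult_4 V_d distrib_left mon_mult_assoc) (simp add: algebra_simps)
  show "posz (th m) \<and> aX m * aX (m + 4) = mon (- 1) (th m) * V (m + 1) + aX (m + 2) * aX (m + 2)" if m: "1 \<le> m \<or> m \<le> - 4"
  proof (cases "1 \<le> m")
    case True
    then show ?thesis
    proof -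
      have "th m = dexp m" "posz (dexp m)"
        using True by (auto simp: th_def gam_def dexp_def zero_prod_def elim!: evenE oddE)
      with True show ?thesis
        by (simp add: aX_pos x_mult_4 V_d)
    qed
  next
    case False
    with m have m: "m \<le> - 4"
      by simp
    have p: "posz (th m) \<and> xxexp m (m + 4) = xxexp (m + 2) (m + 2) \<and> gam m + gam (m + 4) = gam (m + 2) + gam (m + 2)
       \<and> xxexp m (m + 4) - 1 + yform (gam m + gam (m + 4)) (dexp m) = - 1"
      using m by (cases m rule: parity_cases) (simp_all add: zdefs algebra_simps)
    then have p4: "gam m + gam (m + 4) + dexp m = th m"
      by (simp add: th_def add_ac)
    have p3: "xxexp m (m + 4) - 1 + yform (gam m + gam (m + 4)) (dexp m) = - 1"
      and p12: "posz (th m)" "xxexp m (m + 4) = xxexp (m + 2) (m + 2)" "gam m + gam (m + 4) = gam (m + 2) + gam (m + 2)"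
      using p by blast+
    show ?thesis
      unfolding eq p3 p4 unfolding p12 aX_aX[of "m + 2"] by (simp only: add.commute simp_thms p12(1))
  qed
  show "posz (- th m) \<and> aX m * aX (m + 4) = V (m + 1) + mon 1 (- th m) * (aX (m + 2) * aX (m + 2))" if m: "- 3 \<le> m" "m \<le> 0"
  proof -
    have "m = 0 \<or> m = - 1 \<or> m = - 2 \<or> m = - 3"
      using m by linarith
    then show ?thesis
      unfolding eq aX_aX[of "m + 2"] by (elim disjE) (simp_all add: zdefs mon_mult mon_mult_assoc)
  qed
qed

section \<open>Leading terms\<close>

fun ydeg :: "qmon \<Rightarrow> int" where
  "ydeg (QMon l (a, b, c, d, e, f)) = d + e + f"

lemma ydeg_add: "ydeg (k + k') = ydeg k + ydeg k'"
proof -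
  obtain l a1 a2 a3 a4 a5 a6 where "k = QMon l (a1, a2, a3, a4, a5, a6)"
    by (metis qmon.exhaust prod.exhaust)
  moreover obtain l' b1 b2 b3 b4 b5 b6 where "k' = QMon l' (b1, b2, b3, b4, b5, b6)"
    by (metis qmon.exhaust prod.exhaust)
  ultimately show ?thesis
    by (simp add: plus_qmon_def)
qed

definition yge :: "int \<Rightarrow> qtorus set" where
  "yge n = {t. \<forall>k\<in>Poly_Mapping.keys t. n \<le> ydeg k}"

lemma yge_add: "s \<in> yge n \<Longrightarrow> t \<in> yge n \<Longrightarrow> s + t \<in> yge n"
  using keys_add[of s t] by (auto simp: yge_def)

lemma yge_diff: "s \<in> yge n \<Longrightarrow> t \<in> yge n \<Longrightarrow> s - t \<in> yge n"
  using keys_diff[of s t] by (auto simp: yge_def)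

lemma yge_mono: "s \<in> yge n \<Longrightarrow> m \<le> n \<Longrightarrow> s \<in> yge m"
  by (auto simp: yge_def)

lemma yge_mult: "s \<in> yge m \<Longrightarrow> t \<in> yge n \<Longrightarrow> s * t \<in> yge (m + n)"
proof -
  assume *: "s \<in> yge m" "t \<in> yge n"
  show ?thesis
    unfolding yge_def
  proof (clarsimp simp del: not_in_keys_iff_lookup_eq_zero)
    fix k assume "k \<in> Poly_Mapping.keys (s * t)"
    then obtain a b where "a \<in> Poly_Mapping.keys s" "b \<in> Poly_Mapping.keys t" "k = a + b"
      using keys_mult[of s t] by blast
    with * show "m + n \<le> ydeg k"
      by (auto simp: yge_def ydeg_add intro!: add_mono)
  qed
qed

lemma yge_Xm: "Xm (a, b, c, d, e, f) \<in> yge n \<longleftrightarrow> n \<le> d + e + f"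
  by (simp add: yge_def Xm_def)

lemma yge_mon: "mon l (a, b, c) \<in> yge n \<longleftrightarrow> n \<le> a + b + c"
  by (simp add: yge_def mon_def)

definition Xlow :: "z3 \<Rightarrow> qtorus" where
  "Xlow g = (case g of (a, b, c) \<Rightarrow> Xm (a, b, c, 0, 0, 0))"

text \<open>\<open>Lambda\<close> vanishes on the first three coordinates, so lowest parts multiply
  without a power of q.\<close>

lemma Xlow_mult: "Xlow g * Xlow h = Xlow (g + h)"
  by (cases g; cases h) (simp add: Xlow_def Xm_def mult_single plus_qmon_def Lambda_expand)

lemma Xlow_0 [simp]: "Xlow 0 = 1"
  by (simp add: Xlow_def Xm_def zero_prod_def zero_qmon_def single_one[symmetric] del: single_one)

lemma Xlow_yge: "Xlow g \<in> yge 0"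
  by (cases g) (simp add: Xlow_def yge_Xm)

text \<open>The part of y-degree 0 is one monomial with coefficient 1, and all else has positive
  y-degree. For a cluster variable this says that its F-polynomial has constant term 1.\<close>

definition pointed :: "qtorus \<Rightarrow> z3 \<Rightarrow> bool" where
  "pointed t g \<longleftrightarrow> t - Xlow g \<in> yge 1"

lemma pointed_Xlow_add: "t \<in> yge 1 \<Longrightarrow> pointed (Xlow g + t) g"
  by (simp add: pointed_def)

lemma pointed_yge: "pointed t g \<Longrightarrow> t \<in> yge 0"
  using yge_add[OF Xlow_yge yge_mono[of "t - Xlow g" 1 0], of g] by (simp add: pointed_def)

lemma pointed_1: "pointed 1 0"
  by (simp add: pointed_def yge_def)

lemma pointed_mult:
  assumes "pointed s g" "pointed t h"
  shows "pointed (s * t) (g + h)"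
proof -
  have "s * t - Xlow (g + h) = (s - Xlow g) * t + Xlow g * (t - Xlow h)"
    by (simp add: left_diff_distrib right_diff_distrib Xlow_mult)
  moreover have "(s - Xlow g) * t \<in> yge 1"
    using yge_mult[of "s - Xlow g" 1 t 0] assms pointed_yge by (auto simp: pointed_def)
  moreover have "Xlow g * (t - Xlow h) \<in> yge 1"
    using yge_mult[OF Xlow_yge, of "t - Xlow h" 1 g] assms by (simp add: pointed_def)
  ultimately show ?thesis
    by (simp add: pointed_def yge_add)
qed

lemma pointed_diff: "pointed s g \<Longrightarrow> t \<in> yge 1 \<Longrightarrow> pointed (s - t) g"
  using yge_diff[of "s - Xlow g" 1 t] by (simp add: pointed_def algebra_simps)

lemma pointed_lookup:
  assumes "pointed t (a, b, c)"
  shows "Poly_Mapping.lookup t (QMon 0 (a, b, c, 0, 0, 0)) = 1"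
proof -
  have "QMon 0 (a, b, c, 0, 0, 0) \<notin> Poly_Mapping.keys (t - Xlow (a, b, c))"
    using assms by (force simp: pointed_def yge_def)
  then show ?thesis
    by (simp add: in_keys_iff lookup_minus Xlow_def Xm_def)
qed

lemma pointed_nonzero: "pointed t g \<Longrightarrow> t \<noteq> 0"
  by (cases g) (auto dest: pointed_lookup)

lemma pointed_w: "pointed w_elem (0, - 1, 1)"
  by (simp add: pointed_def w_elem_def Xlow_def yge_Xm)

lemma pointed_z: "pointed z_elem (- 1, 1, 0)"
proof -
  have "z_elem - Xlow (- 1, 1, 0) = Xm (0, 1, - 1, 1, 0, 1) + Xm (- 1, 0, - 1, 1, 0, 0)"
    by (simp add: z_elem_def Xlow_def)
  then show ?thesis
    unfolding pointed_def by (simp add: yge_add yge_Xm)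
qed

lemma pointed_V: "pointed (V m) (if even m then (0, - 1, 1) else (- 1, 1, 0))"
  by (simp add: V_def pointed_w pointed_z)

lemma pointed_u1: "pointed u1_elem (- 1, 0, 1)"
proof -
  have "pointed (w_elem * z_elem) (- 1, 0, 1)"
    using pointed_mult[OF pointed_w pointed_z] by simp
  then show ?thesis
    unfolding u1_eq by (intro pointed_diff) (simp_all add: yge_mon)
qed

lemma pointed_u_elem: "pointed (u_elem n) (- int n, 0, int n)"
proof (induction n rule: u_elem.induct)
  case 3
  show ?case
    using pointed_diff[OF pointed_mult[OF pointed_u1 pointed_u1] yge_add] yge_mon[of 0 1 1 1 1]
    by (simp add: u_elem_2)
next
  case (4 n)
  have "Y * u_elem (Suc n) \<in> yge 1"
    using yge_mult[of Y 1, OF _ pointed_yge[OF 4(2)]] by (simp add: yge_mon)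
  from pointed_diff[OF pointed_mult[OF pointed_u1 4(1)] this] show ?case
    by (simp add: u_elem_Suc)
qed (use pointed_1 pointed_u1 in \<open>simp_all add: zero_prod_def\<close>)

lemma pointed_aX: "pointed (aX m) (gX m)"
proof -
  have V: "pointed (V m * aX m) ((if even m then (0, - 1, 1) else (- 1, 1, 0)) + gX m)" if "pointed (aX m) (gX m)" for m
    by (rule pointed_mult[OF pointed_V that])
  have *: "mon l \<gamma> * t \<in> yge 1" if "posz \<gamma>" "\<gamma> \<noteq> 0" "pointed t g" for l \<gamma> t g
  proof -
    obtain a b c where "\<gamma> = (a, b, c)"
      by (metis prod.exhaust)
    with that(1,2) have "mon l \<gamma> \<in> yge 1"
      by (auto simp: yge_mon zero_prod_def)
    from yge_mult[OF this pointed_yge[OF that(3)]] show ?thesis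
      by simp
  qed
  have "pointed (aX m) (gX m) \<and> pointed (aX (m + 1)) (gX (m + 1))"
  proof (induction m rule: int_induct[where k = 1])
    case base
    show ?case
      by (simp add: aX_pos x_1 x_2 gX_def xdeg_def pointed_def Xlow_def yge_def)
  next
    case (step1 i)
    have lam: "lam (i + 1) \<noteq> 0"
      using step1(1) by (cases i rule: parity_cases) (auto simp: zdefs)
    have eq: "aX (i + 2) = V (i + 1) * aX (i + 1) - mon 1 (lam (i + 1)) * aX i"
      using exchange_V(1)[of "i + 1"] step1(1) by (simp add: add.commute)
    have g: "(if even (i + 1) then (0, - 1, 1) else (- 1, 1, 0)) + gX (i + 1) = gX (i + 2)"
      using step1(1) by (cases i rule: parity_cases) (auto simp: zdefs)
    have "pointed (aX (i + 2)) (gX (i + 2))"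
      unfolding eq g[symmetric] using step1 exchange_V(1)[of "i + 1"] lam
      by (intro pointed_diff V *) auto
    then show ?case
      using step1 by (simp add: add.assoc)
  next
    case (step2 i)
    show ?case
    proof (cases "i = 1")
      case True
      \<comment> \<open>In the relation for V_1 X_1 the coefficient stands at X_0 itself, so X_0 is
        not a product minus terms of positive y-degree; its expansion is used directly.\<close>
      have "aX 0 = Xlow (0, 0, - 1) + Xm (1, 1, - 1, 0, 0, 1)"
        by (simp add: aX_def x_0 zdefs mon_mult_assoc Xlow_def)
      then show ?thesis
        using step2 True by (simp add: pointed_Xlow_add yge_Xm gX_def)
    next
      case False
      with step2(1) have i: "i \<le> 0"
        by simp
      have lam: "- lam i \<noteq> 0"
        using i by (cases i rule: parity_cases) (auto simp: zdefs, presburger)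
      have eq: "aX (i - 1) = V i * aX i - mon (- 1) (- lam i) * aX (i + 1)"
        using exchange_V(2)[of i] i by simp
      have g: "(if even i then (0, - 1, 1) else (- 1, 1, 0)) + gX i = gX (i - 1)"
        using i by (cases i rule: parity_cases) (auto simp: zdefs)
      have "pointed (aX (i - 1)) (gX (i - 1))"
        unfolding eq g[symmetric] using step2 exchange_V(2)[of i] lam i
        by (intro pointed_diff V *) auto
      then show ?thesis
        using step2 by simp
    qed
  qed
  then show ?thesis ..
qed

section \<open>Clusters\<close>

fun aval :: "letter \<Rightarrow> qtorus" where
  "aval (LX m) = aX m"
| "aval LW = w_elem"
| "aval LZ = z_elem"
| "aval (LU n) = u_elem n"

fun gvec :: "letter \<Rightarrow> z3" where
  "gvec (LX m) = gX m"
| "gvec LW = (0, - 1, 1)"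
| "gvec LZ = (- 1, 1, 0)"
| "gvec (LU n) = (- int n, 0, int n)"

lemma bar_aval [simp]: "bar (aval s) = aval s"
  by (cases s) simp_all

lemma homog_aval: "homog (aval s) (gvec s)"
  by (cases s) (simp_all add: homog_aX homog_w homog_z homog_u_elem)

lemma pointed_aval: "pointed (aval s) (gvec s)"
  by (cases s) (simp_all add: pointed_aX pointed_w pointed_z pointed_u_elem)

lemma aval_nonzero: "aval s \<noteq> 0"
  by (rule pointed_nonzero[OF pointed_aval])

text \<open>The piecewise definitions branch between the indices 0 and 1. For m outside -3, ..., 1
  the indices m - 1, ..., m + 4 all lie on one side of that break.\<close>

lemma int_regimes [case_names even odd one zero m1 m2 m3 neven nodd]:
  fixes m :: int
  assumes "\<And>k. 1 \<le> k \<Longrightarrow> P (2 * k)" "\<And>k. 1 \<le> k \<Longrightarrow> P (2 * k + 1)" "P 1" "P 0" "P (- 1)" "P (- 2)" "P (- 3)"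
    "\<And>k. k \<le> - 2 \<Longrightarrow> P (2 * k)" "\<And>k. k \<le> - 3 \<Longrightarrow> P (2 * k + 1)"
  shows "P m"
proof (cases m rule: parity_cases)
  case (1 k)
  have "1 \<le> k \<or> m = 0 \<or> m = - 2 \<or> k \<le> - 2"
    using 1 by presburger
  then show ?thesis
    using assms(1,8)[of k] assms(4,6) 1 by (elim disjE) simp_all
next
  case (2 k)
  have "1 \<le> k \<or> m = 1 \<or> m = - 1 \<or> m = - 3 \<or> k \<le> - 3"
    using 2 by presburger
  then show ?thesis
    using assms(2,9)[of k] assms(3,5,7) 2 by (elim disjE) simp_all
qed

text \<open>Rescaling by coefficients that are not central could destroy commutation; it does not,
  since \<open>xxexp\<close> is symmetric at distances one and two.\<close>

lemma aX_commute: "\<bar>m - n\<bar> \<le> 2 \<Longrightarrow> aX m * aX n = aX n * aX m"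
proof -
  have "xxexp m (m + 1) = xxexp (m + 1) m \<and> xxexp m (m + 2) = xxexp (m + 2) m" for m
    by (induct m rule: int_regimes; simp add: zdefs algebra_simps)
  then have sym: "xxexp m (m + 1) = xxexp (m + 1) m" "xxexp m (m + 2) = xxexp (m + 2) m" for m
    by blast+
  have comm: "aX m * aX (m + 1) = aX (m + 1) * aX m" "aX m * aX (m + 2) = aX (m + 2) * aX m" for m
    unfolding aX_aX sym x_commute_1 x_commute_2 by (simp_all only: add.commute)
  assume "\<bar>m - n\<bar> \<le> 2"
  then have "n = m \<or> n = m + 1 \<or> n = m + 2 \<or> m = n + 1 \<or> m = n + 2"
    by linarith
  then show ?thesis
    by (elim disjE) (simp_all only: comm)
qed

lemma aX_V_commute: "aX m * V (m + 1) = V (m + 1) * aX m"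
proof -
  have "V (m + 1) * mon l (gam m) = mon l (gam m) * V (m + 1)" for l
    by (cases m rule: parity_cases) (simp_all add: gam_def V_mon zero_prod_def)
  then show ?thesis
    by (simp add: aX_def mult.assoc x_V_commute) (simp flip: mult.assoc)
qed

lemma aX_w_z_commute: "odd m \<Longrightarrow> aX m * w_elem = w_elem * aX m" "even m \<Longrightarrow> aX m * z_elem = z_elem * aX m"
  using aX_V_commute[of m] by (simp_all add: V_def)

lemma compat_aval: "compat s t \<Longrightarrow> aval s * aval t = aval t * aval s"
  by (cases s; cases t) (simp_all add: aX_commute u_elem_w_z_commute aX_w_z_commute)

datatype cluster = CA int | CB int

definition vlet :: "int \<Rightarrow> letter" where
  "vlet m = (if even m then LW else LZ)"

definition gV :: "int \<Rightarrow> z3" where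
  "gV m = (if even m then (0, - 1, 1) else (- 1, 1, 0))"

lemma vlet [simp]: "aval (vlet m) = V m" "gvec (vlet m) = gV m" "vlet (m + 2) = vlet m" "gV (m + 2) = gV m"
  by (simp_all add: vlet_def V_def gV_def)

fun clt :: "cluster \<Rightarrow> nat \<Rightarrow> letter" where
  "clt (CA m) p = LX (if p = 1 then m else if p = 2 then m + 1 else m + 2)"
| "clt (CB m) p = (if p = 1 then LX m else if p = 2 then vlet (m + 1) else LX (m + 2))"

text \<open>The second matrix is the mutation of \<open>bmat0\<close> at its middle position. The
  entry 2 belongs to the pair X_m, X_{m+2}.\<close>

fun cbt :: "cluster \<Rightarrow> nat \<Rightarrow> nat \<Rightarrow> int" where
  "cbt (CA m) p q = bmat0 p q"
| "cbt (CB m) p q = [[0, - 1, 2], [1, 0, - 1], [- 2, 1, 0]] ! (p - 1) ! (q - 1)"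

text \<open>The third column carries a minus sign and a shifted index because exchanging X_{m+2}
  uses the relation that starts at the lower index, X_{m-1} or X_{m-2}.\<close>

fun ccol :: "cluster \<Rightarrow> nat \<Rightarrow> z3" where
  "ccol (CA m) p = (if p = 1 then kap m else if p = 2 then lam (m + 1) else - kap (m - 1))"
| "ccol (CB m) p = (if p = 1 then th m else if p = 2 then - lam (m + 1) else - th (m - 2))"

lemma clt_compat: "p \<in> {1, 2, 3} \<Longrightarrow> q \<in> {1, 2, 3} \<Longrightarrow> compat (clt C p) (clt C q)"
  by (cases C) (auto simp: vlet_def)

section \<open>Duality of c-vectors and g-vectors\<close>

lemma kap_gX: "dot (kap m) (gX m) = 1" "dot (kap m) (gX (m + 1)) = 0" "dot (kap m) (gX (m + 2)) = 0"
    "dot (kap m) (gX (m + 3)) = - 1"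
proof -
  have "dot (kap m) (gX m) = 1 \<and> dot (kap m) (gX (m + 1)) = 0 \<and> dot (kap m) (gX (m + 2)) = 0
      \<and> dot (kap m) (gX (m + 3)) = - 1"
    by (induct m rule: int_regimes; simp add: zdefs algebra_simps)
  then show "dot (kap m) (gX m) = 1" "dot (kap m) (gX (m + 1)) = 0" "dot (kap m) (gX (m + 2)) = 0"
      "dot (kap m) (gX (m + 3)) = - 1"
    by simp_all
qed

lemma lam_gX: "dot (lam m) (gX (m - 1)) = 0" "dot (lam m) (gX m) = 1" "dot (lam m) (gX (m + 1)) = 0"
    "dot (lam m) (gV m) = - 1"
proof -
  have "dot (lam m) (gX (m - 1)) = 0 \<and> dot (lam m) (gX m) = 1 \<and> dot (lam m) (gX (m + 1)) = 0
      \<and> dot (lam m) (gV m) = - 1"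
    by (induct m rule: int_regimes; simp add: zdefs gV_def algebra_simps)
  then show "dot (lam m) (gX (m - 1)) = 0" "dot (lam m) (gX m) = 1" "dot (lam m) (gX (m + 1)) = 0"
      "dot (lam m) (gV m) = - 1"
    by simp_all
qed

lemma th_gX: "dot (th m) (gX m) = 1" "dot (th m) (gX (m + 2)) = 0" "dot (th m) (gX (m + 4)) = - 1"
    "dot (th m) (gV (m + 1)) = 0"
proof -
  have "dot (th m) (gX m) = 1 \<and> dot (th m) (gX (m + 2)) = 0 \<and> dot (th m) (gX (m + 4)) = - 1
      \<and> dot (th m) (gV (m + 1)) = 0"
    by (induct m rule: int_regimes; simp add: zdefs gV_def algebra_simps)
  then show "dot (th m) (gX m) = 1" "dot (th m) (gX (m + 2)) = 0" "dot (th m) (gX (m + 4)) = - 1"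
      "dot (th m) (gV (m + 1)) = 0"
    by simp_all
qed

text \<open>The C-matrix and the G-matrix are inverse transposes. Later this shows that the
  coefficient of an exchange commutes with the variables that stay, and that no c-vector is
  zero.\<close>

lemma duality: "p \<in> {1, 2, 3} \<Longrightarrow> q \<in> {1, 2, 3} \<Longrightarrow> dot (ccol C q) (gvec (clt C p)) = of_bool (p = q)"
proof -
  assume "p \<in> {1, 2, 3}" "q \<in> {1, 2, 3}"
  moreover have "dot (lam (m + 1)) (gX m) = 0" "dot (lam (m + 1)) (gX (m + 2)) = 0"
    "dot (kap (m - 1)) (gX m) = 0" "dot (kap (m - 1)) (gX (m + 1)) = 0" "dot (kap (m - 1)) (gX (m + 2)) = - 1"
    "dot (th (m - 2)) (gX m) = 0" "dot (th (m - 2)) (gX (m + 2)) = - 1" "dot (th (m - 2)) (gV (m + 1)) = 0" for m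
    using lam_gX[of "m + 1"] kap_gX[of "m - 1"] th_gX[of "m - 2"] vlet(4)[of "m - 1"]
    by (simp_all add: algebra_simps)
  ultimately show ?thesis
    by (cases C) (auto simp: kap_gX lam_gX th_gX)
qed

fun smul :: "int \<Rightarrow> z3 \<Rightarrow> z3" where
  "smul k (a, b, c) = (k * a, k * b, k * c)"

text \<open>The degree, in the sense of \<open>homog\<close>, of the coefficient monomial with the
  given exponent.\<close>

fun lamlow :: "z3 \<Rightarrow> z3" where
  "lamlow (a, b, c) = (- b - c, a - c, a + b)"

definition cprod :: "cluster \<Rightarrow> (nat \<Rightarrow> int) \<Rightarrow> qtorus" where
  "cprod C e = aval (clt C 1) ^ nat (e 1) * aval (clt C 2) ^ nat (e 2) * aval (clt C 3) ^ nat (e 3)"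

text \<open>Mutation of the cluster \<open>C\<close> at its \<open>q\<close>-th position yields \<open>C'\<close>, where \<open>\<rho>\<close> sends positions of \<open>C\<close> to
  positions of \<open>C'\<close>. The columns of coefficients are sign-coherent, so the mutation rules are stated
  separately for the two signs.\<close>

definition mutlink :: "cluster \<Rightarrow> nat \<Rightarrow> cluster \<Rightarrow> (nat \<Rightarrow> nat) \<Rightarrow> bool" where
  "mutlink C q C' \<rho> \<longleftrightarrow>
     bij_betw \<rho> {1, 2, 3} {1, 2, 3} \<and>
     (\<forall>p\<in>{1, 2, 3}. p \<noteq> q \<longrightarrow> clt C' (\<rho> p) = clt C p) \<and>
     (\<forall>p\<in>{1, 2, 3}. \<forall>r\<in>{1, 2, 3}. cbt C' (\<rho> p) (\<rho> r) =
        (if p = q \<or> r = q then - cbt C p r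
         else cbt C p r + (\<bar>cbt C p q\<bar> * cbt C q r + cbt C p q * \<bar>cbt C q r\<bar>) div 2)) \<and>
     ccol C' (\<rho> q) = - ccol C q \<and>
     (posz (ccol C q) \<and>
        (\<forall>p\<in>{1, 2, 3}. p \<noteq> q \<longrightarrow> ccol C' (\<rho> p) = ccol C p + smul (pos_part (cbt C q p)) (ccol C q)) \<and>
        gvec (clt C' (\<rho> q)) = - gvec (clt C q) + smul (pos_part (- cbt C 1 q)) (gvec (clt C 1))
          + smul (pos_part (- cbt C 2 q)) (gvec (clt C 2)) + smul (pos_part (- cbt C 3 q)) (gvec (clt C 3)) \<and>
        aval (clt C q) * aval (clt C' (\<rho> q)) =
          mon (- 1) (ccol C q) * cprod C (\<lambda>p. pos_part (cbt C p q)) + cprod C (\<lambda>p. pos_part (- cbt C p q))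
      \<or> posz (- ccol C q) \<and>
        (\<forall>p\<in>{1, 2, 3}. p \<noteq> q \<longrightarrow> ccol C' (\<rho> p) = ccol C p + smul (pos_part (- cbt C q p)) (ccol C q)) \<and>
        gvec (clt C' (\<rho> q)) = - gvec (clt C q) + smul (pos_part (- cbt C 1 q)) (gvec (clt C 1))
          + smul (pos_part (- cbt C 2 q)) (gvec (clt C 2)) + smul (pos_part (- cbt C 3 q)) (gvec (clt C 3))
          + lamlow (- ccol C q) \<and>
        aval (clt C q) * aval (clt C' (\<rho> q)) =
          cprod C (\<lambda>p. pos_part (cbt C p q)) + mon 1 (- ccol C q) * cprod C (\<lambda>p. pos_part (- cbt C p q)))"

text \<open>Relabelings for the replacements: \<open>rot\<close> belongs to X_m by X_{m+3},
  \<open>rot'\<close> to X_{m+2} by X_{m-1}, and \<open>swp\<close> to replacing an outer member of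
  \<open>CB m\<close>.\<close>

definition rot :: "nat \<Rightarrow> nat" where "rot p = (if p = 1 then 3 else if p = 2 then 1 else 2)"
definition rot' :: "nat \<Rightarrow> nat" where "rot' p = (if p = 3 then 1 else if p = 1 then 2 else 3)"
definition swp :: "nat \<Rightarrow> nat" where "swp p = (if p = 1 then 3 else if p = 3 then 1 else 2)"

lemma bij_perms: "bij_betw rot {1, 2, 3} {1, 2, 3}" "bij_betw rot' {1, 2, 3} {1, 2, 3}"
    "bij_betw swp {1, 2, 3} {1, 2, 3}" "bij_betw id {1, 2, 3} {1, 2, 3::nat}"
  by (auto simp: bij_betw_def inj_on_def rot_def rot'_def swp_def)

lemma mon_past_product:
  assumes "homog s d" "homog t e" "dot \<gamma> (d + e) = 0" "s * t = t * s"
  shows "t * s * mon l \<gamma> = mon l \<gamma> * (s * t)"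
  using homog_right[OF homog_mult[OF assms(1,2)], of l \<gamma>] assms(3,4) by simp

text \<open>Obtained by \<open>bar\<close>, for exchanges in which the removed variable has the
  larger index and must stand on the left. Where a coefficient lands on the right, it returns
  unchanged because \<open>kap m\<close> is orthogonal to the g-vectors of the inner
  variables.\<close>

lemma exchange_3':
  "1 \<le> m \<or> m \<le> - 3 \<Longrightarrow> aX (m + 3) * aX m = mon 1 (kap m) + aX (m + 1) * aX (m + 2)"
  "- 2 \<le> m \<Longrightarrow> m \<le> 0 \<Longrightarrow> aX (m + 3) * aX m = 1 + mon (- 1) (- kap m) * (aX (m + 1) * aX (m + 2))"
proof -
  have comm: "aX (m + 1) * aX (m + 2) = aX (m + 2) * aX (m + 1)"
    by (rule aX_commute) simp
  show "aX (m + 3) * aX m = mon 1 (kap m) + aX (m + 1) * aX (m + 2)" if "1 \<le> m \<or> m \<le> - 3"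
    using arg_cong[OF conjunct2[OF exchange_3(1)[OF that]], of bar] comm
    by (simp add: bar_add bar_mult bar_mon)
  show "aX (m + 3) * aX m = 1 + mon (- 1) (- kap m) * (aX (m + 1) * aX (m + 2))" if "- 2 \<le> m" "m \<le> 0"
    using arg_cong[OF conjunct2[OF exchange_3(2)[OF that]], of bar]
      mon_past_product[OF homog_aX homog_aX _ comm, of "- kap m" "- 1"]
    by (simp add: bar_add bar_mult bar_mon dot_add kap_gX)
qed

lemma exchange_4':
  "1 \<le> m \<or> m \<le> - 4 \<Longrightarrow> aX (m + 4) * aX m = mon 1 (th m) * V (m + 1) + aX (m + 2) * aX (m + 2)"
  "- 3 \<le> m \<Longrightarrow> m \<le> 0 \<Longrightarrow> aX (m + 4) * aX m = V (m + 1) + mon (- 1) (- th m) * (aX (m + 2) * aX (m + 2))"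
proof -
  show "aX (m + 4) * aX m = mon 1 (th m) * V (m + 1) + aX (m + 2) * aX (m + 2)" if "1 \<le> m \<or> m \<le> - 4"
    using arg_cong[OF conjunct2[OF exchange_4(1)[OF that]], of bar]
      homog_right[OF homog_V[of "m + 1", folded gV_def], of 1 "th m"]
    by (simp add: bar_add bar_mult bar_mon th_gX)
  show "aX (m + 4) * aX m = V (m + 1) + mon (- 1) (- th m) * (aX (m + 2) * aX (m + 2))" if "- 3 \<le> m" "m \<le> 0"
    using arg_cong[OF conjunct2[OF exchange_4(2)[OF that]], of bar]
      mon_past_product[OF homog_aX homog_aX _ refl, of "- th m" "m + 2" "- 1"]
    by (simp add: bar_add bar_mult bar_mon dot_add th_gX)
qed

lemma exchange_V':
  "1 \<le> m \<Longrightarrow> aX m * V m = aX (m + 1) + mon (- 1) (lam m) * aX (m - 1)"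
  "m \<le> 0 \<Longrightarrow> aX m * V m = mon 1 (- lam m) * aX (m + 1) + aX (m - 1)"
proof -
  show "aX m * V m = aX (m + 1) + mon (- 1) (lam m) * aX (m - 1)" if "1 \<le> m"
    using arg_cong[OF conjunct2[OF exchange_V(1)[OF that]], of bar] homog_right[OF homog_aX, of "m - 1" "- 1" "lam m"]
    by (simp add: bar_add bar_mult bar_mon lam_gX)
  show "aX m * V m = mon 1 (- lam m) * aX (m + 1) + aX (m - 1)" if "m \<le> 0"
    using arg_cong[OF conjunct2[OF exchange_V(2)[OF that]], of bar] homog_right[OF homog_aX, of "m + 1" 1 "- lam m"]
    by (simp add: bar_add bar_mult bar_mon lam_gX)
qed

section \<open>The six mutations between combinatorial clusters\<close>

lemmas link_simps = mutlink_def bij_perms[unfolded One_nat_def] rot_def rot'_def swp_def bmat0_def pos_part_def cprod_def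
  power2_eq_square zero_prod_def[symmetric]

lemma smul_simps [simp]: "smul 0 \<gamma> = 0" "smul 1 \<gamma> = \<gamma>" "smul 2 \<gamma> = \<gamma> + \<gamma>"
  by (cases \<gamma>; simp add: zero_prod_def)+

text \<open>The two alternatives correspond to the sign of the exchanged column. What remains are
  identities between c-vectors and g-vectors, checked on each range of \<open>int_regimes\<close>;
  the other five links follow the same pattern.\<close>

lemma link_A1: "mutlink (CA m) 1 (CA (m + 1)) rot"
proof -
  have "(1 \<le> m \<or> m \<le> - 3) \<and> kap (m + 1) = lam (m + 1) + kap m \<and> lam (m + 2) = - kap (m - 1) + kap m \<and> gX (m + 3) = - gX m + gX (m + 1) + gX (m + 2) \<or> (- 2 \<le> m \<and> m \<le> 0) \<and> kap (m + 1) = lam (m + 1) \<and> lam (m + 2) = - kap (m - 1) \<and> gX (m + 3) = - gX m + gX (m + 1) + gX (m + 2) + lamlow (- kap m)"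
    by (induct m rule: int_regimes; simp add: zdefs gV_def algebra_simps)
  then show ?thesis
    using exchange_3[of m]
    by (elim disjE) (simp_all add: link_simps algebra_simps)
qed

lemma link_A3: "mutlink (CA m) 3 (CA (m - 1)) rot'"
proof -
  have "(1 \<le> m - 1 \<or> m - 1 \<le> - 3) \<and> lam m = kap m - kap (m - 1) \<and> - kap (m - 2) = lam (m + 1) - kap (m - 1) \<and> gX (m - 1) = - gX (m + 2) + lamlow (kap (m - 1)) \<or> (- 2 \<le> m - 1 \<and> m - 1 \<le> 0) \<and> lam m = kap m \<and> - kap (m - 2) = lam (m + 1) \<and> gX (m - 1) = - gX (m + 2)"
    by (induct m rule: int_regimes; simp add: zdefs gV_def algebra_simps)
  then show ?thesis
    using exchange_3[of "m - 1"] exchange_3'[of "m - 1"]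
    by (elim disjE) (simp_all add: link_simps add.commute[of m])
qed

lemma link_A2: "mutlink (CA m) 2 (CB m) id"
proof -
  have "(1 \<le> m + 1) \<and> th m = kap m \<and> - th (m - 2) = - kap (m - 1) + lam (m + 1) \<and> gV (m + 1) = - gX (m + 1) + gX (m + 2) \<or> (m + 1 \<le> 0) \<and> th m = kap m + lam (m + 1) \<and> th (m - 2) = kap (m - 1) \<and> gV (m + 1) = - gX (m + 1) + gX (m + 2) + lamlow (- lam (m + 1))"
    by (induct m rule: int_regimes; simp add: zdefs gV_def algebra_simps)
  then show ?thesis
    using exchange_V[of "m + 1"] exchange_V'[of "m + 1"]
    by (elim disjE) (simp_all add: link_simps algebra_simps)
qed

lemma link_B2: "mutlink (CB m) 2 (CA m) id"
proof -
  have "(1 \<le> m + 1) \<and> kap m = th m \<and> - kap (m - 1) = - th (m - 2) - lam (m + 1) \<and> gX (m + 1) = - gV (m + 1) + gX m + lamlow (lam (m + 1)) \<or> (m + 1 \<le> 0) \<and> kap m = th m - lam (m + 1) \<and> kap (m - 1) = th (m - 2) \<and> gX (m + 1) = - gV (m + 1) + gX m"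
    by (induct m rule: int_regimes; simp add: zdefs gV_def algebra_simps)
  then show ?thesis
    using exchange_V[of "m + 1"] exchange_V'[of "m + 1"]
    by (elim disjE) (simp_all add: link_simps algebra_simps)
qed

lemma link_B1: "mutlink (CB m) 1 (CB (m + 2)) swp"
proof -
  have "(1 \<le> m \<or> m \<le> - 4) \<and> lam (m + 3) = lam (m + 1) \<and> th (m + 2) = - th (m - 2) + (th m + th m) \<and> gX (m + 4) = - gX m + (gX (m + 2) + gX (m + 2)) \<or> (- 3 \<le> m \<and> m \<le> 0) \<and> - lam (m + 3) = - lam (m + 1) + th m \<and> th (m + 2) = - th (m - 2) \<and> gX (m + 4) = - gX m + (gX (m + 2) + gX (m + 2)) + lamlow (- th m)"
    by (induct m rule: int_regimes; simp add: zdefs gV_def algebra_simps)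
  then show ?thesis
    using exchange_4[of m] vlet(3)[of "m + 1"]
    by (elim disjE) (simp_all add: link_simps algebra_simps)
qed

lemma link_B3: "mutlink (CB m) 3 (CB (m - 2)) swp"
proof -
  have "(1 \<le> m - 2 \<or> m - 2 \<le> - 4) \<and> - th (m - 4) = th m - (th (m - 2) + th (m - 2)) \<and> lam (m - 1) = lam (m + 1) \<and> gX (m - 2) = - gX (m + 2) + gV (m + 1) + lamlow (th (m - 2)) \<or> (- 3 \<le> m - 2 \<and> m - 2 \<le> 0) \<and> - th (m - 4) = th m \<and> - lam (m - 1) = - lam (m + 1) - th (m - 2) \<and> gX (m - 2) = - gX (m + 2) + gV (m + 1)"
    by (induct m rule: int_regimes; simp add: zdefs gV_def algebra_simps)
  then show ?thesis
    using exchange_4[of "m - 2"] exchange_4'[of "m - 2"] vlet(3,4)[of "m - 1"]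
    by (elim disjE) (simp_all add: link_simps add.commute[of m])
qed

section \<open>Seeds\<close>

lemma sum_1_6: "(\<Sum>r = 1..6. f r) = f 1 + f 2 + f 3 + f 4 + f 5 + f (6::nat)"
  for f :: "nat \<Rightarrow> 'a::comm_monoid_add"
proof -
  have "{1..6::nat} = {1, 2, 3, 4, 5, 6}"
    by auto
  then show ?thesis
    by (simp add: add.assoc)
qed

lemma sum_pairs_1_6:
  "(\<Sum>i = 1..6. \<Sum>j = i+1..6. f i j) = f 1 2 + f 1 3 + f 1 4 + f 1 5 + f 1 6 + f 2 3 + f 2 4 + f 2 5
     + f 2 6 + f 3 4 + f 3 5 + f 3 6 + f 4 5 + f 4 6 + f 5 (6::nat)"
  for f :: "nat \<Rightarrow> nat \<Rightarrow> int"
proof -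
  have "{1+1..6::nat} = {2, 3, 4, 5, 6}" "{2+1..6::nat} = {3, 4, 5, 6}" "{3+1..6::nat} = {4, 5, 6}"
      "{4+1..6::nat} = {5, 6}" "{5+1..6::nat} = {6}" "{6+1..6::nat} = {}"
    by auto
  then show ?thesis
    unfolding sum_1_6 by simp
qed

lemma sum_perm3:
  assumes "bij_betw \<pi> {1, 2, 3::nat} {1, 2, 3::nat}"
  shows "f (\<pi> 1) + f (\<pi> 2) + f (\<pi> 3) = f 1 + f 2 + (f 3 :: 'a::comm_monoid_add)"
  using sum.reindex_bij_betw[OF assms, of f] by (simp add: add.assoc)

text \<open>The pairing of y_1, y_2, y_3 with the j-th variable under the form of the seed. It plays
  the role of the degree of that variable, so in a reachable seed it has to be a g-vector.\<close>

definition slamcol :: "'f qseed \<Rightarrow> nat \<Rightarrow> z3" where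
  "slamcol S j = (slam S 4 j, slam S 5 j, slam S 6 j)"

definition slamrow :: "'f qseed \<Rightarrow> nat \<Rightarrow> z3" where
  "slamrow S j = (slam S j 4, slam S j 5, slam S j 6)"

definition sbcol :: "'f qseed \<Rightarrow> nat \<Rightarrow> z3" where
  "sbcol S j = (sbmat S 4 j, sbmat S 5 j, sbmat S 6 j)"

text \<open>Once the sign of y is known, the mutation term is linear in y. Sign-coherence thus lets
  a whole coefficient column mutate as one vector.\<close>

lemma pos_part_div:
  "0 \<le> y \<Longrightarrow> (\<bar>y\<bar> * b + y * \<bar>b\<bar>) div 2 = pos_part b * y"
  "y \<le> 0 \<Longrightarrow> (\<bar>y\<bar> * b + y * \<bar>b\<bar>) div 2 = pos_part (- b) * y"
proof -
  have dbl: "(t + t) div 2 = t" for t :: int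
    by simp
  show "0 \<le> y \<Longrightarrow> (\<bar>y\<bar> * b + y * \<bar>b\<bar>) div 2 = pos_part b * y"
    using dbl[of "y * b"] by (cases "0 \<le> b") (simp_all add: pos_part_def)
  show "y \<le> 0 \<Longrightarrow> (\<bar>y\<bar> * b + y * \<bar>b\<bar>) div 2 = pos_part (- b) * y"
    using dbl[of "- (y * b)"] by (cases "0 \<le> b") (simp_all add: pos_part_def)
qed

context
  fixes \<iota> :: "qtorus \<Rightarrow> 'f::division_ring"
  assumes frac: "skew_field_of_fractions \<iota>"
begin

lemma emb_1: "\<iota> 1 = 1" and emb_add: "\<iota> (a + b) = \<iota> a + \<iota> b" and emb_mult: "\<iota> (a * b) = \<iota> a * \<iota> b"
  and emb_inj: "inj \<iota>"
  using frac unfolding skew_field_of_fractions_def by blast+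

lemma emb_0: "\<iota> 0 = 0"
proof -
  have "\<iota> 0 = \<iota> 0 + \<iota> 0"
    using emb_add[of 0 0] by (simp only: add_0_left)
  then show ?thesis
    by (simp only: add_cancel_right_right)
qed

lemma emb_eq: "\<iota> a = \<iota> b \<longleftrightarrow> a = b"
  using emb_inj by (rule inj_eq)

lemma emb_power: "\<iota> (a ^ n) = \<iota> a ^ n"
  by (induction n) (simp_all add: emb_1 emb_mult)

text \<open>Mutation keeps the labels of a seed, whereas \<open>CA\<close> and \<open>CB\<close>
  list variables by index; the bijection translates labels to positions. The vanishing block of the
  form reflects that cluster variables commute.\<close>

definition realizes :: "'f qseed \<Rightarrow> cluster \<Rightarrow> (nat \<Rightarrow> nat) \<Rightarrow> bool" where
  "realizes S C \<pi> \<longleftrightarrow> bij_betw \<pi> {1, 2, 3} {1, 2, 3} \<and>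
     (\<forall>i\<in>{1, 2, 3}. \<forall>j\<in>{1, 2, 3}. slam S i j = 0 \<and> sbmat S i j = cbt C (\<pi> i) (\<pi> j)) \<and>
     (\<forall>j\<in>{1, 2, 3}. sbcol S j = ccol C (\<pi> j) \<and> slamcol S j = gvec (clt C (\<pi> j))
        \<and> slamrow S j = - gvec (clt C (\<pi> j)) \<and> svar S j = \<iota> (aval (clt C (\<pi> j)))) \<and>
     (\<forall>i\<in>{4, 5, 6}. \<forall>j\<in>{4, 5, 6}. slam S i j = lam0 i j) \<and>
     svar S 4 = \<iota> (mon 0 (1, 0, 0)) \<and> svar S 5 = \<iota> (mon 0 (0, 1, 0)) \<and> svar S 6 = \<iota> (mon 0 (0, 0, 1))"

lemma realizesD:
  assumes "realizes S C \<pi>"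
  shows "bij_betw \<pi> {1, 2, 3} {1, 2, 3}"
    "i \<in> {1, 2, 3} \<Longrightarrow> j \<in> {1, 2, 3} \<Longrightarrow> slam S i j = 0"
    "i \<in> {1, 2, 3} \<Longrightarrow> j \<in> {1, 2, 3} \<Longrightarrow> sbmat S i j = cbt C (\<pi> i) (\<pi> j)"
    "j \<in> {1, 2, 3} \<Longrightarrow> sbcol S j = ccol C (\<pi> j)"
    "j \<in> {1, 2, 3} \<Longrightarrow> slamcol S j = gvec (clt C (\<pi> j))"
    "j \<in> {1, 2, 3} \<Longrightarrow> slamrow S j = - gvec (clt C (\<pi> j))"
    "j \<in> {1, 2, 3} \<Longrightarrow> svar S j = \<iota> (aval (clt C (\<pi> j)))"
    "i \<in> {4, 5, 6} \<Longrightarrow> j \<in> {4, 5, 6} \<Longrightarrow> slam S i j = lam0 i j"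
    "svar S 4 = \<iota> (mon 0 (1, 0, 0))" "svar S 5 = \<iota> (mon 0 (0, 1, 0))" "svar S 6 = \<iota> (mon 0 (0, 0, 1))"
  using assms unfolding realizes_def by blast+

lemma mon_power:
  "mon 0 (1, 0, 0) ^ n = mon 0 (int n, 0, 0)" "mon 0 (0, 1, 0) ^ n = mon 0 (0, int n, 0)"
  "mon 0 (0, 0, 1) ^ n = mon 0 (0, 0, int n)"
  by (induction n; simp add: mon_mult)+

lemma qh_mon: "qh l = mon l 0"
  by (simp add: qh_def mon_def zero_prod_def)

lemma mon_central: "t * mon l 0 = mon l 0 * t"
proof (rule frag_induction[of t UNIV])
  fix m
  obtain k a1 a2 a3 a4 a5 a6 where "m = QMon k (a1, a2, a3, a4, a5, a6)"
    by (metis qmon.exhaust prod.exhaust)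
  then show "frag_of m * mon l 0 = mon l 0 * frag_of m"
    by (simp add: mon_def zero_prod_def mult_single plus_qmon_def Lambda_expand add.commute)
qed (simp_all add: left_diff_distrib right_diff_distrib)

text \<open>Multiplying by the exchanged variable removes the only inverse, so the result lies in
  the torus. The part \<open>f\<close> of the normalizing exponent is used up in merging y_1, y_2,
  y_3 into one monomial; the part \<open>e\<close> pairs coefficients with g-vectors.\<close>

lemma norm_mon_cleared:
  assumes R: "realizes S C \<pi>" and k: "k \<in> {1, 2, 3}" "c k = - 1"
    and c: "\<And>i. i \<in> {1, 2, 3, 4, 5, 6} \<Longrightarrow> i \<noteq> k \<Longrightarrow> 0 \<le> c i"
  defines "A \<equiv> \<lambda>i. aval (clt C (\<pi> i))" and "g \<equiv> \<lambda>i. gvec (clt C (\<pi> i))" and "\<nu> \<equiv> (c 4, c 5, c 6)"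
  shows "\<iota> (A k) * norm_mon \<iota> S c = \<iota> (mon (c 1 * dot \<nu> (g 1) + c 2 * dot \<nu> (g 2) + c 3 * dot \<nu> (g 3)) 0
     * (A 1 ^ nat (c 1) * A 2 ^ nat (c 2) * A 3 ^ nat (c 3)) * mon 0 \<nu>)"
proof -
  define f where "f = c 4 * c 5 + c 4 * c 6 + c 5 * c 6"
  define e where "e = c 1 * dot \<nu> (g 1) + c 2 * dot \<nu> (g 2) + c 3 * dot \<nu> (g 3)"
  have row: "c 4 * slam S j 4 + c 5 * slam S j 5 + c 6 * slam S j 6 = - dot \<nu> (g j)" if "j \<in> {1, 2, 3}" for j
  proof -
    have "slamrow S j = - g j"
      using realizesD(6)[OF R that] by (simp add: g_def)
    then have "dot \<nu> (slamrow S j) = - dot \<nu> (g j)"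
      by simp
    then show ?thesis
      unfolding \<nu>_def slamrow_def dot.simps .
  qed
  have rows: "c 4 * slam S 1 4 + c 5 * slam S 1 5 + c 6 * slam S 1 6 = - dot \<nu> (g 1)"
    "c 4 * slam S 2 4 + c 5 * slam S 2 5 + c 6 * slam S 2 6 = - dot \<nu> (g 2)"
    "c 4 * slam S 3 4 + c 5 * slam S 3 5 + c 6 * slam S 3 6 = - dot \<nu> (g 3)"
    by (rule row; simp)+
  have z: "slam S 1 2 = 0" "slam S 1 3 = 0" "slam S 2 3 = 0" "slam S 4 5 = - 1" "slam S 4 6 = - 1" "slam S 5 6 = - 1"
    by (simp_all add: realizesD(2,8)[OF R] lam0_def)
  have "- (\<Sum>i = 1..6. \<Sum>j = i+1..6. c i * c j * slam S i j)
      = - (c 1 * (c 4 * slam S 1 4 + c 5 * slam S 1 5 + c 6 * slam S 1 6)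
         + c 2 * (c 4 * slam S 2 4 + c 5 * slam S 2 5 + c 6 * slam S 2 6)
         + c 3 * (c 4 * slam S 3 4 + c 5 * slam S 3 5 + c 6 * slam S 3 6)) + c 4 * c 5 + c 4 * c 6 + c 5 * c 6"
    unfolding sum_pairs_1_6 by (simp add: z algebra_simps del: One_nat_def)
  also have "\<dots> = e + f"
    unfolding rows by (simp add: e_def f_def)
  finally have exponent: "- (\<Sum>i = 1..6. \<Sum>j = i+1..6. c i * c j * slam S i j) = e + f" .
  have nonneg: "0 \<le> c 4" "0 \<le> c 5" "0 \<le> c 6"
    using c[of 4] c[of 5] c[of 6] k(1) by auto
  have "svar S 4 powi c 4 * (svar S 5 powi c 5 * svar S 6 powi c 6)
      = \<iota> (mon 0 (c 4, 0, 0) * (mon 0 (0, c 5, 0) * mon 0 (0, 0, c 6)))"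
    by (simp only: realizesD(9-11)[OF R] power_int_def nonneg if_True mon_power emb_mult nat_0_le
        emb_power[symmetric])
  also have "\<dots> = \<iota> (mon (- f) \<nu>)"
    unfolding mon_mult \<nu>_def
    by (intro arg_cong[where f = \<iota>] arg_cong2[where f = mon]) (simp_all add: f_def algebra_simps)
  finally have lower: "svar S 4 powi c 4 * (svar S 5 powi c 5 * svar S 6 powi c 6)
      = \<iota> (mon (- f) \<nu>)" .
  define P where "P i = svar S i powi c i" for i
  have Pi: "P i = \<iota> (A i ^ nat (c i))" if "i \<in> {1, 2, 3}" "i \<noteq> k" for i
  proof -
    have "0 \<le> c i"
      using c[of i] that by blast
    then show ?thesis
      by (simp add: P_def realizesD(7)[OF R that(1)] power_int_def A_def emb_power)
  qed
  have Pk: "P k = inverse (\<iota> (A k))"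
    by (simp add: P_def realizesD(7)[OF R k(1)] A_def k(2) power_int_minus)
  have A0: "\<iota> (A k) \<noteq> 0"
    using emb_eq[of "A k" 0] aval_nonzero by (simp add: A_def emb_0)
  have cancel: "\<iota> (A k) * (P k * t) = t" for t
    using A0 by (simp add: Pk flip: mult.assoc)
  have comm: "\<iota> (A k) * (P i * t) = P i * (\<iota> (A k) * t)" if "i \<in> {1, 2, 3}" "i \<noteq> k" for i t
  proof -
    have "A k * A i = A i * A k"
      unfolding A_def by (rule compat_aval, rule clt_compat) (use bij_betw_apply[OF realizesD(1)[OF R]] k(1) that(1) in blast)+
    then have "A k * A i ^ nat (c i) = A i ^ nat (c i) * A k"
      by (metis power_commuting_commutes)
    then have "\<iota> (A k) * P i = P i * \<iota> (A k)"
      using that by (simp add: Pi flip: emb_mult)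
    then show ?thesis
      by (simp flip: mult.assoc)
  qed
  have qcomm: "\<iota> (A k) * (\<iota> (qh l) * t) = \<iota> (qh l) * (\<iota> (A k) * t)" for l t
  proof -
    have "A k * qh l = qh l * A k"
      by (simp add: qh_mon homog_right[OF homog_aval] A_def)
    then show ?thesis
      by (simp flip: emb_mult mult.assoc)
  qed
  have pull: "\<iota> (A k) * (P 1 * (P 2 * (P 3 * t)))
      = \<iota> (A 1 ^ nat (c 1)) * (\<iota> (A 2 ^ nat (c 2)) * (\<iota> (A 3 ^ nat (c 3)) * t))" for t
  proof -
    \<comment> \<open>Since \<open>nat (- 1) = 0\<close>, the exchanged variable contributes the
      factor 1 on the right-hand side.\<close>
    have Ak: "\<iota> (A k ^ nat (c k)) = 1"
      using k(2) by (simp add: emb_1)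
    have "k = 1 \<or> k = 2 \<or> k = 3"
      using k(1) by blast
    then show ?thesis
    proof (elim disjE)
      assume 1: "k = 1"
      show ?thesis
        using cancel[of "P 2 * (P 3 * t)"] Pi[of 2] Pi[of 3] Ak unfolding 1 by simp
    next
      assume 2: "k = 2"
      show ?thesis
        using comm[of 1 "P 2 * (P 3 * t)"] cancel[of "P 3 * t"] Pi[of 1] Pi[of 3] Ak unfolding 2 by simp
    next
      assume 3: "k = 3"
      show ?thesis
        using comm[of 1 "P 2 * (P 3 * t)"] comm[of 2 "P 3 * t"] cancel[of t] Pi[of 1] Pi[of 2] Ak
        unfolding 3 by simp
    qed
  qed
  have lower': "P 4 * (P 5 * P 6) = \<iota> (mon (- f) \<nu>)"
    using lower by (simp only: P_def)
  have "norm_mon \<iota> S c = \<iota> (qh (e + f))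
      * (P 1 * (P 2 * (P 3 * \<iota> (mon (- f) \<nu>))))"
    unfolding norm_mon_def exponent lower'[symmetric]
    by (simp only: P_def list.map prod_list.Cons prod_list.Nil mult_1_right)
  then have "\<iota> (A k) * norm_mon \<iota> S c = \<iota> (qh (e + f))
      * (\<iota> (A 1 ^ nat (c 1) * (A 2 ^ nat (c 2) * (A 3 ^ nat (c 3) * mon (- f) \<nu>))))"
    by (simp only: qcomm pull emb_mult)
  also have "\<dots> = \<iota> (qh (e + f) * (A 1 ^ nat (c 1) * A 2 ^ nat (c 2) * A 3 ^ nat (c 3))
      * mon (- f) \<nu>)"
    by (simp add: mult.assoc emb_mult)
  also have "qh (e + f) * T * mon (- f) \<nu>
     = mon e 0 * T * mon 0 \<nu>" for T
  proof -
    have "qh (e + f) = mon e 0 * mon f 0"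
      by (simp add: qh_mon mon_mult)
    then have "qh (e + f) * T * mon (- f) \<nu> = mon e 0 * (mon f 0 * T) * mon (- f) \<nu>"
      by (simp add: mult.assoc)
    also have "\<dots> = mon e 0 * T * (mon f 0 * mon (- f) \<nu>)"
      by (simp only: mon_central[of T f, symmetric] mult.assoc)
    finally show ?thesis
      by (simp add: mon_mult)
  qed
  finally show ?thesis
    by (simp only: e_def)
qed

text \<open>The last alternative is a tautology: the sign of the exchanged column is left to be
  supplied where the equation is applied.\<close>

lemma sbcol_mutate:
  assumes R: "realizes S C \<pi>" and k: "k \<in> {1, 2, 3}" and j: "j \<in> {1, 2, 3}"
  shows "sbcol (mutate \<iota> k S) j = (if j = k then - ccol C (\<pi> k)
     else if posz (ccol C (\<pi> k)) then ccol C (\<pi> j) + smul (pos_part (cbt C (\<pi> k) (\<pi> j))) (ccol C (\<pi> k))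
     else if posz (- ccol C (\<pi> k)) then ccol C (\<pi> j) + smul (pos_part (- cbt C (\<pi> k) (\<pi> j))) (ccol C (\<pi> k))
     else sbcol (mutate \<iota> k S) j)"
proof -
  obtain a b c where K: "ccol C (\<pi> k) = (a, b, c)"
    by (metis prod.exhaust)
  obtain a' b' c' where J: "ccol C (\<pi> j) = (a', b', c')"
    by (metis prod.exhaust)
  have k': "sbmat S 4 k = a" "sbmat S 5 k = b" "sbmat S 6 k = c" and neq: "4 \<noteq> k" "5 \<noteq> k" "6 \<noteq> k"
    and j': "sbmat S 4 j = a'" "sbmat S 5 j = b'" "sbmat S 6 j = c'"
    using realizesD(4)[OF R k] realizesD(4)[OF R j] K J k by (auto simp: sbcol_def)
  have M: "sbmat (mutate \<iota> k S) i j = sbmat S i j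
      + (\<bar>sbmat S i k\<bar> * cbt C (\<pi> k) (\<pi> j) + sbmat S i k * \<bar>cbt C (\<pi> k) (\<pi> j)\<bar>) div 2"
    if "i \<noteq> k" "j \<noteq> k" for i
    using that realizesD(3)[OF R k j] by (simp add: mutate_def)
  consider "j = k" | "j \<noteq> k" "posz (ccol C (\<pi> k))" | "j \<noteq> k" "\<not> posz (ccol C (\<pi> k))" "posz (- ccol C (\<pi> k))"
    | "j \<noteq> k" "\<not> posz (ccol C (\<pi> k))" "\<not> posz (- ccol C (\<pi> k))"
    by blast
  then show ?thesis
  proof cases
    case 1
    then show ?thesis
      using neq by (simp add: sbcol_def mutate_def k' K)
  next
    case 2
    then have "0 \<le> a" "0 \<le> b" "0 \<le> c"
      by (simp_all add: K)
    then show ?thesis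
      using 2 unfolding sbcol_def M[OF neq(1) 2(1)] M[OF neq(2) 2(1)] M[OF neq(3) 2(1)] k' j' K J
      by (simp only: pos_part_div(1)) simp
  next
    case 3
    then have "a \<le> 0" "b \<le> 0" "c \<le> 0"
      by (simp_all add: K)
    then show ?thesis
      using 3 unfolding sbcol_def M[OF neq(1) 3(1)] M[OF neq(2) 3(1)] M[OF neq(3) 3(1)] k' j' K J
      by (simp only: pos_part_div(2)) simp
  qed simp
qed

lemma slam_mutate:
  assumes "i \<in> {1..6}" "i \<noteq> k"
  shows "j \<in> {1..6} \<Longrightarrow> j \<noteq> k \<Longrightarrow> slam (mutate \<iota> k S) i j = slam S i j"
    and "slam (mutate \<iota> k S) i k = (\<Sum>s = 1..6. slam S i s * mut_E S k s k)"
    and "slam (mutate \<iota> k S) k i = (\<Sum>s = 1..6. mut_E S k s k * slam S s i)"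
proof -
  have E: "mut_E S k r j = of_bool (r = j)" if "j \<noteq> k" for r j
    using that by (simp add: mut_E_def)
  have collapse: "(\<Sum>r = 1..6. of_bool (r = j) * f r) = f j" if "j \<in> {1..6}" for f :: "nat \<Rightarrow> int" and j
  proof -
    have "(\<Sum>r = 1..6. of_bool (r = j) * f r) = (\<Sum>r = 1..6. if r = j then f r else 0)"
      by (intro sum.cong) auto
    also have "\<dots> = f j"
      using that by (subst sum.delta) auto
    finally show ?thesis .
  qed
  then have collapse': "(\<Sum>r = 1..6. f r * of_bool (r = j)) = f j" if "j \<in> {1..6}" for f :: "nat \<Rightarrow> int" and j
    using that by (simp only: mult.commute)
  have slam_eq: "slam (mutate \<iota> k S) r s = (\<Sum>a = 1..6. \<Sum>b = 1..6. mut_E S k a r * slam S a b * mut_E S k b s)" for r s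
    by (simp only: mutate_def qseed.simps)
  show "slam (mutate \<iota> k S) i j = slam S i j" if "j \<in> {1..6}" "j \<noteq> k"
    unfolding slam_eq E[OF assms(2)] E[OF that(2)] collapse'[OF that(1)] collapse[OF assms(1)] ..
  show "slam (mutate \<iota> k S) i k = (\<Sum>s = 1..6. slam S i s * mut_E S k s k)"
    unfolding slam_eq E[OF assms(2)] mult.assoc sum_distrib_left[symmetric] collapse[OF assms(1)] ..
  show "slam (mutate \<iota> k S) k i = (\<Sum>s = 1..6. mut_E S k s k * slam S s i)"
    unfolding slam_eq E[OF assms(2)] collapse'[OF assms(1)] ..
qed

lemma slam_mutate_diag:
  "slam (mutate \<iota> k S) k k = (\<Sum>r = 1..6. \<Sum>s = 1..6. mut_E S k r k * slam S r s * mut_E S k s k)"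
  by (simp only: mutate_def qseed.simps)

text \<open>The congruence by E acts on these columns as mutation of g-vectors; the coefficient rows
  of E enter through the form on the y's, which is \<open>lamlow\<close>.\<close>

lemma slamcol_mutate:
  assumes R: "realizes S C \<pi>" and k: "k \<in> {1, 2, 3}"
  defines "e \<equiv> \<lambda>s. mut_E S k s k"
  shows "slamcol (mutate \<iota> k S) k = smul (e 1) (slamcol S 1) + smul (e 2) (slamcol S 2) + smul (e 3) (slamcol S 3)
      + lamlow (e 4, e 5, e 6)"
    and "slamrow (mutate \<iota> k S) k = - slamcol (mutate \<iota> k S) k"
    and "j \<in> {1, 2, 3} \<Longrightarrow> j \<noteq> k \<Longrightarrow> slam (mutate \<iota> k S) j k = - dot (gvec (clt C (\<pi> j))) (e 4, e 5, e 6)"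
    and "j \<in> {1, 2, 3} \<Longrightarrow> j \<noteq> k \<Longrightarrow> slam (mutate \<iota> k S) k j = dot (gvec (clt C (\<pi> j))) (e 4, e 5, e 6)"
    and "slam (mutate \<iota> k S) k k = 0"
proof -
  have low: "slam S 4 4 = 0" "slam S 4 5 = - 1" "slam S 4 6 = - 1" "slam S 5 4 = 1" "slam S 5 5 = 0" "slam S 5 6 = - 1"
     "slam S 6 4 = 1" "slam S 6 5 = 1" "slam S 6 6 = 0"
    by (simp_all add: realizesD(8)[OF R] lam0_def)
  have skew: "slam S j 4 = - slam S 4 j" "slam S j 5 = - slam S 5 j" "slam S j 6 = - slam S 6 j" if "j \<in> {1, 2, 3}" for j
  proof -
    have "slamrow S j = - slamcol S j"
      using realizesD(5,6)[OF R that] by simp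
    then show "slam S j 4 = - slam S 4 j" "slam S j 5 = - slam S 5 j" "slam S j 6 = - slam S 6 j"
      by (simp_all add: slamcol_def slamrow_def)
  qed
  have zero: "slam S i j = 0" if "i \<in> {1, 2, 3}" "j \<in> {1, 2, 3}" for i j
    by (rule realizesD(2)[OF R that])
  have zero': "slam S j 1 = 0" "slam S j 2 = 0" "slam S j 3 = 0" "slam S 1 j = 0" "slam S 2 j = 0" "slam S 3 j = 0"
    if "j \<in> {1, 2, 3}" for j
    using that by (auto intro!: zero)
  have neq: "4 \<in> {1..6::nat}" "4 \<noteq> k" "5 \<in> {1..6::nat}" "5 \<noteq> k" "6 \<in> {1..6::nat}" "6 \<noteq> k"
    using k by auto
  show *: "slamcol (mutate \<iota> k S) k = smul (e 1) (slamcol S 1) + smul (e 2) (slamcol S 2) + smul (e 3) (slamcol S 3)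
      + lamlow (e 4, e 5, e 6)"
    unfolding slamcol_def slam_mutate(2)[OF neq(1,2)] slam_mutate(2)[OF neq(3,4)] slam_mutate(2)[OF neq(5,6)] sum_1_6 e_def low
    by (simp add: mult.commute)
  show "slamrow (mutate \<iota> k S) k = - slamcol (mutate \<iota> k S) k"
    unfolding * unfolding slamrow_def slamcol_def slam_mutate(3)[OF neq(1,2)] slam_mutate(3)[OF neq(3,4)] slam_mutate(3)[OF neq(5,6)]
      sum_1_6 e_def low
    by (simp add: skew algebra_simps)
  show "slam (mutate \<iota> k S) j k = - dot (gvec (clt C (\<pi> j))) (e 4, e 5, e 6)" if "j \<in> {1, 2, 3}" "j \<noteq> k"
  proof -
    have "j \<in> {1..6}"
      using that by auto
    then show ?thesis
      unfolding slam_mutate(2)[OF \<open>j \<in> {1..6}\<close> that(2)] sum_1_6 realizesD(5)[OF R that(1), symmetric] slamcol_def e_def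
      by (simp add: zero'[OF that(1)] skew[OF that(1)] del: One_nat_def)
  qed
  show "slam (mutate \<iota> k S) k j = dot (gvec (clt C (\<pi> j))) (e 4, e 5, e 6)" if "j \<in> {1, 2, 3}" "j \<noteq> k"
  proof -
    have "j \<in> {1..6}"
      using that by auto
    then show ?thesis
      unfolding slam_mutate(3)[OF \<open>j \<in> {1..6}\<close> that(2)] sum_1_6 realizesD(5)[OF R that(1), symmetric] slamcol_def e_def
      by (simp add: zero'[OF that(1)] mult.commute del: One_nat_def)
  qed
  show "slam (mutate \<iota> k S) k k = 0"
    unfolding slam_mutate_diag sum_1_6 low by (simp add: zero skew algebra_simps)
qed

lemma pos_part_triple:
  "posz (a, b, c) \<Longrightarrow> (pos_part a, pos_part b, pos_part c) = (a, b, c)"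
  "posz (a, b, c) \<Longrightarrow> (pos_part (- a), pos_part (- b), pos_part (- c)) = 0"
  "posz (- (a, b, c)) \<Longrightarrow> (pos_part a, pos_part b, pos_part c) = 0"
  "posz (- (a, b, c)) \<Longrightarrow> (pos_part (- a), pos_part (- b), pos_part (- c)) = - (a, b, c)"
  by (simp_all add: pos_part_def zero_prod_def)

lemma cprod_perm:
  assumes R: "realizes S C \<pi>"
  shows "aval (clt C (\<pi> 1)) ^ nat (e (\<pi> 1)) * aval (clt C (\<pi> 2)) ^ nat (e (\<pi> 2)) * aval (clt C (\<pi> 3)) ^ nat (e (\<pi> 3))
     = cprod C e"
proof -
  define P where "P p = aval (clt C p) ^ nat (e p)" for p
  have comm: "P p * P q = P q * P p" if "p \<in> {1, 2, 3}" "q \<in> {1, 2, 3}" for p q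
    unfolding P_def using compat_aval[OF clt_compat[OF that, of C]]
    by (metis power_commuting_commutes)
  have c: "P 2 * P 1 = P 1 * P 2" "P 3 * P 1 = P 1 * P 3" "P 3 * P 2 = P 2 * P 3"
    by (rule comm; simp)+
  have c': "P 2 * (P 1 * t) = P 1 * (P 2 * t)" "P 3 * (P 1 * t) = P 1 * (P 3 * t)" "P 3 * (P 2 * t) = P 2 * (P 3 * t)" for t
    by (simp_all only: c flip: mult.assoc)
  have "{\<pi> 1, \<pi> 2, \<pi> 3} = {1, 2, 3}" "\<pi> 1 \<noteq> \<pi> 2" "\<pi> 1 \<noteq> \<pi> 3" "\<pi> 2 \<noteq> \<pi> 3"
    using realizesD(1)[OF R] by (auto simp: bij_betw_def inj_on_def)
  then have "\<pi> 1 \<in> {1, 2, 3}" "\<pi> 2 \<in> {1, 2, 3}" "\<pi> 3 \<in> {1, 2, 3}" "\<pi> 1 \<noteq> \<pi> 2" "\<pi> 1 \<noteq> \<pi> 3" "\<pi> 2 \<noteq> \<pi> 3"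
    by blast+
  then have "P (\<pi> 1) * (P (\<pi> 2) * P (\<pi> 3)) = P 1 * (P 2 * P 3)"
    by (auto simp: c c' simp del: One_nat_def)
  then show ?thesis
    by (simp add: P_def cprod_def mult.assoc)
qed

text \<open>By \<open>duality\<close> the coefficient exponent is orthogonal to the g-vectors of the
  variables that stay. Its monomial commutes with them, and only the pairing with the exchanged
  variable survives in the power of q. The sign covers both exchange terms.\<close>

lemma exchange_term:
  assumes R: "realizes S C \<pi>" and k: "k \<in> {1, 2, 3}" and \<sigma>: "\<sigma> = 1 \<or> \<sigma> = - 1"
    and \<nu>: "\<nu> = (pos_part (\<sigma> * sbmat S 4 k), pos_part (\<sigma> * sbmat S 5 k), pos_part (\<sigma> * sbmat S 6 k))"
      "\<nu> = 0 \<or> \<nu> = smul \<sigma> (ccol C (\<pi> k))"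
  shows "\<iota> (aval (clt C (\<pi> k))) * norm_mon \<iota> S (\<lambda>i. (if i = k then - 1 else 0) + pos_part (\<sigma> * sbmat S i k))
    = \<iota> (mon (- dot \<nu> (gvec (clt C (\<pi> k)))) \<nu> * cprod C (\<lambda>p. pos_part (\<sigma> * cbt C p (\<pi> k))))"
proof -
  define c where "c i = (if i = k then - 1 else 0) + pos_part (\<sigma> * sbmat S i k)" for i
  let ?q = "\<pi> k"
  have q: "?q \<in> {1, 2, 3}"
    using bij_betw_apply[OF realizesD(1)[OF R]] k by blast
  have diag: "cbt C ?q ?q = 0"
    using q by (cases C) (auto simp: bmat0_def)
  have ci: "c i = (if i = k then - 1 else pos_part (\<sigma> * cbt C (\<pi> i) ?q))" if "i \<in> {1, 2, 3}" for i
    using realizesD(3)[OF R that k] diag by (simp add: c_def pos_part_def)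
  have ck: "c k = - 1"
    using ci[OF k] by simp
  have c0: "0 \<le> c i" if "i \<noteq> k" for i
    using that by (simp add: c_def pos_part_def)
  have \<nu>c: "(c 4, c 5, c 6) = \<nu>"
    using k by (auto simp: \<nu>(1) c_def)
  have dot0: "dot \<nu> (gvec (clt C p)) = 0" if "p \<in> {1, 2, 3}" "p \<noteq> ?q" for p
  proof -
    have "dot (smul \<sigma> (ccol C ?q)) (gvec (clt C p)) = \<sigma> * dot (ccol C ?q) (gvec (clt C p))"
      by (cases "ccol C ?q"; cases "gvec (clt C p)") (simp add: algebra_simps)
    with \<nu>(2) duality[OF that(1) q, of C] that(2) show ?thesis
      by auto
  qed
  have other: "\<pi> i \<in> {1, 2, 3} \<and> \<pi> i \<noteq> ?q" if "i \<in> {1, 2, 3}" "i \<noteq> k" for i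
    using realizesD(1)[OF R] that k by (auto simp: bij_betw_def inj_on_def)
  have term0: "c i * dot \<nu> (gvec (clt C (\<pi> i))) = (if i = k then - dot \<nu> (gvec (clt C ?q)) else 0)" if "i \<in> {1, 2, 3}" for i
    using other[OF that] dot0 ck by auto
  have e: "c 1 * dot \<nu> (gvec (clt C (\<pi> 1))) + c 2 * dot \<nu> (gvec (clt C (\<pi> 2))) + c 3 * dot \<nu> (gvec (clt C (\<pi> 3)))
      = - dot \<nu> (gvec (clt C ?q))"
    using term0[of 1] term0[of 2] term0[of 3] k by auto
  \<comment> \<open>For \<open>i = k\<close> both exponents are 0: on the left by
    \<open>nat (- 1) = 0\<close>, on the right by the zero diagonal.\<close>
  have pow: "aval (clt C (\<pi> i)) ^ nat (c i) = aval (clt C (\<pi> i)) ^ nat (pos_part (\<sigma> * cbt C (\<pi> i) ?q))" if "i \<in> {1, 2, 3}" for i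
    using ci[OF that] diag by (auto simp: pos_part_def)
  have central: "cprod C (\<lambda>p. pos_part (\<sigma> * cbt C p ?q)) * mon 0 \<nu> = mon 0 \<nu> * cprod C (\<lambda>p. pos_part (\<sigma> * cbt C p ?q))"
  proof -
    have "mon 0 \<nu> * aval (clt C p) ^ nat (pos_part (\<sigma> * cbt C p ?q)) = aval (clt C p) ^ nat (pos_part (\<sigma> * cbt C p ?q)) * mon 0 \<nu>"
      if "p \<in> {1, 2, 3}" for p
    proof (cases "p = ?q")
      case True
      then show ?thesis
        by (simp add: diag pos_part_def)
    next
      case False
      have "mon 0 \<nu> * aval (clt C p) = aval (clt C p) * mon 0 \<nu>"
        using homogD[OF homog_aval, of 0 \<nu> "clt C p"] dot0[OF that False] by simp
      then show ?thesis
        by (metis power_commuting_commutes)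
    qed
    note comm = this
    show ?thesis
      unfolding cprod_def by (rule sym, rule commute_mult, rule commute_mult) (rule comm, simp)+
  qed
  have "\<iota> (aval (clt C ?q)) * norm_mon \<iota> S c
     = \<iota> (mon (- dot \<nu> (gvec (clt C ?q))) 0 * cprod C (\<lambda>p. pos_part (\<sigma> * cbt C p ?q)) * mon 0 \<nu>)"
    using norm_mon_cleared[where c = c, OF R k ck c0, unfolded \<nu>c e] pow[of 1] pow[of 2] pow[of 3]
      cprod_perm[OF R, of "\<lambda>p. pos_part (\<sigma> * cbt C p ?q)"] by simp
  also have "\<dots> = \<iota> (mon (- dot \<nu> (gvec (clt C ?q))) 0 * mon 0 \<nu> * cprod C (\<lambda>p. pos_part (\<sigma> * cbt C p ?q)))"
    by (simp only: mult.assoc central)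
  finally have "\<iota> (aval (clt C ?q)) * norm_mon \<iota> S c
     = \<iota> (mon (- dot \<nu> (gvec (clt C ?q))) \<nu> * cprod C (\<lambda>p. pos_part (\<sigma> * cbt C p ?q)))"
    by (simp add: mon_mult)
  moreover have "c = (\<lambda>i. (if i = k then - 1 else 0) + pos_part (\<sigma> * sbmat S i k))"
    by (rule ext) (rule c_def)
  ultimately show ?thesis
    by (simp only:)
qed

lemma mutate_realizes:
  assumes R: "realizes S C \<pi>" and k: "k \<in> {1, 2, 3}" and L: "mutlink C (\<pi> k) C' \<rho>"
  shows "realizes (mutate \<iota> k S) C' (\<rho> \<circ> \<pi>)"
proof -
  let ?q = "\<pi> k" and ?S = "mutate \<iota> k S"
  \<comment> \<open>The negative part of the exchanged column; \<open>r\<close> is the positive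
    part. By sign-coherence one of the two is zero.\<close>
  define n where "n = (if posz (ccol C ?q) then 0 else - ccol C ?q)"
  define r where "r = (if posz (ccol C ?q) then ccol C ?q else 0)"
  have q: "?q \<in> {1, 2, 3}"
    using bij_betw_apply[OF realizesD(1)[OF R]] k by blast
  have other: "\<pi> i \<in> {1, 2, 3} \<and> \<pi> i \<noteq> ?q" if "i \<in> {1, 2, 3}" "i \<noteq> k" for i
    using realizesD(1)[OF R] that k by (auto simp: bij_betw_def inj_on_def)
  have in123: "\<pi> i \<in> {1, 2, 3}" if "i \<in> {1, 2, 3}" for i
    using bij_betw_apply[OF realizesD(1)[OF R]] that by blast
  have eq_iff: "\<pi> i = ?q \<longleftrightarrow> i = k" if "i \<in> {1, 2, 3}" for i
    using other[OF that] by blast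
  have neq: "4 \<noteq> k" "5 \<noteq> k" "6 \<noteq> k"
    using k by auto
  have sign: "posz (ccol C ?q) \<or> posz (- ccol C ?q)"
    using L unfolding mutlink_def by blast
  \<comment> \<open>A column with both signs would vanish, but by \<open>duality\<close> it pairs to
    1 with its own g-vector.\<close>
  have not_both: "\<not> (posz (ccol C ?q) \<and> posz (- ccol C ?q))"
  proof
    assume "posz (ccol C ?q) \<and> posz (- ccol C ?q)"
    then have "ccol C ?q = 0"
      by (cases "ccol C ?q") (simp add: zero_prod_def)
    with duality[OF q q, of C] show False
      by simp
  qed
  obtain a b c where abc: "ccol C ?q = (a, b, c)"
    by (metis prod.exhaust)
  have sk: "sbmat S 4 k = a" "sbmat S 5 k = b" "sbmat S 6 k = c"
    using realizesD(4)[OF R k] by (simp_all add: sbcol_def abc)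
  have n: "(pos_part (- a), pos_part (- b), pos_part (- c)) = n"
    and r: "(pos_part a, pos_part b, pos_part c) = r"
    using sign pos_part_triple[of a b c] by (auto simp: n_def r_def abc)
  have low_e: "(mut_E S k 4 k, mut_E S k 5 k, mut_E S k 6 k) = n"
    using neq by (simp add: mut_E_def sk n)
  \<comment> \<open>This pairing is the entry of the new form between the new variable and one that
    stays, so the cluster block stays zero.\<close>
  have n0: "dot (gvec (clt C p)) n = 0" if "p \<in> {1, 2, 3}" "p \<noteq> ?q" for p
    using duality[OF that(1) q, of C] that(2)
    by (cases "gvec (clt C p)") (auto simp: n_def abc zero_prod_def algebra_simps)
  have low: "slam ?S i j = lam0 i j" if "i \<in> {4, 5, 6}" "j \<in> {4, 5, 6}" for i j
  proof -
    have "i \<in> {1..6}" "i \<noteq> k" "j \<in> {1..6}" "j \<noteq> k"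
      using that neq by auto
    then show ?thesis
      using slam_mutate(1) realizesD(8)[OF R that] by simp
  qed
  have top0: "slam ?S i j = 0" if "i \<in> {1, 2, 3}" "j \<in> {1, 2, 3}" for i j
  proof -
    have i6: "i \<in> {1..6}" "j \<in> {1..6}"
      using that by auto
    consider "i = k" "j = k" | "i \<noteq> k" "j = k" | "i = k" "j \<noteq> k" | "i \<noteq> k" "j \<noteq> k"
      by blast
    then show ?thesis
    proof cases
      case 1
      then show ?thesis
        using slamcol_mutate(5)[OF R k] by simp
    next
      case 2
      then show ?thesis
        using slamcol_mutate(3)[OF R k that(1)] n0 other[OF that(1)] by (simp add: low_e)
    next
      case 3
      then show ?thesis
        using slamcol_mutate(4)[OF R k that(2)] n0 other[OF that(2)] by (simp add: low_e)
    next
      case 4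
      then show ?thesis
        using slam_mutate(1)[OF i6(1) _ i6(2)] realizesD(2)[OF R that] by simp
    qed
  qed
  have topb: "sbmat ?S i j = cbt C' (\<rho> (\<pi> i)) (\<rho> (\<pi> j))" if "i \<in> {1, 2, 3}" "j \<in> {1, 2, 3}" for i j
  proof -
    have "cbt C' (\<rho> (\<pi> i)) (\<rho> (\<pi> j)) = (if \<pi> i = ?q \<or> \<pi> j = ?q then - cbt C (\<pi> i) (\<pi> j)
         else cbt C (\<pi> i) (\<pi> j) + (\<bar>cbt C (\<pi> i) ?q\<bar> * cbt C ?q (\<pi> j) + cbt C (\<pi> i) ?q * \<bar>cbt C ?q (\<pi> j)\<bar>) div 2)"
      using L in123[OF that(1)] in123[OF that(2)] unfolding mutlink_def by blast
    then show ?thesis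
      using realizesD(3)[OF R that] realizesD(3)[OF R that(1) k] realizesD(3)[OF R k that(2)]
      by (simp add: mutate_def eq_iff[OF that(1)] eq_iff[OF that(2)])
  qed
  have keep: "clt C' (\<rho> (\<pi> j)) = clt C (\<pi> j)" if "j \<in> {1, 2, 3}" "j \<noteq> k" for j
    using L other[OF that] unfolding mutlink_def by blast
  have colb: "sbcol ?S j = ccol C' (\<rho> (\<pi> j))" if j: "j \<in> {1, 2, 3}" for j
  proof (cases "j = k")
    case True
    then show ?thesis
      using sbcol_mutate[OF R k j] L by (simp add: mutlink_def)
  next
    case False
    note oth = other[OF j False]
    show ?thesis
    proof (cases "posz (ccol C ?q)")
      case True
      then have "ccol C' (\<rho> (\<pi> j)) = ccol C (\<pi> j) + smul (pos_part (cbt C ?q (\<pi> j))) (ccol C ?q)"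
        using L oth not_both unfolding mutlink_def by blast
      then show ?thesis
        using sbcol_mutate[OF R k j] True False by simp
    next
      case neg: False
      then have "ccol C' (\<rho> (\<pi> j)) = ccol C (\<pi> j) + smul (pos_part (- cbt C ?q (\<pi> j))) (ccol C ?q)"
        using L oth unfolding mutlink_def by blast
      then show ?thesis
        using sbcol_mutate[OF R k j] neg sign False by simp
    qed
  qed
  have diag: "cbt C ?q ?q = 0"
    using q by (cases C) (auto simp: bmat0_def)
  have newg: "slamcol ?S k = gvec (clt C' (\<rho> ?q))"
  proof -
    define f where "f p = smul (if p = ?q then - 1 else pos_part (- cbt C p ?q)) (gvec (clt C p))" for p
    have e: "smul (mut_E S k s k) (slamcol S s) = f (\<pi> s)" if "s \<in> {1, 2, 3}" for s
      using realizesD(3)[OF R that k] realizesD(5)[OF R that] eq_iff[OF that]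
      by (simp add: mut_E_def f_def)
    have "slamcol ?S k = f (\<pi> 1) + f (\<pi> 2) + f (\<pi> 3) + lamlow n"
      using slamcol_mutate(1)[OF R k] e[of 1] e[of 2] e[of 3] by (simp add: low_e)
    also have "f (\<pi> 1) + f (\<pi> 2) + f (\<pi> 3) = f 1 + f 2 + f 3"
      by (rule sum_perm3[OF realizesD(1)[OF R]])
    also have "\<dots> = - gvec (clt C ?q) + smul (pos_part (- cbt C 1 ?q)) (gvec (clt C 1))
          + smul (pos_part (- cbt C 2 ?q)) (gvec (clt C 2)) + smul (pos_part (- cbt C 3 ?q)) (gvec (clt C 3))"
    proof -
      have m1: "smul (- 1) \<gamma> = - \<gamma>" for \<gamma>
        by (cases \<gamma>) simp
      have "?q = 1 \<or> ?q = 2 \<or> ?q = 3"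
        using q by blast
      then show ?thesis
        using diag by (elim disjE) (simp_all add: f_def m1 pos_part_def[of 0])
    qed
    finally have *: "slamcol ?S k = - gvec (clt C ?q) + smul (pos_part (- cbt C 1 ?q)) (gvec (clt C 1))
          + smul (pos_part (- cbt C 2 ?q)) (gvec (clt C 2)) + smul (pos_part (- cbt C 3 ?q)) (gvec (clt C 3))
          + lamlow n" .
    show ?thesis
    proof (cases "posz (ccol C ?q)")
      case True
      have "lamlow n = 0"
        using True by (simp add: n_def zero_prod_def)
      with True * L not_both show ?thesis
        unfolding mutlink_def by (metis add_0_right)
    next
      case False
      with * L show ?thesis
        unfolding mutlink_def n_def by (metis (full_types))
    qed
  qed
  have new: "svar ?S k = \<iota> (aval (clt C' (\<rho> ?q)))"
  proof -
    have A0: "\<iota> (aval (clt C ?q)) \<noteq> 0"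
      using emb_eq[of "aval (clt C ?q)" 0] aval_nonzero by (simp add: emb_0)
    have dn: "dot r (gvec (clt C ?q)) = (if posz (ccol C ?q) then 1 else 0)"
        "dot n (gvec (clt C ?q)) = (if posz (ccol C ?q) then 0 else - 1)"
      using duality[OF q q, of C] by (simp_all add: r_def n_def)
    have sm: "smul (- 1) \<gamma> = - \<gamma>" for \<gamma>
      by (cases \<gamma>) simp
    have plus: "\<iota> (aval (clt C ?q)) * norm_mon \<iota> S (\<lambda>i. (if i = k then - 1 else 0) + pos_part (sbmat S i k))
       = \<iota> (mon (- dot r (gvec (clt C ?q))) r * cprod C (\<lambda>p. pos_part (cbt C p ?q)))"
      using exchange_term[OF R k, of 1 r] r by (simp add: sk r_def)
    have minus: "\<iota> (aval (clt C ?q)) * norm_mon \<iota> S (\<lambda>i. (if i = k then - 1 else 0) + pos_part (- sbmat S i k))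
       = \<iota> (mon (- dot n (gvec (clt C ?q))) n * cprod C (\<lambda>p. pos_part (- cbt C p ?q)))"
      using exchange_term[OF R k, of "- 1" n] n by (simp add: sk n_def sm)
    have "aval (clt C ?q) * aval (clt C' (\<rho> ?q))
       = mon (- dot r (gvec (clt C ?q))) r * cprod C (\<lambda>p. pos_part (cbt C p ?q))
         + mon (- dot n (gvec (clt C ?q))) n * cprod C (\<lambda>p. pos_part (- cbt C p ?q))"
    proof (cases "posz (ccol C ?q)")
      case True
      then have "aval (clt C ?q) * aval (clt C' (\<rho> ?q)) =
          mon (- 1) (ccol C ?q) * cprod C (\<lambda>p. pos_part (cbt C p ?q)) + cprod C (\<lambda>p. pos_part (- cbt C p ?q))"
        using L not_both unfolding mutlink_def by blast
      with True show ?thesis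
        unfolding dn by (simp add: r_def n_def)
    next
      case False
      then have "aval (clt C ?q) * aval (clt C' (\<rho> ?q)) =
          cprod C (\<lambda>p. pos_part (cbt C p ?q)) + mon 1 (- ccol C ?q) * cprod C (\<lambda>p. pos_part (- cbt C p ?q))"
        using L unfolding mutlink_def by blast
      with False show ?thesis
        unfolding dn by (simp add: r_def n_def)
    qed
    then have "\<iota> (aval (clt C ?q)) * svar ?S k = \<iota> (aval (clt C ?q)) * \<iota> (aval (clt C' (\<rho> ?q)))"
      using plus minus by (simp add: mutate_def distrib_left emb_add flip: emb_mult)
    with A0 show ?thesis
      by simp
  qed
  have bij: "bij_betw (\<rho> \<circ> \<pi>) {1, 2, 3} {1, 2, 3}"
    using L realizesD(1)[OF R] unfolding mutlink_def by (blast intro: bij_betw_trans)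
  have cols: "slamcol ?S j = gvec (clt C' (\<rho> (\<pi> j))) \<and> slamrow ?S j = - gvec (clt C' (\<rho> (\<pi> j)))
      \<and> svar ?S j = \<iota> (aval (clt C' (\<rho> (\<pi> j))))" if j: "j \<in> {1, 2, 3}" for j
  proof (cases "j = k")
    case True
    then show ?thesis
      using newg new slamcol_mutate(2)[OF R k] by simp
  next
    case False
    have j6: "j \<in> {1..6}"
      using j by auto
    have "slamcol ?S j = slamcol S j" "slamrow ?S j = slamrow S j"
      using slam_mutate(1)[OF _ _ j6 False] slam_mutate(1)[OF j6 False] neq
      by (simp_all add: slamcol_def slamrow_def)
    moreover have "svar ?S j = svar S j"
      using False by (simp add: mutate_def)
    ultimately show ?thesis
      using realizesD(5-7)[OF R j] keep[OF j False] by simp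
  qed
  have "svar ?S 4 = svar S 4" "svar ?S 5 = svar S 5" "svar ?S 6 = svar S 6"
    using neq by (simp_all add: mutate_def)
  note y = this
  show ?thesis
    unfolding realizes_def comp_apply
    by (intro conjI ballI)
       (rule bij[unfolded comp_def] | (rule top0; assumption) | (rule topb; assumption) | (rule colb; assumption)
        | (rule cols[THEN conjunct1]; assumption) | (rule cols[THEN conjunct2, THEN conjunct1]; assumption)
        | (rule cols[THEN conjunct2, THEN conjunct2]; assumption) | (rule low; assumption)
        | (simp only: y realizesD(9-11)[OF R]) | rule bij)+
qed

lemma initial_realizes: "realizes (initial_seed \<iota>) (CA 1) id"
proof -
  have "ccol (CA 1) 1 = (1, 0, 0)" "ccol (CA 1) 2 = (0, 1, 0)" "ccol (CA 1) 3 = (0, 0, 1)"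
    by (simp_all add: zdefs)
  moreover have "gvec (clt (CA 1) 1) = (1, 0, 0)" "gvec (clt (CA 1) 2) = (0, 1, 0)" "gvec (clt (CA 1) 3) = (0, 0, 1)"
    by (simp_all add: gX_def xdeg_def)
  moreover have "aval (clt (CA 1) 1) = Xm (evec 1)" "aval (clt (CA 1) 2) = Xm (evec 2)" "aval (clt (CA 1) 3) = Xm (evec 3)"
    by (simp_all add: aX_pos x_1 x_2 x_3 evec_def)
  moreover have "Xm (evec 4) = mon 0 (1, 0, 0)" "Xm (evec 5) = mon 0 (0, 1, 0)" "Xm (evec 6) = mon 0 (0, 0, 1)"
    by (simp_all add: Xm_def mon_def evec_def)
  ultimately show ?thesis
    by (simp add: realizes_def initial_seed_def sbcol_def slamcol_def slamrow_def lam0_def bmat0_def del: clt.simps ccol.simps One_nat_def)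
qed

text \<open>The six links cover the three directions from both kinds of clusters, so mutation never
  leaves this list.\<close>

lemma seed_realizes: "S \<in> seeds \<iota> \<Longrightarrow> \<exists>C \<pi>. realizes S C \<pi>"
proof (induction rule: seeds.induct)
  case initial
  then show ?case
    using initial_realizes by blast
next
  case (mutation S k)
  then obtain C \<pi> where R: "realizes S C \<pi>"
    by blast
  have "\<pi> k \<in> {1, 2, 3}"
    using bij_betw_apply[OF realizesD(1)[OF R]] mutation by blast
  then have "\<exists>C' \<rho>. mutlink C (\<pi> k) C' \<rho>"
    using link_A1 link_A2 link_A3 link_B1 link_B2 link_B3 by (cases C) (fastforce simp del: One_nat_def)+
  with mutate_realizes[OF R mutation(2)] show ?case
    by blast
qed

lemma mutate_seed:
  assumes "S \<in> seeds \<iota>" "realizes S C \<pi>" "mutlink C q C' \<rho>" "q \<in> {1, 2, 3}"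
  shows "\<exists>S\<in>seeds \<iota>. \<exists>\<pi>. realizes S C' \<pi>"
proof -
  obtain k where "k \<in> {1, 2, 3}" "\<pi> k = q"
    using realizesD(1)[OF assms(2)] assms(4) unfolding bij_betw_def by (metis imageE)
  then show ?thesis
    using mutate_realizes[OF assms(2)] assms(1,3) seeds.mutation by metis
qed

text \<open>Links at the first and third position walk through all \<open>CA m\<close>; mutating in
  the middle then reaches \<open>CB m\<close>.\<close>

lemma cluster_realized: "\<exists>S\<in>seeds \<iota>. \<exists>\<pi>. realizes S C \<pi>"
proof -
  have A: "\<exists>S\<in>seeds \<iota>. \<exists>\<pi>. realizes S (CA m) \<pi>" for m
  proof (induction m rule: int_induct[where k = 1])
    case base
    then show ?case
      using initial_realizes seeds.initial by blast
  next
    case (step1 i)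
    then show ?case
      using mutate_seed[OF _ _ link_A1] by blast
  next
    case (step2 i)
    then show ?case
      using mutate_seed[OF _ _ link_A3] by blast
  qed
  show ?thesis
  proof (cases C)
    case (CB m)
    then show ?thesis
      using A[of m] mutate_seed[OF _ _ link_A2] by blast
  qed (simp add: A)
qed

end

section \<open>The basis elements and their leading exponents\<close>

definition awval :: "letter list \<Rightarrow> qtorus" where
  "awval W = prod_list (map aval W)"

definition gw :: "letter list \<Rightarrow> z3" where
  "gw W = sum_list (map gvec W)"

lemma awval_simps [simp]: "awval [] = 1" "awval (s # W) = aval s * awval W" "awval (U @ W) = awval U * awval W"
  by (simp_all add: awval_def)

lemma awval_replicate [simp]: "awval (replicate n s) = aval s ^ n"
  by (induction n) simp_all

lemma gw_simps [simp]: "gw [] = 0" "gw (s # W) = gvec s + gw W" "gw (U @ W) = gw U + gw W"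
  by (simp_all add: gw_def)

lemma smul_Suc: "smul (1 + int n) \<gamma> = \<gamma> + smul (int n) \<gamma>"
  by (cases \<gamma>) (simp add: algebra_simps)

lemma gw_replicate [simp]: "gw (replicate n s) = smul (int n) (gvec s)"
  by (induction n) (simp_all add: smul_Suc)

lemma pointed_awval: "pointed (awval W) (gw W)"
  by (induction W) (simp_all add: pointed_1 pointed_mult pointed_aval)

lemma basic_pair:
  assumes "basic W" "s \<in> set W" "t \<in> set W" "s \<noteq> t"
  shows "compat s t"
  using assms
proof (induction W)
  case (Cons a W)
  then show ?case
    using compat_sym by (auto simp: basic_def)
qed simp

lemma awval_perm: "basic W \<Longrightarrow> mset W = mset W' \<Longrightarrow> awval W = awval W'"
proof (induction W arbitrary: W')
  case (Cons a W)
  then have "a \<in> set W'"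
    by (metis list.set_intros(1) set_mset_mset)
  then obtain U R where W': "W' = U @ a # R"
    by (metis split_list)
  with Cons.prems(2) have m: "mset W = mset (U @ R)"
    by simp
  have "basic W" and a: "\<And>s. s \<in> set W \<Longrightarrow> compat a s"
    using Cons.prems(1) by (simp_all add: basic_def)
  have "set U \<subseteq> set W"
    using m by (metis Un_upper1 set_append set_mset_mset)
  then have "compat a s" if "s \<in> set U" for s
    using a that by blast
  then have "aval a * awval U = awval U * aval a"
    by (induction U) (simp_all add: compat_aval commute_mult)
  then show ?case
    using Cons.IH[OF \<open>basic W\<close> m] by (simp add: W' flip: mult.assoc)
qed simp

lemma gw_perm: "mset W = mset W' \<Longrightarrow> gw W = gw W'"
  by (simp add: gw_def flip: sum_mset_sum_list)

lemma bar_awval: "bar (awval W) = awval (rev W)"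
  by (induction W) (simp_all add: bar_mult)

lemma bar_awval_basic: "basic W \<Longrightarrow> bar (awval W) = awval W"
  using awval_perm[of W "rev W"] by (simp add: bar_awval)

lemma basicI: "(\<And>s t. s \<in> set W \<Longrightarrow> t \<in> set W \<Longrightarrow> compat s t) \<Longrightarrow> basic W"
  by (induction W) (simp_all add: basic_def)

definition cword :: "cluster \<Rightarrow> nat \<Rightarrow> nat \<Rightarrow> nat \<Rightarrow> letter list" where
  "cword C a b c = replicate a (clt C 1) @ replicate b (clt C 2) @ replicate c (clt C 3)"

lemma basic_three_letters:
  assumes "basic W" "set W \<subseteq> {clt C 1, clt C 2, clt C 3}"
  shows "\<exists>a b c. mset W = mset (cword C a b c)"
proof -
  have d: "clt C 1 \<noteq> clt C 2" "clt C 1 \<noteq> clt C 3" "clt C 2 \<noteq> clt C 3"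
    by (cases C; simp add: vlet_def)+
  have "mset W = mset (cword C (count (mset W) (clt C 1)) (count (mset W) (clt C 2)) (count (mset W) (clt C 3)))"
  proof (rule multiset_eqI)
    fix s
    show "count (mset W) s = count (mset (cword C (count (mset W) (clt C 1)) (count (mset W) (clt C 2)) (count (mset W) (clt C 3)))) s"
    proof (cases "s \<in> set W")
      case True
      with assms(2) have "s = clt C 1 \<or> s = clt C 2 \<or> s = clt C 3"
        by blast
      then show ?thesis
        using d d[symmetric] by (elim disjE) (simp_all add: cword_def count_replicate_mset del: One_nat_def)
    next
      case False
      then have "count (mset W) s = 0"
        by (simp add: count_eq_zero_iff)
      then show ?thesis
        by (auto simp: cword_def count_replicate_mset simp del: One_nat_def)
    qed
  qed
  then show ?thesis
    by blast
qed

text \<open>Next to u_n only w's or only z's can occur. Otherwise the bridging indices lie in a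
  window of length two, and a letter w or z forces them to have one parity.\<close>

lemma basic_normal_form:
  assumes "basic W"
  shows "(\<exists>C a b c. mset W = mset (cword C a b c)) \<or> (\<exists>n k. mset W = mset (LU n # replicate k LW))
    \<or> (\<exists>n k. mset W = mset (LU n # replicate k LZ))"
proof -
  note pair = basic_pair[OF assms]
  define M where "M = {m. LX m \<in> set W}"
  have "M = (\<lambda>s. case s of LX m \<Rightarrow> m | _ \<Rightarrow> 0) ` (set W \<inter> range LX)"
    by (force simp: M_def)
  then have fin: "finite M"
    by simp
  have M: "\<bar>m - n\<bar> \<le> 2" if "m \<in> M" "n \<in> M" for m n
    using pair[of "LX m" "LX n"] that by (cases "m = n") (simp_all add: M_def)
  define m0 where "m0 = Min M"
  have m0: "m0 \<in> M \<and> m0 \<le> m \<and> m \<le> m0 + 2" if "m \<in> M" for m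
  proof -
    have "m0 \<in> M" "m0 \<le> m"
      using that fin by (auto simp: m0_def intro: Min_in)
    then show ?thesis
      using M[of m m0] that by linarith
  qed
  show ?thesis
  proof (cases "\<exists>n. LU n \<in> set W")
    case True
    then obtain n where n: "LU n \<in> set W" ..
    then obtain U R where W: "W = U @ LU n # R"
      by (metis split_list)
    \<comment> \<open>Positions are compared, so this also excludes a second \<open>LU\<close>
      letter.\<close>
    have once: "compat (LU n) s" if "s \<in> set (U @ R)" for s
      using assms that compat_sym by (auto simp: W basic_def sorted_wrt_append)
    have "s = LW \<or> s = LZ" if "s \<in> set (U @ R)" for s
      using once[OF that] by (cases s) auto
    moreover have "\<not> (LW \<in> set (U @ R) \<and> LZ \<in> set (U @ R))"
      using pair[of LW LZ] by (auto simp: W)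
    ultimately have "(\<forall>s\<in>set (U @ R). s = LW) \<or> (\<forall>s\<in>set (U @ R). s = LZ)"
      by blast
    then have "replicate (length (U @ R)) LW = U @ R \<or> replicate (length (U @ R)) LZ = U @ R"
      using replicate_length_same[of "U @ R" LW] replicate_length_same[of "U @ R" LZ] by blast
    moreover have "mset W = mset (LU n # (U @ R))"
      by (simp add: W)
    ultimately have "mset W = mset (LU n # replicate (length (U @ R)) LW)
        \<or> mset W = mset (LU n # replicate (length (U @ R)) LZ)"
      by (elim disjE) (simp_all only: simp_thms)
    then show ?thesis
      by blast
  next
    case noU: False
    have V: "\<exists>C. set W \<subseteq> {clt C 1, clt C 2, clt C 3}" if v: "vlet (k + 1) \<in> set W" for k
    proof -
      have par: "even m = even k" if "m \<in> M" for m
        using pair[of "vlet (k + 1)" "LX m"] v that by (cases "even k") (auto simp: M_def vlet_def)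
      have *: "set W \<subseteq> insert (vlet (k + 1)) (LX ` M)"
      proof
        fix s assume s: "s \<in> set W"
        show "s \<in> insert (vlet (k + 1)) (LX ` M)"
          by (cases s) (use pair[of LW LZ] noU s v in \<open>auto simp: M_def vlet_def split: if_splits\<close>)
      qed
      show ?thesis
      proof (cases "M = {}")
        case True
        then show ?thesis
          using * by (intro exI[of _ "CB k"]) auto
      next
        case False
        have m: "even m0 = even k \<and> (m = m0 \<or> m = m0 + 2)" if "m \<in> M" for m
        proof -
          have "m0 \<in> M" "m0 \<le> m" "m \<le> m0 + 2"
            using m0[OF that] by auto
          moreover from this have "even m0 = even k" "even m = even k"
            using par that by auto
          ultimately show ?thesis
            by presburger
        qed
        then have "vlet (m0 + 1) = vlet (k + 1)" "LX ` M \<subseteq> {LX m0, LX (m0 + 2)}"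
          using False by (auto simp: vlet_def)
        with * show ?thesis
          by (intro exI[of _ "CB m0"]) auto
      qed
    qed
    have "\<exists>C. set W \<subseteq> {clt C 1, clt C 2, clt C 3}"
    proof -
      consider (v) "LW \<in> set W \<or> LZ \<in> set W" | (x) "LW \<notin> set W" "LZ \<notin> set W"
        by blast
      then show ?thesis
      proof cases
        case v
        then show ?thesis
          using V[of 0] V[of 1] by (auto simp: vlet_def)
      next
        case x
        have *: "set W \<subseteq> LX ` M"
        proof
          fix s assume s: "s \<in> set W"
          show "s \<in> LX ` M"
            by (cases s) (use x noU s in \<open>auto simp: M_def\<close>)
        qed
        have "m = m0 \<or> m = m0 + 1 \<or> m = m0 + 2" if "m \<in> M" for m
        proof -
          have "m0 \<le> m" "m \<le> m0 + 2"
            using m0[OF that] by auto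
          then show ?thesis
            by presburger
        qed
        then have "LX ` M \<subseteq> {LX m0, LX (m0 + 1), LX (m0 + 2)}"
          by auto
        with * show ?thesis
          by (intro exI[of _ "CA m0"]) auto
      qed
    qed
    then show ?thesis
      using basic_three_letters[OF assms] by blast
  qed
qed

section \<open>Recovering a basis element from its leading exponent\<close>

definition EA :: "int \<Rightarrow> nat \<Rightarrow> nat \<Rightarrow> nat \<Rightarrow> qtorus" where
  "EA m a b c = aX m ^ a * aX (m + 1) ^ b * aX (m + 2) ^ c"

definition EB :: "int \<Rightarrow> nat \<Rightarrow> nat \<Rightarrow> nat \<Rightarrow> qtorus" where
  "EB m a k c = aX m ^ a * V (m + 1) ^ k * aX (m + 2) ^ c"

lemma awval_cword: "awval (cword (CA m) a b c) = EA m a b c" "awval (cword (CB m) a b c) = EB m a b c"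
  by (simp_all add: cword_def EA_def EB_def mult.assoc)

lemma gw_cword:
  "gw (cword (CA m) a b c) = smul (int a) (gX m) + smul (int b) (gX (m + 1)) + smul (int c) (gX (m + 2))"
  "gw (cword (CB m) a b c) = smul (int a) (gX m) + smul (int b) (gV (m + 1)) + smul (int c) (gX (m + 2))"
  by (simp_all add: cword_def add.assoc)

text \<open>A monomial in \<open>w\<close> or \<open>z\<close> and bridging variables \<open>X\<^sub>m\<close> whose indices all have the same sign is
  determined by the number \<open>N\<close> of bridging variables, the number \<open>E\<close> of those of even index
  (corrected by the exponent of \<open>w\<close> or \<open>z\<close>) and the sum \<open>M\<close> of their indices (corrected likewise).\<close>

definition shape :: "int \<Rightarrow> int \<Rightarrow> int \<Rightarrow> int \<Rightarrow> qtorus \<Rightarrow> bool" where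
  "shape \<epsilon> N E M t \<longleftrightarrow>
     (\<exists>m a b c. t = EA m a b c \<and> N = int a + int b + int c
        \<and> E = (if even m then int a + int c else int b) \<and> M = m * N + int b + 2 * int c) \<or>
     (\<exists>m a k c. 1 \<le> k \<and> t = EB m a k c \<and> N = int a + int c
        \<and> E = (if even m then N + int k else - int k) \<and> M = m * N + 2 * int c + \<epsilon> * int k)"

text \<open>The parameters themselves are not unique, e.g.
  \<open>EA m 0 b c = EA (m + 1) b c 0\<close>, so the conclusion compares values.\<close>

lemma EA_unique:
  assumes le: "m \<le> m'" and N: "1 \<le> N" "N = int a + int b + int c" "N = int a' + int b' + int c'"
    and E: "(if even m then int a + int c else int b) = (if even m' then int a' + int c' else int b')"
    and M: "m * N + int b + 2 * int c = m' * N + int b' + 2 * int c'"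
  shows "EA m a b c = EA m' a' b' c'"
proof -
  obtain d where m': "m' = m + d" and "0 \<le> d"
    using le by (metis zle_iff_zadd of_nat_0_le_iff)
  have eq: "d * N = int b + 2 * int c - int b' - 2 * int c'"
    using M by (simp add: m' algebra_simps)
  \<comment> \<open>M / N is the mean index, which lies between m and m + 2; equal means force the
    starting indices to differ by at most 2.\<close>
  have "d \<le> 2"
  proof (rule ccontr)
    assume "\<not> d \<le> 2"
    then have "3 * N \<le> d * N"
      using N(1) by (intro mult_right_mono) auto
    with eq N show False
      by linarith
  qed
  with \<open>0 \<le> d\<close> have "d = 0 \<or> d = 1 \<or> d = 2"
    by linarith
  then show ?thesis
  proof (elim disjE)
    assume d: "d = 0"
    have "int b = int b'"
      using E N by (auto simp: m' d split: if_splits)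
    then have "int b = int b' \<and> int c = int c' \<and> int a = int a'"
      using eq N by (simp add: d)
    then have "a = a' \<and> b = b' \<and> c = c'"
      by simp
    then show ?thesis
      by (simp add: m' d)
  next
    assume d: "d = 1"
    have "int b = int a' + int c' \<and> int b' = int a + int c"
      using E N by (auto simp: m' d split: if_splits)
    then have "int a + int c' = 0"
      using eq N by (simp add: d)
    then have "int a = 0" "int c' = 0"
      by linarith+
    then have "a = 0 \<and> c' = 0 \<and> b = a' \<and> c = b'"
      using \<open>int b = int a' + int c' \<and> int b' = int a + int c\<close> by simp
    then show ?thesis
      by (simp add: m' d EA_def add.assoc)
  next
    assume d: "d = 2"
    have "a = 0 \<and> b = 0 \<and> b' = 0 \<and> c' = 0 \<and> c = a'"
      using eq N by (simp add: d)
    then show ?thesis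
      by (simp add: m' d EA_def)
  qed
qed

text \<open>E exceeds N for even m and is negative for odd m, which reveals the parity and the
  exponent k; then the mean index is compared as for \<open>EA\<close>.\<close>

lemma EB_unique:
  assumes le: "m \<le> m'" and N: "1 \<le> N" "N = int a + int c" "N = int a' + int c'" and k: "1 \<le> k" "1 \<le> k'"
    and E: "(if even m then N + int k else - int k) = (if even m' then N + int k' else - int k')"
    and M: "m * N + 2 * int c + \<epsilon> * int k = m' * N + 2 * int c' + \<epsilon> * int k'"
  shows "EB m a k c = EB m' a' k' c'"
proof -
  have par: "even m = even m'" "k = k'"
    using E N(1) k by (auto split: if_splits)
  obtain d where m': "m' = m + 2 * d" and "0 \<le> d"
  proof -
    have "even (m' - m)"
      using par(1) by simp
    then obtain d where "m' - m = 2 * d" ..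
    with le show ?thesis
      by (intro that[of d]) auto
  qed
  have eq: "d * N = int c - int c'"
    using M by (simp add: m' par(2) algebra_simps)
  have "d \<le> 1"
  proof (rule ccontr)
    assume "\<not> d \<le> 1"
    then have "2 * N \<le> d * N"
      using N(1) by (intro mult_right_mono) auto
    with eq N show False
      by linarith
  qed
  with \<open>0 \<le> d\<close> have "d = 0 \<or> d = 1"
    by linarith
  then show ?thesis
  proof (elim disjE)
    assume d: "d = 0"
    then have "a = a' \<and> c = c'"
      using eq N by simp
    then show ?thesis
      by (simp add: m' d par)
  next
    assume d: "d = 1"
    then have "a = 0 \<and> c' = 0 \<and> c = a'"
      using eq N by simp
    moreover have "V (m + 3) = V (m + 1)"
      by (simp add: V_def)
    moreover have "aX (m + 2) ^ c * V (m + 1) ^ k = V (m + 1) ^ k * aX (m + 2) ^ c"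
    proof -
      have "aX (m + 2) * V (m + 1) = V (m + 1) * aX (m + 2)"
        using aX_V_commute[of "m + 2"] \<open>V (m + 3) = V (m + 1)\<close> by (simp add: add.commute)
      then show ?thesis
        by (metis power_commuting_commutes)
    qed
    ultimately show ?thesis
      by (simp add: m' d EB_def par add.assoc)
  qed
qed

text \<open>The two forms are told apart by E: it lies in the interval from 0 to N for
  \<open>EA\<close> and outside it for \<open>EB\<close>, since there k >= 1.\<close>

lemma shape_unique:
  assumes "1 \<le> N" "shape \<epsilon> N E M t" "shape \<epsilon> N E M t'"
  shows "t = t'"
proof -
  consider (AA) m a b c m' a' b' c' where
      "t = EA m a b c" "N = int a + int b + int c" "E = (if even m then int a + int c else int b)" "M = m * N + int b + 2 * int c"
      "t' = EA m' a' b' c'" "N = int a' + int b' + int c'" "E = (if even m' then int a' + int c' else int b')"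
      "M = m' * N + int b' + 2 * int c'"
    | (BB) m a k c m' a' k' c' where "1 \<le> k" "1 \<le> k'"
      "t = EB m a k c" "N = int a + int c" "E = (if even m then N + int k else - int k)" "M = m * N + 2 * int c + \<epsilon> * int k"
      "t' = EB m' a' k' c'" "N = int a' + int c'" "E = (if even m' then N + int k' else - int k')"
      "M = m' * N + 2 * int c' + \<epsilon> * int k'"
    | (AB) "0 \<le> E \<and> E \<le> N" "E < 0 \<or> N < E"
    using assms(2,3) unfolding shape_def
    by (elim disjE exE conjE) (force split: if_splits)+
  then show ?thesis
  proof cases
    case AA
    show ?thesis
    proof (cases "m \<le> m'")
      case True
      then show ?thesis
        using EA_unique[of m m' N a b c a' b' c'] AA assms(1) by simp
    next
      case False
      then show ?thesis
        using EA_unique[of m' m N a' b' c' a b c] AA assms(1) by simp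
    qed
  next
    case BB
    show ?thesis
    proof (cases "m \<le> m'")
      case True
      then show ?thesis
        using EB_unique[of m m' N a c a' c' k k' \<epsilon>] BB assms(1) by simp
    next
      case False
      then show ?thesis
        using EB_unique[of m' m N a' c' a c k' k \<epsilon>] BB assms(1) by simp
    qed
  qed auto
qed

text \<open>\<open>canon n t g\<close> describes the pairs of a basis element \<open>t\<close> and its leading exponent \<open>g\<close>; \<open>n\<close> is the
  index of the factor \<open>u\<^sub>n\<close>. The four cases are distinguished by the position of \<open>g\<close>: products with
  bridging variables of positive index only, of nonpositive index only, of both kinds, and none.\<close>

definition posreg :: "z3 \<Rightarrow> bool" where
  "posreg g \<longleftrightarrow> (case g of (\<alpha>, \<beta>, \<gamma>) \<Rightarrow> 0 \<le> \<gamma> \<and> 0 \<le> \<gamma> + \<beta>)"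

definition negreg :: "z3 \<Rightarrow> bool" where
  "negreg g \<longleftrightarrow> (case g of (\<alpha>, \<beta>, \<gamma>) \<Rightarrow> \<alpha> \<le> 0 \<and> \<alpha> + \<beta> \<le> 0)"

fun gsum :: "z3 \<Rightarrow> int" where
  "gsum (\<alpha>, \<beta>, \<gamma>) = \<alpha> + \<beta> + \<gamma>"

text \<open>Only clusters that start at 0 or -1 contain bridging variables of both kinds. The
  inequalities ask that both kinds really occur; the exponents can then be read off from g.\<close>

definition mixed :: "qtorus \<Rightarrow> z3 \<Rightarrow> bool" where
  "mixed t g \<longleftrightarrow>
     (\<exists>a b c. 1 \<le> a \<and> 1 \<le> b + c \<and> t = EA 0 a b c \<and> g = (int b, int c, - int a)) \<or>
     (\<exists>a b c. 1 \<le> a + b \<and> 1 \<le> c \<and> t = EA (- 1) a b c \<and> g = (int c, - int a, - int b)) \<or>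
     (\<exists>a k c. 1 \<le> a \<and> 1 \<le> k \<and> 1 \<le> c \<and> t = EB 0 a k c \<and> g = (- int k, int k + int c, - int a)) \<or>
     (\<exists>a k c. 1 \<le> a \<and> 1 \<le> k \<and> 1 \<le> c \<and> t = EB (- 1) a k c \<and> g = (int c, - int a - int k, int k))"

definition nonbridging :: "nat \<Rightarrow> qtorus \<Rightarrow> z3 \<Rightarrow> bool" where
  "nonbridging n t g \<longleftrightarrow>
     (\<exists>k. t = u_elem n * w_elem ^ k \<and> g = (- int n, - int k, int n + int k)) \<or>
     (\<exists>k. t = u_elem n * z_elem ^ k \<and> g = (- int n - int k, int k, int n))"

definition canon :: "nat \<Rightarrow> qtorus \<Rightarrow> z3 \<Rightarrow> bool" where
  "canon n t g \<longleftrightarrow> (case g of (\<alpha>, \<beta>, \<gamma>) \<Rightarrow>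
     n = 0 \<and> posreg g \<and> 1 \<le> gsum g \<and> shape 1 (gsum g) \<beta> (2 * \<gamma> + \<beta> + gsum g) t \<or>
     n = 0 \<and> negreg g \<and> gsum g \<le> - 1 \<and> shape (- 1) (- gsum g) (\<beta> - gsum g) (2 * \<alpha> + \<beta>) t \<or>
     n = 0 \<and> mixed t g \<or>
     nonbridging n t g)"

lemma mixed_reg: "mixed t g \<Longrightarrow> \<not> posreg g \<and> \<not> negreg g"
  by (auto simp: mixed_def posreg_def negreg_def)

lemma nonbridging_reg: "nonbridging n t g \<Longrightarrow> posreg g \<and> negreg g \<and> gsum g = 0"
  by (auto simp: nonbridging_def posreg_def negreg_def)

lemma mixed_unique:
  assumes "mixed t g" "mixed t' g"
  shows "t = t'"
  using assms unfolding mixed_def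
  by (elim disjE exE conjE) (auto simp: EA_def)

lemma nonbridging_unique: "nonbridging n t g \<Longrightarrow> nonbridging n' t' g \<Longrightarrow> t = t' \<and> n = n'"
proof -
  have mix: "t = t' \<and> n = n'" if "t = u_elem n * w_elem ^ k" "g = (- int n, - int k, int n + int k)"
      "t' = u_elem n' * z_elem ^ k'" "g = (- int n' - int k', int k', int n')" for n t n' t' k k'
  proof -
    have "- int k = int k'" "- int n = - int n' - int k'"
      using that by simp_all
    then have "k = 0 \<and> k' = 0 \<and> n = n'"
      by linarith
    then show ?thesis
      by (simp add: that(1,3))
  qed
  assume *: "nonbridging n t g" "nonbridging n' t' g"
  then consider k k' where "t = u_elem n * w_elem ^ k" "g = (- int n, - int k, int n + int k)"
      "t' = u_elem n' * w_elem ^ k'" "g = (- int n', - int k', int n' + int k')"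
    | k k' where "t = u_elem n * z_elem ^ k" "g = (- int n - int k, int k, int n)"
      "t' = u_elem n' * z_elem ^ k'" "g = (- int n' - int k', int k', int n')"
    | k k' where "t = u_elem n * w_elem ^ k" "g = (- int n, - int k, int n + int k)"
      "t' = u_elem n' * z_elem ^ k'" "g = (- int n' - int k', int k', int n')"
    | k k' where "t' = u_elem n' * w_elem ^ k" "g = (- int n', - int k, int n' + int k)"
      "t = u_elem n * z_elem ^ k'" "g = (- int n - int k', int k', int n)"
    unfolding nonbridging_def by blast
  then show ?thesis
  proof cases
    case 1
    then show ?thesis
      by simp
  next
    case 2
    then show ?thesis
      by simp
  next
    case 3
    then show ?thesis
      by (rule mix)
  next
    case 4
    then have "t' = t \<and> n' = n"
      by (rule mix)
    then show ?thesis
      by simp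
  qed
qed

lemma canon_unique:
  assumes "canon n t g" "canon n' t' g"
  shows "t = t' \<and> n = n'"
proof -
  obtain \<alpha> \<beta> \<gamma> where g: "g = (\<alpha>, \<beta>, \<gamma>)"
    by (metis prod.exhaust)
  have "n = 0 \<and> posreg g \<and> 1 \<le> gsum g \<and> shape 1 (gsum g) \<beta> (2 * \<gamma> + \<beta> + gsum g) t
      \<or> n = 0 \<and> negreg g \<and> gsum g \<le> - 1 \<and> shape (- 1) (- gsum g) (\<beta> - gsum g) (2 * \<alpha> + \<beta>) t
      \<or> n = 0 \<and> mixed t g \<or> nonbridging n t g"
    using assms(1) by (simp add: canon_def g)
  moreover have "n' = 0 \<and> posreg g \<and> 1 \<le> gsum g \<and> shape 1 (gsum g) \<beta> (2 * \<gamma> + \<beta> + gsum g) t'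
      \<or> n' = 0 \<and> negreg g \<and> gsum g \<le> - 1 \<and> shape (- 1) (- gsum g) (\<beta> - gsum g) (2 * \<alpha> + \<beta>) t'
      \<or> n' = 0 \<and> mixed t' g \<or> nonbridging n' t' g"
    using assms(2) by (simp add: canon_def g)
  moreover have "\<not> (1 \<le> gsum g \<and> gsum g \<le> - 1)" "\<not> (1 \<le> gsum g \<and> gsum g = 0)" "\<not> (gsum g \<le> - 1 \<and> gsum g = 0)"
    by linarith+
  moreover have "gsum g \<le> - 1 \<Longrightarrow> 1 \<le> - gsum g"
    by linarith
  ultimately show ?thesis
    using mixed_reg[of t g] mixed_reg[of t' g] nonbridging_reg[of n t g] nonbridging_reg[of n' t' g]
      mixed_unique[of t g t'] nonbridging_unique[of n t g n' t']
      shape_unique[of "gsum g" 1 \<beta> "2 * \<gamma> + \<beta> + gsum g" t t']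
      shape_unique[of "- gsum g" "- 1" "\<beta> - gsum g" "2 * \<alpha> + \<beta>" t t']
    by argo
qed

lemma canon_posI:
  assumes "gsum (\<alpha>, \<beta>, \<gamma>) = N" "shape 1 N \<beta> (2 * \<gamma> + \<beta> + N) t" "1 \<le> N" "0 \<le> \<gamma>" "0 \<le> \<gamma> + \<beta>"
  shows "canon 0 t (\<alpha>, \<beta>, \<gamma>)"
  unfolding canon_def prod.case assms(1) using assms(2-) by (simp add: posreg_def)

lemma canon_negI:
  assumes "gsum (\<alpha>, \<beta>, \<gamma>) = - N" "shape (- 1) N E (2 * \<alpha> + \<beta>) t" "\<beta> = E - N" "1 \<le> N" "\<alpha> \<le> 0" "\<alpha> + \<beta> \<le> 0"
  shows "canon 0 t (\<alpha>, \<beta>, \<gamma>)"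
  unfolding canon_def prod.case assms(1) using assms(2-) by (simp add: negreg_def)

text \<open>The functional 2 \<gamma> + \<beta> + 1 recovers the index, and its linear part is 1 on
  the g-vectors of w and z. This is the origin of the third invariant and of the parameter 1 in
  \<open>shape\<close>; on the negative side 2 \<alpha> + \<beta> does the same with -1.\<close>

lemma gX_pos: "1 \<le> m \<Longrightarrow> \<exists>\<gamma>. 0 \<le> \<gamma> \<and> gX m = (1 - of_bool (even m) - \<gamma>, of_bool (even m), \<gamma>) \<and> 2 * \<gamma> + of_bool (even m) + 1 = m"
  by (cases m rule: parity_cases) (auto simp: gX_def xdeg_def)

lemma gX_neg: "m \<le> 0 \<Longrightarrow> \<exists>\<alpha>. \<alpha> \<le> 0 \<and> \<alpha> \<le> of_bool (odd m)
     \<and> gX m = (\<alpha>, - of_bool (odd m), of_bool (odd m) - 1 - \<alpha>) \<and> 2 * \<alpha> - of_bool (odd m) = m"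
  by (cases m rule: parity_cases) (auto simp: gX_def)

definition GA :: "int \<Rightarrow> nat \<Rightarrow> nat \<Rightarrow> nat \<Rightarrow> z3" where
  "GA m a b c = smul (int a) (gX m) + smul (int b) (gX (m + 1)) + smul (int c) (gX (m + 2))"

definition GB :: "int \<Rightarrow> nat \<Rightarrow> nat \<Rightarrow> nat \<Rightarrow> z3" where
  "GB m a k c = smul (int a) (gX m) + smul (int k) (gV (m + 1)) + smul (int c) (gX (m + 2))"

lemma canon_EA_pos:
  assumes m: "1 \<le> m" and N: "1 \<le> a + b + c"
  shows "canon 0 (EA m a b c) (GA m a b c)"
proof -
  obtain p where p: "0 \<le> p" "gX m = (1 - of_bool (even m) - p, of_bool (even m), p)" "2 * p + of_bool (even m) + 1 = m"
    using gX_pos[OF m] by blast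
  obtain q where q: "0 \<le> q" "gX (m + 1) = (1 - of_bool (odd m) - q, of_bool (odd m), q)" "2 * q + of_bool (odd m) = m"
    using gX_pos[of "m + 1"] m by auto
  have r: "gX (m + 2) = (- of_bool (even m) - p, of_bool (even m), p + 1)"
    using gX_pos[of "m + 2"] m p by auto
  define \<beta> where "\<beta> = (if even m then int a + int c else int b)"
  define \<gamma> where "\<gamma> = int a * p + int b * q + int c * (p + 1)"
  have g: "GA m a b c = (int a + int b + int c - \<beta> - \<gamma>, \<beta>, \<gamma>)"
    unfolding GA_def p(2) q(2) r by (simp add: \<beta>_def \<gamma>_def algebra_simps)
  have nn: "0 \<le> \<gamma>" "0 \<le> \<beta>"
    using p(1) q(1) by (simp_all add: \<gamma>_def \<beta>_def)
  have "2 * \<gamma> + \<beta> + (int a + int b + int c)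
      = int a * (2 * p + of_bool (even m) + 1) + int b * (2 * q + of_bool (odd m) + 1) + int c * (2 * p + of_bool (even m) + 1 + 2)"
    by (simp add: \<gamma>_def \<beta>_def algebra_simps)
  also have "\<dots> = m * (int a + int b + int c) + int b + 2 * int c"
    unfolding p(3) q(3) by (simp add: algebra_simps)
  finally have "shape 1 (int a + int b + int c) \<beta> (2 * \<gamma> + \<beta> + (int a + int b + int c)) (EA m a b c)"
    unfolding shape_def \<beta>_def by (intro disjI1 exI[of _ m] exI[of _ a] exI[of _ b] exI[of _ c]) simp
  then show ?thesis
    unfolding g by (rule canon_posI[rotated]) (use nn N in simp_all)
qed

lemma canon_EA_neg:
  assumes m: "m \<le> - 2" and N: "1 \<le> a + b + c"
  shows "canon 0 (EA m a b c) (GA m a b c)"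
proof -
  obtain p where p: "p \<le> 0" "gX m = (p, - of_bool (odd m), of_bool (odd m) - 1 - p)" "2 * p - of_bool (odd m) = m"
    using gX_neg[of m] m by auto
  obtain q where q: "q \<le> 0" "gX (m + 1) = (q, - of_bool (even m), of_bool (even m) - 1 - q)" "2 * q - of_bool (even m) = m + 1"
    using gX_neg[of "m + 1"] m by auto
  have r: "p + 1 \<le> 0" "gX (m + 2) = (p + 1, - of_bool (odd m), of_bool (odd m) - 2 - p)"
    using gX_neg[of "m + 2"] m p by auto
  define E where "E = (if even m then int a + int c else int b)"
  define \<alpha> where "\<alpha> = int a * p + int b * q + int c * (p + 1)"
  let ?N = "int a + int b + int c"
  have g: "GA m a b c = (\<alpha>, E - ?N, - E - \<alpha>)"
    unfolding GA_def p(2) q(2) r(2) by (simp add: E_def \<alpha>_def algebra_simps)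
  have nn: "\<alpha> \<le> 0" "E \<le> ?N"
    using p(1) q(1) r(1) by (simp_all add: \<alpha>_def E_def mult_nonneg_nonpos add_nonpos_nonpos)
  have "2 * \<alpha> + (E - ?N)
      = int a * (2 * p - of_bool (odd m)) + int b * (2 * q - of_bool (even m)) + int c * (2 * p - of_bool (odd m) + 2)"
    by (simp add: \<alpha>_def E_def algebra_simps)
  also have "\<dots> = m * ?N + int b + 2 * int c"
    unfolding p(3) q(3) by (simp add: algebra_simps)
  finally have "shape (- 1) ?N E (2 * \<alpha> + (E - ?N)) (EA m a b c)"
    unfolding shape_def E_def by (intro disjI1 exI[of _ m] exI[of _ a] exI[of _ b] exI[of _ c]) simp
  then show ?thesis
    unfolding g by (rule canon_negI[rotated]) (use nn N in simp_all)
qed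

lemma canon_1: "canon 0 1 0"
  by (auto simp: canon_def nonbridging_def zero_prod_def intro: exI[of _ 0])

lemma canon_EA: "canon 0 (EA m a b c) (GA m a b c)"
proof (cases "a + b + c = 0")
  case True
  then show ?thesis
    using canon_1 by (simp add: EA_def GA_def)
next
  case False
  have "1 \<le> m \<or> m \<le> - 2 \<or> m = 0 \<or> m = - 1"
    by linarith
  then show ?thesis
  proof (elim disjE)
    assume "1 \<le> m"
    then show ?thesis
      using False by (intro canon_EA_pos) auto
  next
    assume "m \<le> - 2"
    then show ?thesis
      using False by (intro canon_EA_neg) auto
  next
    assume m: "m = 0"
    \<comment> \<open>If only one kind of bridging variable occurs, the monomial is rewritten with a
      starting index on one side of the break.\<close>
    consider "a = 0" | "b + c = 0" "a \<ge> 1" | "1 \<le> a" "1 \<le> b + c"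
      by linarith
    then show ?thesis
    proof cases
      case 1
      then show ?thesis
        using canon_EA_pos[of 1 b c 0] False by (simp add: m EA_def GA_def)
    next
      case 2
      then show ?thesis
        using canon_EA_neg[of "- 2" 0 0 a] by (simp add: m EA_def GA_def)
    next
      case 3
      moreover have "GA 0 a b c = (int b, int c, - int a)"
        by (simp add: GA_def gX_def xdeg_def)
      ultimately show ?thesis
        by (auto simp: m canon_def mixed_def)
    qed
  next
    assume m: "m = - 1"
    consider "a + b = 0" | "c = 0" | "1 \<le> a + b" "1 \<le> c"
      by linarith
    then show ?thesis
    proof cases
      case 1
      then show ?thesis
        using canon_EA_pos[of 1 c 0 0] False by (simp add: m EA_def GA_def)
    next
      case 2
      then show ?thesis
        using canon_EA_neg[of "- 2" 0 a b] False by (simp add: m EA_def GA_def)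
    next
      case 3
      moreover have "GA (- 1) a b c = (int c, - int a, - int b)"
        by (simp add: GA_def gX_def xdeg_def)
      ultimately show ?thesis
        by (auto simp: m canon_def mixed_def)
    qed
  qed
qed

lemma canon_EB_pos:
  assumes m: "1 \<le> m" and N: "1 \<le> a + c" "1 \<le> k"
  shows "canon 0 (EB m a k c) (GB m a k c)"
proof -
  obtain p where p: "0 \<le> p" "gX m = (1 - of_bool (even m) - p, of_bool (even m), p)" "2 * p + of_bool (even m) + 1 = m"
    using gX_pos[OF m] by blast
  have r: "gX (m + 2) = (- of_bool (even m) - p, of_bool (even m), p + 1)"
    using gX_pos[of "m + 2"] m p by auto
  let ?N = "int a + int c"
  define \<beta> where "\<beta> = (if even m then ?N + int k else - int k)"
  define \<gamma> where "\<gamma> = int a * p + int c * (p + 1) + of_bool (odd m) * int k"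
  have g: "GB m a k c = (?N - \<beta> - \<gamma>, \<beta>, \<gamma>)"
    by (simp add: GB_def p(2) r gV_def \<beta>_def \<gamma>_def algebra_simps)
  have nn: "0 \<le> \<gamma>" "0 \<le> \<gamma> + \<beta>"
    using p(1) by (simp_all add: \<gamma>_def \<beta>_def)
  have "2 * \<gamma> + \<beta> + ?N = int a * (2 * p + of_bool (even m) + 1) + int c * (2 * p + of_bool (even m) + 1 + 2) + int k"
    by (simp add: \<gamma>_def \<beta>_def algebra_simps)
  also have "\<dots> = m * ?N + 2 * int c + 1 * int k"
    unfolding p(3) by (simp add: algebra_simps)
  finally have "shape 1 ?N \<beta> (2 * \<gamma> + \<beta> + ?N) (EB m a k c)"
    unfolding shape_def \<beta>_def using N(2)
    by (intro disjI2 exI[of _ m] exI[of _ a] exI[of _ k] exI[of _ c]) simp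
  then show ?thesis
    unfolding g by (rule canon_posI[rotated]) (use nn N in simp_all)
qed

lemma canon_EB_neg:
  assumes m: "m \<le> - 2" and N: "1 \<le> a + c" "1 \<le> k"
  shows "canon 0 (EB m a k c) (GB m a k c)"
proof -
  obtain p where p: "p \<le> 0" "gX m = (p, - of_bool (odd m), of_bool (odd m) - 1 - p)" "2 * p - of_bool (odd m) = m"
    using gX_neg[of m] m by auto
  have r: "p + 1 \<le> 0" "gX (m + 2) = (p + 1, - of_bool (odd m), of_bool (odd m) - 2 - p)"
    using gX_neg[of "m + 2"] m p by auto
  let ?N = "int a + int c"
  define E where "E = (if even m then ?N + int k else - int k)"
  define \<alpha> where "\<alpha> = int a * p + int c * (p + 1) - of_bool (even m) * int k"
  have g: "GB m a k c = (\<alpha>, E - ?N, - E - \<alpha>)"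
    by (simp add: GB_def p(2) r(2) gV_def E_def \<alpha>_def algebra_simps)
  have "int a * p \<le> 0" "int c * (p + 1) \<le> 0"
    using p(1) r(1) by (simp_all add: mult_nonneg_nonpos)
  then have nn: "\<alpha> \<le> 0" "\<alpha> + (E - ?N) \<le> 0"
    by (simp_all add: \<alpha>_def E_def)
  have "2 * \<alpha> + (E - ?N) = int a * (2 * p - of_bool (odd m)) + int c * (2 * p - of_bool (odd m) + 2) - int k"
    by (simp add: \<alpha>_def E_def algebra_simps)
  also have "\<dots> = m * ?N + 2 * int c + - 1 * int k"
    unfolding p(3) by (simp add: algebra_simps)
  finally have "shape (- 1) ?N E (2 * \<alpha> + (E - ?N)) (EB m a k c)"
    unfolding shape_def E_def using N(2)
    by (intro disjI2 exI[of _ m] exI[of _ a] exI[of _ k] exI[of _ c]) simp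
  then show ?thesis
    unfolding g by (rule canon_negI[rotated]) (use nn N in simp_all)
qed

lemma V_power_aX: "V (m + 1) ^ k * aX m ^ a = aX m ^ a * V (m + 1) ^ k"
  using aX_V_commute[of m] by (metis power_commuting_commutes)

lemma canon_EB: "canon 0 (EB m a k c) (GB m a k c)"
proof -
  consider "k = 0" | "1 \<le> k" "a + c = 0" | "1 \<le> k" "1 \<le> a + c"
    by linarith
  then show ?thesis
  proof cases
    case 1
    then show ?thesis
      using canon_EA[of m a 0 c] by (simp add: EA_def EB_def GA_def GB_def)
  next
    case 2
    then show ?thesis
      by (auto simp: EB_def GB_def V_def gV_def canon_def nonbridging_def zero_prod_def)
  next
    case 3
    note out = 3
    have "1 \<le> m \<or> m \<le> - 2 \<or> m = 0 \<or> m = - 1"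
      by linarith
    then show ?thesis
    proof (elim disjE)
      assume "1 \<le> m"
      then show ?thesis
        using 3 by (intro canon_EB_pos) auto
    next
      assume "m \<le> - 2"
      then show ?thesis
        using 3 by (intro canon_EB_neg) auto
    next
      assume m: "m = 0"
      consider "a = 0" "1 \<le> c" | "c = 0" "1 \<le> a" | "1 \<le> a" "1 \<le> c"
        using out by linarith
      then show ?thesis
      proof cases
        case 1
        have "V 3 = V 1" "gV 3 = gV 1"
          by (simp_all add: V_def gV_def)
        then show ?thesis
          using 1 out canon_EB_pos[of 2 c 0 k] V_power_aX[of 2 k c] by (simp add: m EB_def GB_def add.commute)
      next
        case 2
        have "V (- 1) = V 1" "gV (- 1) = gV 1"
          by (simp_all add: V_def gV_def)
        then show ?thesis
          using 2 out canon_EB_neg[of "- 2" 0 a k] V_power_aX[of 0 k a] by (simp add: m EB_def GB_def add.commute)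
      next
        case 3
        moreover have "GB 0 a k c = (- int k, int k + int c, - int a)"
          by (simp add: GB_def gX_def xdeg_def gV_def)
        ultimately show ?thesis
          using out by (auto simp: m canon_def mixed_def)
      qed
    next
      assume m: "m = - 1"
      consider "a = 0" "1 \<le> c" | "c = 0" "1 \<le> a" | "1 \<le> a" "1 \<le> c"
        using out by linarith
      then show ?thesis
      proof cases
        case 1
        have "V 2 = V 0" "gV 2 = gV 0"
          by (simp_all add: V_def gV_def)
        then show ?thesis
          using 1 out canon_EB_pos[of 1 c 0 k] V_power_aX[of 1 k c] by (simp add: m EB_def GB_def add.commute)
      next
        case 2
        have "V (- 2) = V 0" "gV (- 2) = gV 0"
          by (simp_all add: V_def gV_def)
        then show ?thesis
          using 2 out canon_EB_neg[of "- 3" 0 a k] V_power_aX[of "- 1" k a] by (simp add: m EB_def GB_def add.commute)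
      next
        case 3
        moreover have "GB (- 1) a k c = (int c, - int a - int k, int k)"
          by (simp add: GB_def gX_def xdeg_def gV_def)
        ultimately show ?thesis
          using out by (auto simp: m canon_def mixed_def)
      qed
    qed
  qed
qed

lemma canon_cword: "canon 0 (awval (cword C a b c)) (gw (cword C a b c))"
  using canon_EA canon_EB by (cases C) (simp_all add: awval_cword gw_cword GA_def GB_def)

lemma canon_U: "canon n (awval (LU n # replicate k LW)) (gw (LU n # replicate k LW))"
    "canon n (awval (LU n # replicate k LZ)) (gw (LU n # replicate k LZ))"
  by (auto simp: canon_def nonbridging_def)

lemma canon_basic:
  assumes "basic W"
  shows "\<exists>n. canon n (awval W) (gw W)"
  using basic_normal_form[OF assms] awval_perm[OF assms] gw_perm[of W] canon_cword canon_U
  by metis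

lemma basic_eq: "basic W \<Longrightarrow> basic W' \<Longrightarrow> gw W = gw W' \<Longrightarrow> awval W = awval W'"
  using canon_basic canon_unique by metis

section \<open>Linear independence\<close>

lemma qmon_exhaust6: obtains l a b c d e f where "m = QMon l (a, b, c, d, e, f)"
  by (metis qmon.exhaust prod.exhaust)

lemma plus_qmon_right_cancel: "m + k = n + k \<longleftrightarrow> m = n" for m n k :: qmon
proof -
  obtain l a1 a2 a3 a4 a5 a6 where "m = QMon l (a1, a2, a3, a4, a5, a6)"
    by (rule qmon_exhaust6)
  moreover obtain l' b1 b2 b3 b4 b5 b6 where "n = QMon l' (b1, b2, b3, b4, b5, b6)"
    by (rule qmon_exhaust6)
  moreover obtain l'' c1 c2 c3 c4 c5 c6 where "k = QMon l'' (c1, c2, c3, c4, c5, c6)"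
    by (rule qmon_exhaust6)
  ultimately show ?thesis
    by (auto simp: plus_qmon_def Lambda_expand)
qed

lemma lookup_mult_single_right:
  "Poly_Mapping.lookup (p * Poly_Mapping.single k 1) (m + k) = Poly_Mapping.lookup p m" for p :: qtorus
proof (rule frag_induction[of p UNIV])
  fix n
  show "Poly_Mapping.lookup (frag_of n * Poly_Mapping.single k 1) (m + k) = Poly_Mapping.lookup (frag_of n) m"
    by (auto simp: mult_single lookup_single plus_qmon_right_cancel when_def)
qed (simp_all add: left_diff_distrib lookup_minus)

definition lkey :: "z3 \<Rightarrow> qmon" where
  "lkey g = (case g of (a, b, c) \<Rightarrow> QMon 0 (a, b, c, 0, 0, 0))"

lemma Xlow_single: "Xlow g = Poly_Mapping.single (lkey g) 1"
  by (simp add: Xlow_def lkey_def Xm_def split: prod.split)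

lemma ydeg_lkey: "ydeg (lkey g) = 0"
  by (simp add: lkey_def split: prod.split)

lemma coeff_mons_lkey: "m \<in> coeff_mons \<Longrightarrow> n \<in> coeff_mons \<Longrightarrow> m + lkey g = n + lkey h \<Longrightarrow> g = h"
  by (auto simp: coeff_mons_def lkey_def plus_qmon_def split: prod.splits)

lemma yge_lookup: "t \<in> yge n \<Longrightarrow> ydeg k < n \<Longrightarrow> Poly_Mapping.lookup t k = 0"
proof (rule ccontr)
  assume "t \<in> yge n" "ydeg k < n" "Poly_Mapping.lookup t k \<noteq> 0"
  moreover from this have "k \<in> Poly_Mapping.keys t"
    by (simp add: in_keys_iff)
  ultimately show False
    by (force simp: yge_def)
qed

lemma yge_0: "0 \<in> yge n"
  by (simp add: yge_def)

lemma yge_sum: "(\<And>i. i \<in> I \<Longrightarrow> f i \<in> yge n) \<Longrightarrow> sum f I \<in> yge n"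
  by (induction I rule: infinite_finite_induct) (simp_all add: yge_0 yge_add)

text \<open>Compare the parts of lowest degree in \<open>y\<^sub>1, y\<^sub>2, y\<^sub>3\<close>.\<close>

lemma pointed_independent:
  assumes fin: "finite I"
    and p: "\<And>i. i \<in> I \<Longrightarrow> p i \<in> ZP" and t: "\<And>i. i \<in> I \<Longrightarrow> pointed (t i) (g i)" and inj: "inj_on g I"
    and sum: "(\<Sum>i\<in>I. p i * t i) = 0"
  shows "\<forall>i\<in>I. p i = 0"
proof (rule ccontr)
  assume "\<not> (\<forall>i\<in>I. p i = 0)"
  then obtain i1 where i1: "i1 \<in> I" "p i1 \<noteq> 0"
    by blast
  define K where "K = (\<Union>i\<in>I. Poly_Mapping.keys (p i))"
  have "finite K" "K \<noteq> {}"
    using fin i1 by (auto simp: K_def)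
  then obtain k0 where k0: "k0 \<in> K" "\<And>k. k \<in> K \<Longrightarrow> ydeg k0 \<le> ydeg k"
    using ex_min_if_finite[of "ydeg ` K"] by (metis (mono_tags, lifting) arg_min_if_finite(1,2) linorder_not_le)
  then obtain i0 where i0: "i0 \<in> I" "k0 \<in> Poly_Mapping.keys (p i0)"
    by (auto simp: K_def)
  let ?d = "ydeg k0"
  have pd: "p i \<in> yge ?d" if "i \<in> I" for i
    using k0(2) that by (auto simp: yge_def K_def)
  have "(\<Sum>i\<in>I. p i * Xlow (g i)) = (\<Sum>i\<in>I. p i * t i) - (\<Sum>i\<in>I. p i * (t i - Xlow (g i)))"
    by (simp add: right_diff_distrib sum_subtractf)
  also have "\<dots> = 0 - (\<Sum>i\<in>I. p i * (t i - Xlow (g i)))"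
    by (simp only: sum)
  also have "\<dots> \<in> yge (?d + 1)"
    using yge_mult[OF pd] t by (intro yge_diff yge_sum yge_0) (auto simp: pointed_def)
  finally have "Poly_Mapping.lookup (\<Sum>i\<in>I. p i * Xlow (g i)) (k0 + lkey (g i0)) = 0"
    by (rule yge_lookup) (simp add: ydeg_add ydeg_lkey)
  moreover have "Poly_Mapping.lookup (p i * Xlow (g i)) (k0 + lkey (g i0)) = (if i = i0 then Poly_Mapping.lookup (p i0) k0 else 0)"
    if i: "i \<in> I" for i
  proof (cases "i = i0")
    case True
    then show ?thesis
      by (simp add: Xlow_single lookup_mult_single_right)
  next
    case False
    \<comment> \<open>Coefficients involve only the y's, so the first three exponents of any key of
      this product are those of \<open>g i\<close>; different indices contribute disjoint
      keys.\<close>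
    have "k0 + lkey (g i0) \<notin> Poly_Mapping.keys (p i * Xlow (g i))"
    proof
      assume "k0 + lkey (g i0) \<in> Poly_Mapping.keys (p i * Xlow (g i))"
      then obtain k where k: "k \<in> Poly_Mapping.keys (p i)" "k0 + lkey (g i0) = k + lkey (g i)"
        using keys_mult[of "p i" "Xlow (g i)"] by (auto simp: Xlow_single)
      have "k0 \<in> coeff_mons" "k \<in> coeff_mons"
        using p[OF i0(1)] p[OF i] i0(2) k(1) by (auto simp: ZP_def)
      then have "g i0 = g i"
        using k(2) by (rule coeff_mons_lkey)
      with inj i i0(1) False show False
        by (auto dest: inj_onD)
    qed
    with False show ?thesis
      by (simp add: in_keys_iff)
  qed
  ultimately have "Poly_Mapping.lookup (p i0) k0 = 0"
    using fin i0(1) by (simp add: lookup_sum)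
  with i0(2) show False
    by (simp add: in_keys_iff)
qed

lemma pointed_unique:
  assumes "pointed t g" "pointed t h"
  shows "g = h"
proof -
  have "Xlow g - Xlow h \<in> yge 1"
    using yge_diff[of "t - Xlow h" 1 "t - Xlow g"] assms by (simp add: pointed_def)
  then have "Poly_Mapping.lookup (Xlow g - Xlow h) (lkey g) = 0"
    by (rule yge_lookup) (simp add: ydeg_lkey)
  then show ?thesis
    by (auto simp: Xlow_single lookup_minus lookup_single when_def lkey_def split: prod.splits if_splits)
qed

section \<open>Coefficients\<close>

lemma ZP_0: "0 \<in> ZP" and ZP_add: "p \<in> ZP \<Longrightarrow> q \<in> ZP \<Longrightarrow> p + q \<in> ZP"
    and ZP_diff: "p \<in> ZP \<Longrightarrow> q \<in> ZP \<Longrightarrow> p - q \<in> ZP"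
  using keys_add[of p q] keys_diff[of p q] by (auto simp: ZP_def)

lemma coeff_mons_add: "m \<in> coeff_mons \<Longrightarrow> n \<in> coeff_mons \<Longrightarrow> m + n \<in> coeff_mons"
  by (auto simp: coeff_mons_def plus_qmon_def)

lemma ZP_mult: "p \<in> ZP \<Longrightarrow> q \<in> ZP \<Longrightarrow> p * q \<in> ZP"
  using keys_mult[of p q] coeff_mons_add by (fastforce simp: ZP_def)

lemma mon_ZP: "mon l \<gamma> \<in> ZP_nonneg" "mon l \<gamma> \<in> ZP"
  by (cases \<gamma>; auto simp: mon_def ZP_def ZP_nonneg_def coeff_mons_def lookup_single when_def)+

lemma ZP_1: "1 \<in> ZP"
  using mon_ZP(2)[of 0 0] by simp

lemma ZP_nonneg_0: "0 \<in> ZP_nonneg" and ZP_nonneg_add: "p \<in> ZP_nonneg \<Longrightarrow> q \<in> ZP_nonneg \<Longrightarrow> p + q \<in> ZP_nonneg"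
  using ZP_0 ZP_add[of p q] by (auto simp: ZP_nonneg_def lookup_add)

text \<open>Scalars do not commute with basis elements, but homogeneous elements carry right
  multiples by scalars into left multiples. Hence the left span of the basis can be closed under
  products.\<close>

lemma homog_past_ZP:
  assumes "homog t d" "p \<in> ZP"
  shows "\<exists>q\<in>ZP. t * p = q * t"
proof (rule frag_induction[of p coeff_mons])
  show "Poly_Mapping.keys p \<subseteq> coeff_mons"
    using assms(2) by (simp add: ZP_def)
  fix m assume "m \<in> coeff_mons"
  then obtain l a b c where "frag_of m = mon l (a, b, c)"
    by (auto simp: coeff_mons_def mon_def)
  then show "\<exists>q\<in>ZP. t * frag_of m = q * t"
    using homog_right[OF assms(1)] mon_ZP by metis
next
  show "\<exists>q\<in>ZP. t * 0 = q * t"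
    using ZP_0 by (intro bexI[of _ 0]) simp_all
next
  fix a b assume "\<exists>q\<in>ZP. t * a = q * t" "\<exists>q\<in>ZP. t * b = q * t"
  then obtain q r where "q \<in> ZP" "r \<in> ZP" "t * a = q * t" "t * b = r * t"
    by blast
  then show "\<exists>q\<in>ZP. t * (a - b) = q * t"
    by (intro bexI[of _ "q - r"] ZP_diff) (simp_all add: left_diff_distrib right_diff_distrib)
qed

lemma aval_lval: "\<exists>l \<gamma>. aval s = mon l \<gamma> * lval s"
proof (cases s)
  case (LX m)
  show ?thesis
    unfolding LX aval.simps lval.simps aX_def by blast
qed (auto intro!: exI[of _ 0] simp: zero_prod_def[symmetric] simp del: split_paired_Ex)

text \<open>Rewriting uses the \<open>x m\<close>, the basis the \<open>aX m\<close>; words in the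
  two differ by an invertible coefficient monomial, so nonnegative expansions carry over.\<close>

lemma awval_wval: "\<exists>l \<gamma>. awval W = mon l \<gamma> * wval W"
proof (induction W)
  case Nil
  show ?case
    by (intro exI[of _ 0]) simp
next
  case (Cons s W)
  then obtain l \<gamma> where 1: "awval W = mon l \<gamma> * wval W"
    by blast
  obtain l' \<gamma>' where 2: "aval s = mon l' \<gamma>' * lval s"
    using aval_lval by blast
  have "awval (s # W) = mon l' \<gamma>' * (lval s * (mon l \<gamma> * wval W))"
    by (simp add: 1 2 mult.assoc)
  also have "\<dots> = mon l' \<gamma>' * mon (l - 2 * dot \<gamma> (ldeg s)) \<gamma> * wval (s # W)"
    by (simp add: homog_right_assoc[OF homog_lval] mult.assoc)
  finally show ?case
    unfolding mon_mult by blast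
qed

lemma wval_awval: "\<exists>l \<gamma>. wval W = mon l \<gamma> * awval W"
proof -
  obtain l \<gamma> where "awval W = mon l \<gamma> * wval W"
    using awval_wval by blast
  then have "mon (- l) (- \<gamma>) * awval W = wval W"
    by (simp add: mon_mult_assoc)
  then show ?thesis
    by metis
qed

lemma homog_awval: "\<exists>d. homog (awval W) d"
  by (induction W) (auto intro: homog_1 homog_mult homog_aval simp del: split_paired_Ex)

lemma awval_mult_pcone: "awval W * awval W' \<in> pcone {W. basic W}"
proof -
  obtain l \<gamma> l' \<gamma>' where "awval W = mon l \<gamma> * wval W" "awval W' = mon l' \<gamma>' * wval W'"
    using awval_wval by metis
  then have "awval W * awval W' = mon l \<gamma> * (mon (l' - 2 * dot \<gamma>' (sum_list (map ldeg W))) \<gamma>' * wval (W @ W'))"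
    by (simp add: mult.assoc homog_right_assoc[OF homog_wval])
  then show ?thesis
    by (simp only: pcone_mon wval_pcone)
qed

section \<open>The basis\<close>

context
  fixes \<iota> :: "qtorus \<Rightarrow> 'f::division_ring"
  assumes frac: "skew_field_of_fractions \<iota>"
begin

lemmas emb_simps = emb_0[OF frac] emb_1[OF frac] emb_add[OF frac] emb_mult[OF frac] emb_power[OF frac]

lemma emb_sum: "\<iota> (sum f I) = (\<Sum>i\<in>I. \<iota> (f i))"
  by (induction I rule: infinite_finite_induct) (simp_all add: emb_simps)

lemma emb_diff: "\<iota> (a - b) = \<iota> a - \<iota> b"
  using emb_add[OF frac, of "a - b" b] by (simp add: algebra_simps)

lemma emb_uminus: "\<iota> (- a) = - \<iota> a"
  using emb_diff[of 0 a] by (simp add: emb_simps)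

lemma cluster_mono_word:
  assumes "realizes \<iota> S C \<pi>"
  shows "svar S 1 ^ a * svar S 2 ^ b * svar S 3 ^ c
    = \<iota> (awval (replicate a (clt C (\<pi> 1)) @ replicate b (clt C (\<pi> 2)) @ replicate c (clt C (\<pi> 3))))"
  using realizesD(7)[OF frac assms, of 1] realizesD(7)[OF frac assms, of 2] realizesD(7)[OF frac assms, of 3]
  by (simp add: emb_simps mult.assoc)

lemma cluster_monomials_eq: "cluster_monomials \<iota> = {\<iota> (awval (cword C a b c)) | C a b c. True}"
proof (intro subset_antisym subsetI)
  fix y assume "y \<in> cluster_monomials \<iota>"
  then obtain S a b c where S: "S \<in> seeds \<iota>" and y: "y = svar S 1 ^ a * svar S 2 ^ b * svar S 3 ^ c"
    by (auto simp: cluster_monomials_def)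
  obtain C \<pi> where R: "realizes \<iota> S C \<pi>"
    using seed_realizes[OF frac S] by blast
  let ?W = "replicate a (clt C (\<pi> 1)) @ replicate b (clt C (\<pi> 2)) @ replicate c (clt C (\<pi> 3))"
  have \<pi>: "\<pi> 1 \<in> {1, 2, 3}" "\<pi> 2 \<in> {1, 2, 3}" "\<pi> 3 \<in> {1, 2, 3}"
    using bij_betw_apply[OF realizesD(1)[OF frac R]] by simp_all
  have sub: "set ?W \<subseteq> {clt C 1, clt C 2, clt C 3}"
    using \<pi> by (auto split: if_splits)
  have basic: "basic ?W"
  proof (rule basicI)
    fix s t assume "s \<in> set ?W" "t \<in> set ?W"
    then have "s \<in> clt C ` {1, 2, 3}" "t \<in> clt C ` {1, 2, 3}"
      using sub by blast+
    then show "compat s t"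
      using clt_compat by blast
  qed
  obtain a' b' c' where "mset ?W = mset (cword C a' b' c')"
    using basic_three_letters[OF basic sub] by blast
  then have "y = \<iota> (awval (cword C a' b' c'))"
    using awval_perm[OF basic] cluster_mono_word[OF R] y by metis
  then show "y \<in> {\<iota> (awval (cword C a b c)) | C a b c. True}"
    by blast
next
  fix y assume "y \<in> {\<iota> (awval (cword C a b c)) | C a b c. True}"
  then obtain C a b c where y: "y = \<iota> (awval (cword C a b c))"
    by blast
  obtain S \<pi> where S: "S \<in> seeds \<iota>" and R: "realizes \<iota> S C \<pi>"
    using cluster_realized[OF frac] by blast
  define e where "e p = (if p = 1 then int a else if p = 2 then int b else int c)" for p :: nat
  have "cprod C e = awval (cword C a b c)"
    by (simp add: cprod_def e_def cword_def mult.assoc)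
  with cprod_perm[OF frac R, of e] y
  have "y = svar S 1 ^ nat (e (\<pi> 1)) * svar S 2 ^ nat (e (\<pi> 2)) * svar S 3 ^ nat (e (\<pi> 3))"
    using realizesD(7)[OF frac R, of 1] realizesD(7)[OF frac R, of 2] realizesD(7)[OF frac R, of 3]
    by (simp flip: emb_mult[OF frac] emb_power[OF frac])
  with S show "y \<in> cluster_monomials \<iota>"
    unfolding cluster_monomials_def by blast
qed

lemma uwz_eq: "uwz_elements \<iota> = {\<iota> (awval (LU n # replicate k s)) | n k s. 1 \<le> n \<and> (s = LW \<or> s = LZ)}"
proof -
  have "{\<iota> (awval (LU n # replicate k s)) | n k s. 1 \<le> n \<and> (s = LW \<or> s = LZ)}
    = {\<iota> (awval (LU n # replicate k LW)) | n k. n \<ge> 1} \<union> {\<iota> (awval (LU n # replicate k LZ)) | n k. n \<ge> 1}"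
    by blast
  then show ?thesis
    unfolding uwz_elements_def by (simp only: awval_simps awval_replicate aval.simps)
qed

lemma basic_cword: "basic (cword C a b c)"
proof (rule basicI)
  fix s t assume "s \<in> set (cword C a b c)" "t \<in> set (cword C a b c)"
  then have "s \<in> clt C ` {1, 2, 3}" "t \<in> clt C ` {1, 2, 3}"
    by (auto simp: cword_def split: if_splits)
  then show "compat s t"
    using clt_compat by blast
qed

lemma basic_replicate: "compat s s \<Longrightarrow> basic (replicate k s)"
  by (rule basicI) (auto split: if_splits)

lemma basic_U: "s = LW \<or> s = LZ \<Longrightarrow> basic (LU n # replicate k s)"
  using basic_replicate[of s k] by (auto simp: basic_def split: if_splits)

lemma B_set_eq: "B_set \<iota> = {\<iota> (awval W) | W. basic W}"
proof (intro subset_antisym subsetI)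
  fix y assume "y \<in> B_set \<iota>"
  then show "y \<in> {\<iota> (awval W) | W. basic W}"
    unfolding B_set_def cluster_monomials_eq uwz_eq using basic_cword basic_U by blast
next
  fix y assume "y \<in> {\<iota> (awval W) | W. basic W}"
  then obtain W where W: "basic W" "y = \<iota> (awval W)"
    by blast
  have "\<iota> (awval (LU n # replicate k s)) \<in> B_set \<iota>" if s: "s = LW \<or> s = LZ" for n k s
  proof (cases "n = 0")
    case True
    \<comment> \<open>For n = 0 the word is a power of w or z, hence a cluster monomial:
      \<open>CB 1\<close> contains w and \<open>CB 0\<close> contains z.\<close>
    have "\<iota> (awval (cword (CB (if s = LW then 1 else 0)) 0 k 0)) \<in> B_set \<iota>"
      unfolding B_set_def cluster_monomials_eq by blast
    then show ?thesis
      using s True by (auto simp: cword_def V_def)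
  next
    case False
    then have "1 \<le> n"
      by simp
    then show ?thesis
      unfolding B_set_def uwz_eq using s by blast
  qed
  moreover have "\<iota> (awval (cword C a b c)) \<in> B_set \<iota>" for C a b c
    unfolding B_set_def cluster_monomials_eq by blast
  ultimately show "y \<in> B_set \<iota>"
    using basic_normal_form[OF W(1)] awval_perm[OF W(1)] W(2) by metis
qed

text \<open>The leading exponent also determines the index of the factor u_n, which is 0 for a
  cluster monomial.\<close>

lemma monomials_disjoint: "cluster_monomials \<iota> \<inter> uwz_elements \<iota> = {}"
proof (rule ccontr)
  assume "cluster_monomials \<iota> \<inter> uwz_elements \<iota> \<noteq> {}"
  then obtain C a b c n k s where n: "1 \<le> n" and s: "s = LW \<or> s = LZ"
      and "\<iota> (awval (cword C a b c)) = \<iota> (awval (LU n # replicate k s))"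
    unfolding cluster_monomials_eq uwz_eq by blast
  then have eq: "awval (cword C a b c) = awval (LU n # replicate k s)"
    by (simp only: emb_eq[OF frac])
  have "gw (cword C a b c) = gw (LU n # replicate k s)"
    using pointed_unique pointed_awval eq by metis
  moreover have "canon n (awval (LU n # replicate k s)) (gw (LU n # replicate k s))"
    using s canon_U by blast
  ultimately have "0 = n"
    using canon_cword[of C a b c] canon_unique by metis
  with n show False
    by simp
qed

lemma bar_fixed_B: "b \<in> B_set \<iota> \<Longrightarrow> bar_fixed \<iota> b"
  unfolding B_set_eq bar_fixed_def using bar_awval_basic by blast

text \<open>The set of admissible coefficients is a parameter, so that the same closure properties
  serve spanning (\<open>ZP\<close>) and positivity (\<open>ZP_nonneg\<close>).\<close>

definition combs :: "qtorus set \<Rightarrow> 'f set" where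
  "combs P = {lincomb \<iota> c | c. Poly_Mapping.keys c \<subseteq> B_set \<iota> \<and> (\<forall>b. Poly_Mapping.lookup c b \<in> P)}"

lemma lincomb_superset:
  assumes "finite F" "Poly_Mapping.keys c \<subseteq> F"
  shows "lincomb \<iota> c = (\<Sum>b\<in>F. \<iota> (Poly_Mapping.lookup c b) * b)"
  unfolding lincomb_def using assms
  by (intro sum.mono_neutral_left) (auto simp: in_keys_iff emb_simps)

lemma lincomb_add: "lincomb \<iota> (c + d) = lincomb \<iota> c + lincomb \<iota> d"
proof -
  let ?F = "Poly_Mapping.keys c \<union> Poly_Mapping.keys d"
  have "lincomb \<iota> (c + d) = (\<Sum>b\<in>?F. \<iota> (Poly_Mapping.lookup (c + d) b) * b)"
    using keys_add[of c d] by (intro lincomb_superset) auto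
  moreover have "lincomb \<iota> c = (\<Sum>b\<in>?F. \<iota> (Poly_Mapping.lookup c b) * b)"
      "lincomb \<iota> d = (\<Sum>b\<in>?F. \<iota> (Poly_Mapping.lookup d b) * b)"
    by (intro lincomb_superset; simp)+
  ultimately show ?thesis
    by (simp add: lookup_add emb_simps distrib_right sum.distrib)
qed

lemma lincomb_diff: "lincomb \<iota> (c - d) = lincomb \<iota> c - lincomb \<iota> d"
  using lincomb_add[of "c - d" d] by (simp add: algebra_simps)

lemma combs_add:
  assumes P: "\<And>p q. p \<in> P \<Longrightarrow> q \<in> P \<Longrightarrow> p + q \<in> P" and "y \<in> combs P" "y' \<in> combs P"
  shows "y + y' \<in> combs P"
proof -
  obtain c d where "y = lincomb \<iota> c" "y' = lincomb \<iota> d" "Poly_Mapping.keys c \<subseteq> B_set \<iota>" "Poly_Mapping.keys d \<subseteq> B_set \<iota>"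
      "\<forall>b. Poly_Mapping.lookup c b \<in> P" "\<forall>b. Poly_Mapping.lookup d b \<in> P"
    using assms(2,3) unfolding combs_def by blast
  then show ?thesis
    unfolding combs_def using keys_add[of c d] P
    by (intro CollectI exI[of _ "c + d"]) (auto simp: lincomb_add lookup_add)
qed

lemma combs_scaled: "0 \<in> P \<Longrightarrow> p \<in> P \<Longrightarrow> b \<in> B_set \<iota> \<Longrightarrow> \<iota> p * b \<in> combs P"
proof -
  assume "0 \<in> P" "p \<in> P" "b \<in> B_set \<iota>"
  moreover have "lincomb \<iota> (Poly_Mapping.single b p) = \<iota> p * b"
    by (cases "p = 0") (simp_all add: lincomb_def emb_simps)
  ultimately show ?thesis
    unfolding combs_def
    by (intro CollectI exI[of _ "Poly_Mapping.single b p"]) (auto simp: lookup_single when_def)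
qed

lemma combs_0: "0 \<in> P \<Longrightarrow> 0 \<in> combs P"
  unfolding combs_def by (intro CollectI exI[of _ 0]) (simp add: lincomb_def)

lemma pcone_combs: "t \<in> pcone {W. basic W} \<Longrightarrow> \<iota> t \<in> combs ZP_nonneg"
proof (induction rule: pcone.induct)
  case zero
  then show ?case
    by (simp add: emb_simps combs_0 ZP_nonneg_0)
next
  case (step t W l \<gamma>)
  obtain l' \<gamma>' where "wval W = mon l' \<gamma>' * awval W"
    using wval_awval by blast
  then have eq: "\<iota> (mon l \<gamma> * wval W) = \<iota> (mon (l + l' + yform \<gamma> \<gamma>') (\<gamma> + \<gamma>')) * \<iota> (awval W)"
    by (simp only: mon_mult_assoc emb_mult[OF frac])
  have "\<iota> (mon l \<gamma> * wval W) \<in> combs ZP_nonneg"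
    unfolding eq using step(2) by (intro combs_scaled ZP_nonneg_0 mon_ZP) (auto simp: B_set_eq)
  with step show ?case
    by (simp only: emb_add[OF frac] combs_add ZP_nonneg_add)
qed

lemma B_mult: "b \<in> B_set \<iota> \<Longrightarrow> b' \<in> B_set \<iota> \<Longrightarrow> b * b' \<in> combs ZP_nonneg"
  unfolding B_set_eq using pcone_combs[OF awval_mult_pcone] by (auto simp: emb_simps)

lemma combs_mono: "P \<subseteq> Q \<Longrightarrow> combs P \<subseteq> combs Q"
  unfolding combs_def by blast

lemma combs_sum: "(\<And>i. i \<in> I \<Longrightarrow> f i \<in> combs ZP) \<Longrightarrow> sum f I \<in> combs ZP"
  by (induction I rule: infinite_finite_induct) (simp_all add: combs_0 ZP_0 combs_add ZP_add)

lemma combs_scale: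
  assumes "p \<in> ZP" "y \<in> combs ZP"
  shows "\<iota> p * y \<in> combs ZP"
proof -
  obtain c where c: "y = lincomb \<iota> c" "Poly_Mapping.keys c \<subseteq> B_set \<iota>" "\<forall>b. Poly_Mapping.lookup c b \<in> ZP"
    using assms(2) unfolding combs_def by blast
  have "\<iota> p * y = (\<Sum>b\<in>Poly_Mapping.keys c. \<iota> (p * Poly_Mapping.lookup c b) * b)"
    by (simp add: c(1) lincomb_def sum_distrib_left emb_simps mult.assoc)
  then show ?thesis
    using c assms(1) by (auto intro!: combs_sum combs_scaled ZP_0 ZP_mult)
qed

lemma combs_mult:
  assumes "y \<in> combs ZP" "y' \<in> combs ZP"
  shows "y * y' \<in> combs ZP"
proof -
  obtain c where c: "y = lincomb \<iota> c" "Poly_Mapping.keys c \<subseteq> B_set \<iota>" "\<forall>b. Poly_Mapping.lookup c b \<in> ZP"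
    using assms(1) unfolding combs_def by blast
  obtain d where d: "y' = lincomb \<iota> d" "Poly_Mapping.keys d \<subseteq> B_set \<iota>" "\<forall>b. Poly_Mapping.lookup d b \<in> ZP"
    using assms(2) unfolding combs_def by blast
  have "y * y' = (\<Sum>b\<in>Poly_Mapping.keys c. \<Sum>b'\<in>Poly_Mapping.keys d.
      \<iota> (Poly_Mapping.lookup c b) * (b * \<iota> (Poly_Mapping.lookup d b') * b'))"
    unfolding c(1) d(1) lincomb_def sum_product by (simp only: mult.assoc)
  moreover have "\<iota> (Poly_Mapping.lookup c b) * (b * \<iota> (Poly_Mapping.lookup d b') * b') \<in> combs ZP"
    if bb: "b \<in> Poly_Mapping.keys c" "b' \<in> Poly_Mapping.keys d" for b b'
  proof (rule combs_scale)
    obtain W where W: "b = \<iota> (awval W)"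
      using subsetD[OF c(2) bb(1)] unfolding B_set_eq by auto
    obtain e where "homog (awval W) e"
      using homog_awval by blast
    from homog_past_ZP[OF this d(3)[rule_format, of b']]
    obtain q where q: "q \<in> ZP" "awval W * Poly_Mapping.lookup d b' = q * awval W"
      by blast
    then have "b * \<iota> (Poly_Mapping.lookup d b') = \<iota> q * b"
      unfolding W by (simp only: emb_mult[OF frac, symmetric])
    moreover have "b * b' \<in> combs ZP"
    proof -
      have "ZP_nonneg \<subseteq> ZP"
        by (auto simp: ZP_nonneg_def)
      then show ?thesis
        using B_mult[OF subsetD[OF c(2) bb(1)] subsetD[OF d(2) bb(2)]] combs_mono by blast
    qed
    ultimately show "b * \<iota> (Poly_Mapping.lookup d b') * b' \<in> combs ZP"
      using combs_scale[OF q(1)] by (simp only: mult.assoc)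
  qed (rule c(3)[rule_format])
  ultimately show ?thesis
    by (simp only: combs_sum)
qed

lemma one_in_B: "1 \<in> B_set \<iota>"
proof -
  have "\<iota> (awval []) \<in> B_set \<iota>"
    unfolding B_set_eq by (auto simp: basic_def intro: exI[of _ "[]"])
  then show ?thesis
    by (simp add: emb_simps)
qed

lemma cluster_variables_B: "cluster_variables \<iota> \<subseteq> B_set \<iota>"
proof
  fix y assume "y \<in> cluster_variables \<iota>"
  then obtain S i where S: "S \<in> seeds \<iota>" "i \<in> {1, 2, 3}" "y = svar S i"
    by (auto simp: cluster_variables_def)
  then have "y \<in> cluster_monomials \<iota>"
    unfolding cluster_monomials_def
    by (intro CollectI exI[of _ S] exI[of _ "of_bool (i = 1)"] exI[of _ "of_bool (i = 2)"] exI[of _ "of_bool (i = 3)"]) auto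
  then show "y \<in> B_set \<iota>"
    by (simp add: B_set_def)
qed

lemma cluster_algebra_combs: "y \<in> cluster_algebra \<iota> \<Longrightarrow> y \<in> combs ZP"
proof (induction rule: cluster_algebra.induct)
  case (scalar p)
  then show ?case
    using combs_scaled[OF ZP_0 scalar one_in_B] by simp
next
  case (variable y)
  then show ?case
    using combs_scaled[OF ZP_0 ZP_1, of y] cluster_variables_B by (auto simp: emb_simps)
qed (simp_all add: combs_add ZP_add combs_mult)

section \<open>The basis elements lie in the cluster algebra\<close>

lemma cluster_algebra_power: "y \<in> cluster_algebra \<iota> \<Longrightarrow> y ^ n \<in> cluster_algebra \<iota>"
proof (induction n)
  case 0
  show ?case
    using cluster_algebra.scalar[OF ZP_1, of \<iota>] by (simp add: emb_simps)
qed (simp add: cluster_algebra.mult)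

lemma svar_cluster_algebra: "S \<in> seeds \<iota> \<Longrightarrow> i \<in> {1, 2, 3} \<Longrightarrow> svar S i \<in> cluster_algebra \<iota>"
  by (rule cluster_algebra.variable) (auto simp: cluster_variables_def)

lemma V_cluster_algebra: "\<iota> (V (m + 1)) \<in> cluster_algebra \<iota>"
proof -
  obtain S \<pi> where S: "S \<in> seeds \<iota>" "realizes \<iota> S (CB m) \<pi>"
    using cluster_realized[OF frac] by blast
  obtain i where i: "i \<in> {1, 2, 3}" "\<pi> i = 2"
    using realizesD(1)[OF frac S(2)] unfolding bij_betw_def by (metis imageE insertCI)
  have "svar S i = \<iota> (V (m + 1))"
    using realizesD(7)[OF frac S(2) i(1)] i(2) by simp
  then show ?thesis
    using svar_cluster_algebra[OF S(1) i(1)] by simp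
qed

lemma cluster_algebra_diff:
  "p \<in> ZP \<Longrightarrow> \<iota> s \<in> cluster_algebra \<iota> \<Longrightarrow> \<iota> t \<in> cluster_algebra \<iota> \<Longrightarrow> \<iota> (s - p * t) \<in> cluster_algebra \<iota>"
proof -
  assume "p \<in> ZP" "\<iota> s \<in> cluster_algebra \<iota>" "\<iota> t \<in> cluster_algebra \<iota>"
  moreover have "\<iota> (s - p * t) = \<iota> s + \<iota> (- p) * \<iota> t"
    by (simp add: emb_diff emb_uminus emb_simps)
  moreover have "- p \<in> ZP"
    using ZP_diff[OF ZP_0 \<open>p \<in> ZP\<close>] by simp
  ultimately show ?thesis
    by (auto intro!: cluster_algebra.add cluster_algebra.mult cluster_algebra.scalar)
qed

lemma u1_cluster_algebra: "\<iota> u1_elem \<in> cluster_algebra \<iota>"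
proof -
  have wz: "\<iota> (w_elem * z_elem) \<in> cluster_algebra \<iota>"
    using V_cluster_algebra[of 1] V_cluster_algebra[of 0] by (simp add: V_def emb_simps cluster_algebra.mult)
  have one: "\<iota> 1 \<in> cluster_algebra \<iota>"
    by (rule cluster_algebra.scalar[OF ZP_1])
  show ?thesis
    using cluster_algebra_diff[OF mon_ZP(2) cluster_algebra_diff[OF mon_ZP(2) wz one] one] by (simp add: u1_eq)
qed

lemma u_cluster_algebra: "\<iota> (u_elem n) \<in> cluster_algebra \<iota>"
proof (induction n rule: u_elem.induct)
  case 1
  show ?case
    using cluster_algebra.scalar[OF ZP_1, of \<iota>] by simp
next
  case 2
  show ?case
    using u1_cluster_algebra by simp
next
  case 3
  have "\<iota> (u1_elem * u1_elem) \<in> cluster_algebra \<iota>"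
    by (simp add: emb_simps cluster_algebra.mult u1_cluster_algebra)
  moreover have one: "\<iota> 1 \<in> cluster_algebra \<iota>"
    by (rule cluster_algebra.scalar[OF ZP_1])
  ultimately show ?case
    using cluster_algebra_diff[OF ZP_add[OF mon_ZP(2) mon_ZP(2)] _ one] by (simp add: u_elem_2)
next
  case (4 n)
  then have "\<iota> (u1_elem * u_elem (Suc (Suc n))) \<in> cluster_algebra \<iota>"
    by (simp add: emb_simps cluster_algebra.mult u1_cluster_algebra)
  then show ?case
    unfolding u_elem_Suc using 4 by (intro cluster_algebra_diff mon_ZP)
qed

lemma B_cluster_algebra: "B_set \<iota> \<subseteq> cluster_algebra \<iota>"
proof
  fix y assume "y \<in> B_set \<iota>"
  then consider "y \<in> cluster_monomials \<iota>" | "y \<in> uwz_elements \<iota>"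
    by (auto simp: B_set_def)
  then show "y \<in> cluster_algebra \<iota>"
  proof cases
    case 1
    then show ?thesis
      by (auto simp: cluster_monomials_def intro!: cluster_algebra.mult cluster_algebra_power svar_cluster_algebra)
  next
    case 2
    then show ?thesis
      using V_cluster_algebra[of 1] V_cluster_algebra[of 0]
      by (auto simp: uwz_elements_def V_def emb_simps intro!: cluster_algebra.mult cluster_algebra_power u_cluster_algebra)
  qed
qed

lemma B_independent:
  assumes c: "c \<in> coeffs_on (B_set \<iota>)" and 0: "lincomb \<iota> c = 0"
  shows "c = 0"
proof -
  have "\<forall>b\<in>B_set \<iota>. \<exists>W. basic W \<and> b = \<iota> (awval W)"
    by (auto simp: B_set_eq)
  then obtain w where w: "\<And>b. b \<in> B_set \<iota> \<Longrightarrow> basic (w b) \<and> b = \<iota> (awval (w b))"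
    by metis
  have keys: "Poly_Mapping.keys c \<subseteq> B_set \<iota>" and ZP: "\<And>b. Poly_Mapping.lookup c b \<in> ZP"
    using c by (auto simp: coeffs_on_def)
  have "\<iota> (\<Sum>b\<in>Poly_Mapping.keys c. Poly_Mapping.lookup c b * awval (w b)) = lincomb \<iota> c"
    unfolding lincomb_def emb_sum
  proof (rule sum.cong)
    fix b assume "b \<in> Poly_Mapping.keys c"
    then have "b = \<iota> (awval (w b))"
      using w keys by blast
    then show "\<iota> (Poly_Mapping.lookup c b * awval (w b)) = \<iota> (Poly_Mapping.lookup c b) * b"
      by (simp add: emb_simps)
  qed simp
  then have "\<iota> (\<Sum>b\<in>Poly_Mapping.keys c. Poly_Mapping.lookup c b * awval (w b)) = \<iota> 0"
    using 0 by (simp add: emb_simps)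
  then have sum: "(\<Sum>b\<in>Poly_Mapping.keys c. Poly_Mapping.lookup c b * awval (w b)) = 0"
    by (simp only: emb_eq[OF frac])
  have "inj_on (\<lambda>b. gw (w b)) (Poly_Mapping.keys c)"
    using w keys basic_eq by (intro inj_onI) (metis subsetD)
  then have "\<forall>b\<in>Poly_Mapping.keys c. Poly_Mapping.lookup c b = 0"
    using pointed_independent[OF finite_keys ZP pointed_awval _ sum] by blast
  then have "Poly_Mapping.lookup c b = 0" for b
    by (cases "b \<in> Poly_Mapping.keys c") (simp_all add: in_keys_iff)
  then show ?thesis
    by (intro poly_mapping_eqI) simp
qed

text \<open>Rewriting yields one nonnegative expansion of the product, and independence identifies
  any other expansion with it.\<close>

lemma B_positive: "positive_products \<iota> (B_set \<iota>)"
  unfolding positive_products_def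
proof (intro ballI impI allI)
  fix b b' c d
  assume b: "b \<in> B_set \<iota>" "b' \<in> B_set \<iota>" and c: "c \<in> coeffs_on (B_set \<iota>)" "lincomb \<iota> c = b * b'"
  obtain c' where c': "lincomb \<iota> c' = b * b'" "Poly_Mapping.keys c' \<subseteq> B_set \<iota>"
      "\<forall>b. Poly_Mapping.lookup c' b \<in> ZP_nonneg"
    using B_mult[OF b] unfolding combs_def by force
  have "c - c' \<in> coeffs_on (B_set \<iota>)"
    using c(1) c'(2,3) keys_diff[of c c'] by (auto simp: coeffs_on_def lookup_minus ZP_nonneg_def intro!: ZP_diff)
  moreover have "lincomb \<iota> (c - c') = 0"
    by (simp add: lincomb_diff c(2) c'(1))
  ultimately have "c - c' = 0"
    by (rule B_independent)
  then show "Poly_Mapping.lookup c d \<in> ZP_nonneg"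
    using c'(3) by simp
qed

lemma B_basis: "ZP_basis \<iota> (B_set \<iota>) (cluster_algebra \<iota>)"
  unfolding ZP_basis_def
proof (intro conjI ballI impI)
  show "B_set \<iota> \<subseteq> cluster_algebra \<iota>"
    by (rule B_cluster_algebra)
  fix y assume "y \<in> cluster_algebra \<iota>"
  then have "y \<in> combs ZP"
    by (rule cluster_algebra_combs)
  then show "\<exists>c\<in>coeffs_on (B_set \<iota>). lincomb \<iota> c = y"
    unfolding combs_def coeffs_on_def by blast
qed (rule B_independent)

end

theorem theorem4p3:
  fixes \<iota> :: "qtorus \<Rightarrow> 'f::division_ring"
  assumes "skew_field_of_fractions \<iota>"
  shows "cluster_monomials \<iota> \<inter> uwz_elements \<iota> = {}
    \<and> (\<forall>b\<in>B_set \<iota>. bar_fixed \<iota> b)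
    \<and> ZP_basis \<iota> (B_set \<iota>) (cluster_algebra \<iota>)
    \<and> positive_products \<iota> (B_set \<iota>)"
  using monomials_disjoint[OF assms] bar_fixed_B[OF assms] B_basis[OF assms] B_positive[OF assms] by blast

end
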